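(* For every $\alpha>2$ there is a countably connected domain $U_\alpha\subset\mathbb{S}^2$ with $\sum_{p\in\mathcal{C}(U_\alpha)}\operatorname{diam}(p)^\alpha<\infty$ such that the closed unit disk $\overline{\mathbb{D}}$ belongs to $\mathcal{C}_N(U_\alpha)$ but $\hat f(\overline{\mathbb{D}})\in\mathcal{C}_P(D)$ for every conformal homeomorphism $f:U_\alpha\to D$ onto a circle domain $D\subset\mathbb{S}^2$.
   Context: $\mathbb{S}^2$ is the Riemann sphere $\mathbb{C}\cup\{\infty\}$ with the spherical metric. For a domain $\Omega\subset\mathbb{S}^2$, $\mathcal{C}(\Omega)$ is the set of connected components of $\mathbb{S}^2\setminus\Omega$; $\mathcal{C}_N(\Omega)$ is the set of those with positive diameter and $\mathcal{C}_P(\Omega)$ the set of those with zero diameter. $\Omega$ is countably connected if $\mathcal{C}(\Omega)$ is countable. $\hat\Omega$ is the quotient space of $\mathbb{S}^2$ obtained by collapsing each $p\in\mathcal{C}(\Omega)$ to a point; $p$ is identified with its image in $\hat\Omega$. Every homeomorphism $f:\Omega\to D$ between domains in $\mathbb{S}^2$ extends to a homeomorphism $\hat f:\hat\Omega\to\hat D$. A domain $D\subset\mathbb{S}^2$ is a circle domain if each $p\in\mathcal{C}_N(D)$ is a (closed, round) disk. *)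

theory Defs
  imports "HOL-Analysis.Analysis"
begin

datatype riemann_sphere = Fin complex | Infty

primrec stereo :: "riemann_sphere \<Rightarrow> complex \<times> real" where
  "stereo (Fin z) = ((2 / (1 + (cmod z)\<^sup>2)) *\<^sub>R z, ((cmod z)\<^sup>2 - 1) / ((cmod z)\<^sup>2 + 1))"
| "stereo Infty = (0, 1)"

lemma norm_stereo [simp]: "norm (stereo x) = 1"
proof (cases x)
  case (Fin z)
  define t where "t = (cmod z)\<^sup>2"
  have t: "t \<ge> 0" by (simp add: t_def)
  have "(cmod ((2 / (1 + t)) *\<^sub>R z))\<^sup>2 = 4 * t / (1 + t)\<^sup>2"
    by (simp add: t_def power_mult_distrib power_divide)
  moreover have "4 * t / (1 + t)\<^sup>2 + ((t - 1) / (t + 1))\<^sup>2 = 1"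
  proof -
    have "4 * t / (1 + t)\<^sup>2 + ((t - 1) / (t + 1))\<^sup>2 = (4 * t + (t - 1)\<^sup>2) / (1 + t)\<^sup>2"
      by (simp add: power_divide add_divide_distrib add.commute)
    also have "4 * t + (t - 1)\<^sup>2 = (1 + t)\<^sup>2"
      by (simp add: power2_eq_square algebra_simps)
    finally show ?thesis using t by simp
  qed
  ultimately show ?thesis
    using Fin by (simp add: norm_prod_def t_def power_divide)
qed (simp add: norm_prod_def)

lemma inj_stereo: "inj stereo"
proof (rule injI)
  have pos: "t + 1 \<noteq> 0" if "t \<ge> 0" for t :: real using that by simp
  have tinj: "s = t" if "(s - 1) / (s + 1) = (t - 1) / (t + 1)" "s \<ge> 0" "t \<ge> 0" for s t :: real
  proof -
    have "(s - 1) * (t + 1) = (t - 1) * (s + 1)"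
      using that by (simp add: frac_eq_eq)
    then show ?thesis by (simp add: algebra_simps)
  qed
  have inf: "((cmod z)\<^sup>2 - 1) / ((cmod z)\<^sup>2 + 1) \<noteq> 1" for z
    using pos[of "(cmod z)\<^sup>2"] by (simp add: divide_eq_1_iff)
  fix x y assume eq: "stereo x = stereo y"
  show "x = y"
  proof (cases x; cases y)
    fix z w assume x: "x = Fin z" and y: "y = Fin w"
    then have t: "(cmod z)\<^sup>2 = (cmod w)\<^sup>2"
      using eq by (intro tinj[of "(cmod z)\<^sup>2" "(cmod w)\<^sup>2"]) simp_all
    have "(2 / (1 + (cmod z)\<^sup>2)) *\<^sub>R z = (2 / (1 + (cmod w)\<^sup>2)) *\<^sub>R w"
      using eq x y by simp
    then have "(2 / (1 + (cmod w)\<^sup>2)) *\<^sub>R z = (2 / (1 + (cmod w)\<^sup>2)) *\<^sub>R w"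
      by (simp only: t)
    moreover have "2 / (1 + (cmod w)\<^sup>2) \<noteq> 0"
      using pos[of "(cmod w)\<^sup>2"] by (simp add: add.commute)
    ultimately show ?thesis unfolding x y by (simp only: scaleR_cancel_left) blast
  next
    fix z assume "x = Fin z" "y = Infty"
    then show ?thesis using eq inf[of z] by simp
  next
    fix w assume "x = Infty" "y = Fin w"
    then show ?thesis using eq inf[of w] by simp
  qed simp
qed

lemma arccos_inner_triangle:
  fixes x y z :: "'a::real_inner"
  assumes "norm x = 1" "norm y = 1" "norm z = 1"
  shows "arccos (x \<bullet> z) \<le> arccos (x \<bullet> y) + arccos (y \<bullet> z)"
proof -
  have bd: "\<bar>u \<bullet> v\<bar> \<le> 1" if "norm u = 1" "norm v = 1" for u v :: 'a
    using Cauchy_Schwarz_ineq2[of u v] that by simp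
  have bd': "-1 \<le> u \<bullet> v" "u \<bullet> v \<le> 1" if "norm u = 1" "norm v = 1" for u v :: 'a
    using bd[OF that] by auto
  define a where "a = arccos (x \<bullet> y)"
  define b where "b = arccos (y \<bullet> z)"
  have cosa: "cos a = x \<bullet> y" and cosb: "cos b = y \<bullet> z"
    using bd'[OF assms(1,2)] bd'[OF assms(2,3)] by (simp_all add: a_def b_def)
  have nn: "0 \<le> a" "a \<le> pi" "0 \<le> b" "b \<le> pi"
    using bd'[OF assms(1,2)] bd'[OF assms(2,3)]
    by (simp_all add: a_def b_def arccos_lbound arccos_ubound)
  have sn: "0 \<le> sin a" "0 \<le> sin b"
    using nn by (auto intro: sin_ge_zero)
  define u where "u = x - (x \<bullet> y) *\<^sub>R y"
  define v where "v = z - (y \<bullet> z) *\<^sub>R y"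
  have un: "x \<bullet> x = 1" "y \<bullet> y = 1" "z \<bullet> z = 1"
    using assms by (simp_all add: dot_square_norm)
  have "u \<bullet> u = (sin a)\<^sup>2"
    unfolding sin_squared_eq cosa
    by (simp add: u_def inner_diff_left inner_diff_right un inner_commute power2_eq_square)
  then have nu: "norm u = sin a"
    using sn by (simp add: norm_eq_sqrt_inner)
  have "v \<bullet> v = (sin b)\<^sup>2"
    unfolding sin_squared_eq cosb
    by (simp add: v_def inner_diff_left inner_diff_right un inner_commute power2_eq_square)
  then have nv: "norm v = sin b"
    using sn by (simp add: norm_eq_sqrt_inner)
  have "x \<bullet> z = (x \<bullet> y) * (y \<bullet> z) + u \<bullet> v"
    by (simp add: u_def v_def inner_diff_left inner_diff_right un inner_commute)
  moreover have "- (sin a * sin b) \<le> u \<bullet> v"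
    using Cauchy_Schwarz_ineq2[of u v] nu nv by auto
  ultimately have ge: "cos (a + b) \<le> x \<bullet> z"
    by (simp add: cos_add cosa cosb)
  show ?thesis
  proof (cases "a + b \<le> pi")
    case True
    have "arccos (x \<bullet> z) \<le> arccos (cos (a + b))"
      using ge bd'[OF assms(1,3)] by (intro arccos_le_arccos) auto
    then show ?thesis
      using True nn by (simp add: arccos_cos a_def b_def)
  next
    case False
    then show ?thesis
      using arccos_ubound[of "x \<bullet> z"] bd'[OF assms(1,3)] by (simp add: a_def b_def)
  qed
qed

text \<open>The spherical metric: geodesic distance on the unit sphere, equivalently the length metric
  of $2|dz|/(1+|z|^2)$.\<close>

instantiation riemann_sphere :: metric_space
begin

definition dist_riemann_sphere :: "riemann_sphere \<Rightarrow> riemann_sphere \<Rightarrow> real" where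
  "dist_riemann_sphere x y = arccos (stereo x \<bullet> stereo y)"

definition uniformity_riemann_sphere :: "(riemann_sphere \<times> riemann_sphere) filter" where
  "uniformity_riemann_sphere = (INF e\<in>{0<..}. principal {(x, y). dist x y < e})"

definition open_riemann_sphere :: "riemann_sphere set \<Rightarrow> bool" where
  "open_riemann_sphere U \<longleftrightarrow> (\<forall>x\<in>U. \<forall>\<^sub>F (x', y) in uniformity. x' = x \<longrightarrow> y \<in> U)"

instance
proof
  fix x y z :: riemann_sphere
  have eq1: "stereo x \<bullet> stereo y = 1 \<longleftrightarrow> stereo x = stereo y"
  proof
    assume *: "stereo x \<bullet> stereo y = 1"
    have "(norm (stereo x - stereo y))\<^sup>2 = 0"
      unfolding power2_norm_eq_inner inner_diff_left inner_diff_right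
      by (simp only: * dot_square_norm inner_commute[of "stereo y" "stereo x"] norm_stereo one_power2 diff_self)
    then show "stereo x = stereo y" by simp
  next
    assume "stereo x = stereo y"
    then show "stereo x \<bullet> stereo y = 1"
      by (simp only: dot_square_norm norm_stereo one_power2)
  qed
  have "\<bar>stereo x \<bullet> stereo y\<bar> \<le> 1"
    using Cauchy_Schwarz_ineq2[of "stereo x" "stereo y"] by simp
  then have "cos (arccos (stereo x \<bullet> stereo y)) = stereo x \<bullet> stereo y"
    by (rule cos_arccos_abs)
  then have "arccos (stereo x \<bullet> stereo y) = 0 \<longleftrightarrow> stereo x \<bullet> stereo y = 1"
    by (metis arccos_1 cos_zero)
  then show "dist x y = 0 \<longleftrightarrow> x = y"
    by (simp add: dist_riemann_sphere_def eq1 inj_eq[OF inj_stereo])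
  show "dist x y \<le> dist x z + dist y z"
    using arccos_inner_triangle[of "stereo x" "stereo z" "stereo y"]
    by (simp add: dist_riemann_sphere_def inner_commute)
qed (simp_all add: uniformity_riemann_sphere_def open_riemann_sphere_def)

end

definition sphere_domain :: "riemann_sphere set \<Rightarrow> bool" where
  "sphere_domain \<Omega> \<longleftrightarrow> open \<Omega> \<and> connected \<Omega> \<and> \<Omega> \<noteq> {}"

definition comps :: "riemann_sphere set \<Rightarrow> riemann_sphere set set" where
  "comps \<Omega> = components (- \<Omega>)"

definition comps_N :: "riemann_sphere set \<Rightarrow> riemann_sphere set set" where
  "comps_N \<Omega> = {p \<in> comps \<Omega>. diameter p > 0}"

definition comps_P :: "riemann_sphere set \<Rightarrow> riemann_sphere set set" where
  "comps_P \<Omega> = {p \<in> comps \<Omega>. diameter p = 0}"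

definition countably_connected :: "riemann_sphere set \<Rightarrow> bool" where
  "countably_connected \<Omega> \<longleftrightarrow> countable (comps \<Omega>)"

text \<open>Closed round disks of the sphere (images of closed Euclidean disks, closed half-planes and
  complements of open Euclidean disks) are exactly the spherical balls of radius less than $\pi$.\<close>

definition closed_disk :: "riemann_sphere set \<Rightarrow> bool" where
  "closed_disk p \<longleftrightarrow> (\<exists>a r. 0 < r \<and> r < pi \<and> p = cball a r)"

definition circle_domain :: "riemann_sphere set \<Rightarrow> bool" where
  "circle_domain D \<longleftrightarrow> sphere_domain D \<and> (\<forall>p \<in> comps_N D. closed_disk p)"

definition unit_disk :: "riemann_sphere set" where
  "unit_disk = Fin ` cball 0 1"

text \<open>A conformal homeomorphism is a holomorphic one in the local coordinates (its derivative then
  vanishes nowhere and its inverse is holomorphic). \<open>chart a\<close> is a local coordinate near \<open>a\<close> (\<open>z\<close> at finite points, \<open>1/z\<close> at infinity), and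
  \<open>param a\<close> is its inverse. The value of \<open>chart a\<close> at the one point outside the coordinate
  neighbourhood is irrelevant, since only continuous maps are considered.\<close>

fun chart :: "riemann_sphere \<Rightarrow> riemann_sphere \<Rightarrow> complex" where
  "chart (Fin _) (Fin z) = z"
| "chart (Fin _) Infty = 0"
| "chart Infty (Fin z) = 1 / z"
| "chart Infty Infty = 0"

fun param :: "riemann_sphere \<Rightarrow> complex \<Rightarrow> riemann_sphere" where
  "param (Fin _) w = Fin w"
| "param Infty w = (if w = 0 then Infty else Fin (1 / w))"

definition sphere_holomorphic_on :: "(riemann_sphere \<Rightarrow> riemann_sphere) \<Rightarrow> riemann_sphere set \<Rightarrow> bool" where
  "sphere_holomorphic_on f \<Omega> \<longleftrightarrow> continuous_on \<Omega> f \<and>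
     (\<forall>a \<in> \<Omega>. (\<lambda>w. chart (f a) (f (param a w))) analytic_on {chart a a})"

definition conformal_homeo ::
    "riemann_sphere set \<Rightarrow> riemann_sphere set \<Rightarrow> (riemann_sphere \<Rightarrow> riemann_sphere) \<Rightarrow> bool" where
  "conformal_homeo \<Omega> D f \<longleftrightarrow> (\<exists>g. homeomorphism \<Omega> D f g) \<and> sphere_holomorphic_on f \<Omega>"

text \<open>The points of \<open>hat_space \<Omega>\<close> are the fibres of the collapsing map: singletons of points
  of \<open>\<Omega>\<close> and complementary components. So a component \<open>p \<in> comps \<Omega>\<close> is its own image in the
  quotient.\<close>

definition hat_proj :: "riemann_sphere set \<Rightarrow> riemann_sphere \<Rightarrow> riemann_sphere set" where
  "hat_proj \<Omega> x = (if x \<in> \<Omega> then {x} else connected_component_set (- \<Omega>) x)"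

definition hat_space :: "riemann_sphere set \<Rightarrow> riemann_sphere set topology" where
  "hat_space \<Omega> = topology (\<lambda>V. V \<subseteq> range (hat_proj \<Omega>) \<and> open (hat_proj \<Omega> -` V))"

lemma openin_hat_space:
  "openin (hat_space \<Omega>) V \<longleftrightarrow> V \<subseteq> range (hat_proj \<Omega>) \<and> open (hat_proj \<Omega> -` V)"
proof -
  have "istopology (\<lambda>V. V \<subseteq> range (hat_proj \<Omega>) \<and> open (hat_proj \<Omega> -` V))"
    unfolding istopology_def by (auto simp: vimage_Union)
  then show ?thesis
    by (simp add: hat_space_def topology_inverse')
qed

lemma topspace_hat_space: "topspace (hat_space \<Omega>) = range (hat_proj \<Omega>)"
proof (rule antisym)
  have "hat_proj \<Omega> -` range (hat_proj \<Omega>) = UNIV" by auto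
  then have "openin (hat_space \<Omega>) (range (hat_proj \<Omega>))"
    by (simp add: openin_hat_space)
  then show "range (hat_proj \<Omega>) \<subseteq> topspace (hat_space \<Omega>)"
    by (rule openin_subset)
  show "topspace (hat_space \<Omega>) \<subseteq> range (hat_proj \<Omega>)"
    using openin_topspace[of "hat_space \<Omega>"] by (simp only: openin_hat_space)
qed

lemma quotient_map_hat_proj: "quotient_map euclidean (hat_space \<Omega>) (hat_proj \<Omega>)"
  unfolding quotient_map_def topspace_hat_space openin_hat_space
  by (auto simp: vimage_def)

lemma range_hat_proj: "range (hat_proj \<Omega>) = (\<lambda>x. {x}) ` \<Omega> \<union> comps \<Omega>"
  by (auto simp: hat_proj_def comps_def components_def image_iff)

text \<open>The homeomorphism of the quotient spaces extending \<open>f\<close>. It exists for every homeomorphism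
  \<open>f\<close> between domains, and is unique as \<open>\<Omega>\<close> is dense in the Hausdorff space \<open>hat_space \<Omega>\<close>;
  extensionality fixes its values off \<open>topspace (hat_space \<Omega>)\<close>, so the description is proper.\<close>

definition hat_map :: "riemann_sphere set \<Rightarrow> riemann_sphere set \<Rightarrow>
    (riemann_sphere \<Rightarrow> riemann_sphere) \<Rightarrow> riemann_sphere set \<Rightarrow> riemann_sphere set" where
  "hat_map \<Omega> D f = (THE F. F \<in> extensional (topspace (hat_space \<Omega>)) \<and>
     homeomorphic_map (hat_space \<Omega>) (hat_space D) F \<and> (\<forall>x\<in>\<Omega>. F {x} = {f x}))"

end

theory Submission
  imports Defs "HOL-Complex_Analysis.Complex_Analysis"
begin

text \<open>Remove from the sphere the closed unit disk and, for each $k$, an arrangement of $k+1$ equal arcs of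
  the circle of radius $1 + 1/(k+1)$, leaving only tiny gaps. The arcs have diameter $O(1/k)$, so
  the sum of the $\alpha$-th powers of all diameters is comparable to $\sum_k k^{1-\alpha} < \infty$.

  Suppose that a circle domain conformally equivalent to this domain had a nondegenerate disk $B$
  corresponding to the unit disk, and normalise so that $B$ is a neighbourhood of $\infty$. Points have zero
  capacity, so when the gaps are small enough there is for each level $k$ a function equal to 1 inside and 0
  outside the $k$-th circle that jumps only across the arcs and has Dirichlet energy $O(1/k)$.
  Transported to the circle domain, it must change from 0 to 1 along each line of a fixed family of
  parallel lines; as the energy is small, for large $k$ the disks corresponding to the arcs of level $k$ block a
  definite proportion of these lines. There are $k+1$ of them, so the sum of their squared
  radii is at least $c/k$. Summing over $k$ contradicts the finiteness of area.\<close>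

section \<open>The spherical metric and rotations of the sphere\<close>

text \<open>The exponent 2 is borderline: radii of k + 1 disks with sum bounded below have squares
  of sum at least a multiple of 1/(k + 1), which just diverges, while k + 1 diameters of size 1/k
  leave a convergent sum for each \<alpha> > 2. The obstacle is the behaviour along a line in the
  plane of the circle domain: it crosses images of components of all levels and may meet the
  boundary in an uncontrolled set, where a transported function has no reason to be differentiable.
  The remedy is that the potential of level k is constant near each component of another level.
  Circles without slits separate circle k from the other circles, so these components lie in open
  sets that are unions of fibres of the collapsing map. Continuity of the induced map of quotient
  spaces makes the transported function locally constant around their images. It is therefore
  differentiable off the disks of level k, and the fundamental theorem of calculus applies on every
  line that misses them. In the source only the gaps are delicate, since there the two sides of a
  circle are joined; the potential is pinned to 1/2 on a ball covering the gap.\<close>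

definition homog :: "complex \<Rightarrow> complex \<Rightarrow> riemann_sphere" where
  "homog u v = (if v = 0 then Infty else Fin (u / v))"

lemma stereo_homog:
  assumes "u \<noteq> 0 \<or> v \<noteq> 0"
  shows "stereo (homog u v) = ((2 / ((cmod u)\<^sup>2 + (cmod v)\<^sup>2)) *\<^sub>R (u * cnj v),
           ((cmod u)\<^sup>2 - (cmod v)\<^sup>2) / ((cmod u)\<^sup>2 + (cmod v)\<^sup>2))"
proof (cases "v = 0")
  case True
  then show ?thesis using assms by (simp add: homog_def)
next
  case False
  define s where "s = (cmod u)\<^sup>2"
  define t where "t = (cmod v)\<^sup>2"
  have t: "t > 0" and s: "s \<ge> 0" using False by (auto simp: t_def s_def)
  have uv: "u / v = (1 / t) *\<^sub>R (u * cnj v)"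
    using False by (simp add: t_def scaleR_conv_of_real complex_norm_square field_simps flip: of_real_power)
  have n: "(cmod (u / v))\<^sup>2 = s / t"
    by (simp add: norm_divide power_divide s_def t_def)
  have 1: "2 * (1 / t) / (1 + s / t) = 2 / (s + t)"
    using t s by (simp add: divide_simps)
  have 2: "(s / t - 1) / (s / t + 1) = (s - t) / (s + t)"
    using t s by (simp add: divide_simps)
  show ?thesis
    using False unfolding homog_def stereo.simps n if_False if_not_P[OF False]
    unfolding uv by (simp add: 1 2 s_def[symmetric] t_def[symmetric] del: times_divide_eq_right)
qed

text \<open>Up to an affine change, the cosine of the spherical distance is the squared Hermitian
  product of the homogeneous coordinate vectors, divided by their squared norms. Unitary matrices
  therefore act as isometries, which is what \<open>dist_rot\<close> exploits.\<close>

lemma inner_stereo_homog: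
  assumes "u \<noteq> 0 \<or> v \<noteq> 0" "u' \<noteq> 0 \<or> v' \<noteq> 0"
  shows "stereo (homog u v) \<bullet> stereo (homog u' v') =
    2 * (cmod (u * cnj u' + v * cnj v'))\<^sup>2 /
      (((cmod u)\<^sup>2 + (cmod v)\<^sup>2) * ((cmod u')\<^sup>2 + (cmod v')\<^sup>2)) - 1"
proof -
  define s where "s = (cmod u)\<^sup>2 + (cmod v)\<^sup>2"
  define t where "t = (cmod u')\<^sup>2 + (cmod v')\<^sup>2"
  have s: "s > 0" and t: "t > 0"
    using assms by (auto simp: s_def t_def add_pos_nonneg add_nonneg_pos)
  have id: "4 * ((u * cnj v) \<bullet> (u' * cnj v')) + ((cmod u)\<^sup>2 - (cmod v)\<^sup>2) * ((cmod u')\<^sup>2 - (cmod v')\<^sup>2)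
     = 2 * (cmod (u * cnj u' + v * cnj v'))\<^sup>2 - s * t"
    unfolding s_def t_def cmod_power2 inner_complex_def
    by (simp add: power2_eq_square algebra_simps)
  have "stereo (homog u v) \<bullet> stereo (homog u' v') =
     (4 * ((u * cnj v) \<bullet> (u' * cnj v')) + ((cmod u)\<^sup>2 - (cmod v)\<^sup>2) * ((cmod u')\<^sup>2 - (cmod v')\<^sup>2)) / (s * t)"
    using s t by (simp add: stereo_homog[OF assms(1)] stereo_homog[OF assms(2)] inner_prod_def s_def[symmetric] t_def[symmetric] add_divide_distrib)
  also have "\<dots> = 2 * (cmod (u * cnj u' + v * cnj v'))\<^sup>2 / (s * t) - 1"
    unfolding id using s t by (simp add: diff_divide_distrib)
  finally show ?thesis by (simp add: s_def t_def)
qed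

lemma homog_fin: "homog z 1 = Fin z" by (simp add: homog_def)

lemma homog_scale: "c \<noteq> 0 \<Longrightarrow> homog (c * u) (c * v) = homog u v"
  by (simp add: homog_def)

lemma homog_exists: obtains u v where "(cmod u)\<^sup>2 + (cmod v)\<^sup>2 = 1" "x = homog u v"
proof (cases x)
  case Infty
  then show thesis using that[of 1 0] by (simp add: homog_def)
next
  case (Fin z)
  define c where "c = 1 / sqrt (1 + (cmod z)\<^sup>2)"
  have p: "1 + (cmod z)\<^sup>2 > 0" by (simp add: add_pos_nonneg)
  then have c: "c > 0" "c\<^sup>2 * (1 + (cmod z)\<^sup>2) = 1" by (simp_all add: c_def power_divide)
  show thesis
  proof (rule that)
    show "(cmod (of_real c * z))\<^sup>2 + (cmod (of_real c * 1))\<^sup>2 = 1"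
      using c by (simp add: norm_mult power_mult_distrib algebra_simps)
    show "x = homog (of_real c * z) (of_real c * 1)"
      using c Fin homog_scale[of "of_real c" z 1] by (simp add: homog_fin)
  qed
qed

lemma inner_stereo_Fin:
  "stereo (Fin z) \<bullet> stereo (Fin w) = 1 - 2 * (cmod (z - w))\<^sup>2 / ((1 + (cmod z)\<^sup>2) * (1 + (cmod w)\<^sup>2))"
proof -
  have p: "(1 + (cmod z)\<^sup>2) * (1 + (cmod w)\<^sup>2) > 0" by (simp add: add_pos_nonneg)
  have "(cmod (z * cnj w + 1))\<^sup>2 = (1 + (cmod z)\<^sup>2) * (1 + (cmod w)\<^sup>2) - (cmod (z - w))\<^sup>2"
    unfolding cmod_power2 by (simp add: power2_eq_square algebra_simps)
  moreover have "2 * (A - B) / A - 1 = 1 - 2 * B / A" if "A > 0" for A B :: real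
    using that by (simp add: field_simps)
  ultimately show ?thesis
    using p inner_stereo_homog[of z 1 w 1]
    by (simp add: homog_fin add.commute[of _ 1] del: stereo.simps)
qed

lemma inner_stereo_Fin_Infty: "stereo (Fin z) \<bullet> stereo Infty = ((cmod z)\<^sup>2 - 1) / ((cmod z)\<^sup>2 + 1)"
  by (simp add: inner_prod_def)

lemma inner_stereo_bounds: "-1 \<le> stereo x \<bullet> stereo y" "stereo x \<bullet> stereo y \<le> 1"
  using Cauchy_Schwarz_ineq2[of "stereo x" "stereo y"] by auto

lemma cos_dist_sphere: "cos (dist x y) = stereo x \<bullet> stereo y"
  unfolding dist_riemann_sphere_def using inner_stereo_bounds by (simp add: cos_arccos)

lemma dist_sphere_bounds: "0 \<le> dist x y" "dist x y \<le> pi" for x y :: riemann_sphere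
  unfolding dist_riemann_sphere_def using inner_stereo_bounds[of x y]
  by (auto simp: arccos_lbound arccos_ubound)

lemma dist_sphere_le_iff:
  assumes "0 \<le> r" "r \<le> pi"
  shows "dist x y \<le> r \<longleftrightarrow> cos r \<le> stereo x \<bullet> stereo y"
  unfolding cos_dist_sphere[symmetric]
  using cos_mono_le_eq[OF assms dist_sphere_bounds[of x y]] by simp

lemma norm_stereo_diff: "(norm (stereo x - stereo y))\<^sup>2 = 2 - 2 * cos (dist x y)"
proof -
  have "stereo x \<bullet> stereo x = 1" "stereo y \<bullet> stereo y = 1"
    by (simp_all only: dot_square_norm norm_stereo one_power2)
  then show ?thesis
    unfolding cos_dist_sphere power2_norm_eq_inner inner_diff_left inner_diff_right
    by (simp only: inner_commute[of "stereo y" "stereo x"])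
qed

text \<open>By the half-angle formula this reduces to sin y >= y/2 on [0, pi/2]. A crude constant
  suffices, since only comparability of arc and chord is wanted.\<close>

lemma cos_upper_bound:
  fixes x :: real
  assumes "0 \<le> x" "x \<le> pi"
  shows "cos x \<le> 1 - x\<^sup>2 / 8"
proof -
  define y where "y = x / 2"
  have y: "0 \<le> y" "y \<le> pi / 2" using assms by (auto simp: y_def)
  have "y / 2 \<le> sin y"
  \<comment> \<open>On [0, pi/3] the derivative cos t - 1/2 is nonnegative; beyond it sin y >= sqrt
    3 / 2 >= 0.8 >= y/2, as pi/2 <= 1.6.\<close>
  proof (cases "y \<le> pi / 3")
    case True
    have "0 - 0 / 2 \<le> sin y - y / 2"
    proof -
      have "(\<lambda>t. sin t - t / 2) 0 \<le> (\<lambda>t. sin t - t / 2) y"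
      proof (rule DERIV_nonneg_imp_nondecreasing[OF y(1)])
        fix t assume t: "0 \<le> t" "t \<le> y"
        have "cos t \<ge> cos (pi / 3)"
          using t True y by (intro cos_monotone_0_pi_le) auto
        then show "\<exists>d. ((\<lambda>t. sin t - t / 2) has_real_derivative d) (at t) \<and> 0 \<le> d"
          by (intro exI[of _ "cos t - 1/2"]) (auto intro!: derivative_eq_intros simp: cos_60)
      qed
      then show ?thesis by simp
    qed
    then show ?thesis by simp
  next
    case False
    have "sin (pi/3) \<le> sin y"
      using False y by (intro sin_monotone_2pi_le) auto
    moreover have "8 / 5 \<le> sqrt (3::real)"
      by (rule real_le_rsqrt) (simp add: power2_eq_square)
    moreover have "y \<le> 1.6" using y pi_less_4 pi_approx by simp
    ultimately show ?thesis by (simp add: sin_60)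
  qed
  then have "(y / 2)\<^sup>2 \<le> (sin y)\<^sup>2" using y by (intro power_mono) auto
  moreover have "cos x = 1 - 2 * (sin y)\<^sup>2"
    using cos_double_sin[of y] by (simp add: y_def)
  ultimately show ?thesis by (simp add: y_def power2_eq_square)
qed

lemma dist_sphere_le_norm: "dist x y \<le> 2 * norm (stereo x - stereo y)"
proof -
  have "(dist x y)\<^sup>2 \<le> (2 * norm (stereo x - stereo y))\<^sup>2"
    using cos_upper_bound[OF dist_sphere_bounds[of x y]]
    by (simp add: power_mult_distrib norm_stereo_diff)
  then show ?thesis by (rule power2_le_imp_le) simp
qed

lemma norm_le_dist_sphere: "norm (stereo x - stereo y) \<le> dist x y"
proof -
  have "1 - (dist x y)\<^sup>2 / 2 \<le> cos (dist x y)"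
  proof -
    define d where "d = dist x y / 2"
    have d: "0 \<le> d" "d \<le> pi" "dist x y = 2 * d" using dist_sphere_bounds[of x y] pi_gt_zero unfolding d_def by linarith+
    have "(sin d)\<^sup>2 \<le> d\<^sup>2"
      using sin_x_le_x[OF d(1)] sin_ge_zero[OF d(1,2)] by (rule power_mono)
    then show ?thesis unfolding d(3) cos_double_sin by simp
  qed
  then have "(norm (stereo x - stereo y))\<^sup>2 \<le> (dist x y)\<^sup>2"
    by (simp add: norm_stereo_diff)
  then show ?thesis by (rule power2_le_imp_le) simp
qed

lemma dist_Fin_le: "dist (Fin z) (Fin w) \<le> 4 * cmod (z - w)"
proof -
  have d: "1 \<le> (1 + (cmod z)\<^sup>2) * (1 + (cmod w)\<^sup>2)"
    using mult_mono[of 1 "1 + (cmod z)\<^sup>2" 1 "1 + (cmod w)\<^sup>2"] by simp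
  have "(norm (stereo (Fin z) - stereo (Fin w)))\<^sup>2 = 4 * (cmod (z - w))\<^sup>2 / ((1 + (cmod z)\<^sup>2) * (1 + (cmod w)\<^sup>2))"
    unfolding norm_stereo_diff cos_dist_sphere inner_stereo_Fin by simp
  also have "\<dots> \<le> 4 * (cmod (z - w))\<^sup>2 / 1"
    using d by (intro divide_left_mono) auto
  finally have "(norm (stereo (Fin z) - stereo (Fin w)))\<^sup>2 \<le> (2 * cmod (z - w))\<^sup>2"
    by (simp add: power_mult_distrib)
  then have "norm (stereo (Fin z) - stereo (Fin w)) \<le> 2 * cmod (z - w)"
    by (rule power2_le_imp_le) simp
  then show ?thesis using dist_sphere_le_norm[of "Fin z" "Fin w"] by linarith
qed

lemma continuous_on_Fin: "continuous_on S Fin"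
proof (rule continuous_on_subset[OF _ subset_UNIV], unfold continuous_on_iff, safe)
  fix x :: complex and e :: real assume "0 < e"
  then show "\<exists>d>0. \<forall>x'\<in>UNIV. dist x' x < d \<longrightarrow> dist (Fin x') (Fin x) < e"
    by (intro exI[of _ "e / 4"]) (auto simp: dist_norm intro: le_less_trans[OF dist_Fin_le])
qed

lemma continuous_on_stereo: "continuous_on S stereo"
  unfolding continuous_on_iff
  by (metis dist_norm le_less_trans norm_le_dist_sphere)

text \<open>Inverse of \<open>Fin\<close>, with the default value 0 at \<open>Infty\<close>
  inherited from \<open>chart\<close>. Quotients of homogeneous coordinates agree with it even for
  denominator 0.\<close>

definition unfin :: "riemann_sphere \<Rightarrow> complex" where
  "unfin x = chart (Fin 0) x"

lemma unfin_Fin [simp]: "unfin (Fin z) = z" by (simp add: unfin_def)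
lemma Fin_unfin: "x \<noteq> Infty \<Longrightarrow> Fin (unfin x) = x" by (cases x) auto

text \<open>The formula is stereographic projection from the north pole, z = x / (1 - h) for a point
  (x, h) of the unit sphere.\<close>

lemma continuous_on_unfin: "continuous_on (- {Infty}) unfin"
proof -
  have eq: "unfin x = (1 / (1 - snd (stereo x))) *\<^sub>R fst (stereo x) \<and> snd (stereo x) \<noteq> 1" if "x \<noteq> Infty" for x
  proof (cases x)
    case (Fin z)
    have p: "1 + (cmod z)\<^sup>2 > 0" by (simp add: add_pos_nonneg)
    then have p': "1 + (cmod z)\<^sup>2 \<noteq> 0" by linarith
    have "1 - (t - 1) / (t + 1) = 2 / (1 + t)" "(t - 1) / (t + 1) \<noteq> 1" if "1 + t > 0" for t :: real
      using that by (auto simp: field_simps)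
    note q = this[OF p]
    moreover have "snd (stereo x) \<noteq> 1"
      using q Fin by simp
    ultimately have "1 / (1 - ((cmod z)\<^sup>2 - 1) / ((cmod z)\<^sup>2 + 1)) * (2 / (1 + (cmod z)\<^sup>2)) = 1"
        and "snd (stereo x) \<noteq> 1"
      using p' by (simp_all only: q) simp
    then show ?thesis
      unfolding Fin stereo.simps fst_conv snd_conv unfin_Fin scaleR_scaleR by (metis scaleR_one)
  qed (use that in auto)
  have "continuous_on (- {Infty}) (\<lambda>x. (1 / (1 - snd (stereo x))) *\<^sub>R fst (stereo x))"
    using eq by (intro continuous_intros continuous_on_stereo) auto
  then show ?thesis
    by (rule continuous_on_eq) (use eq in auto)
qed

lemma open_not_Infty: "open (- {Infty :: riemann_sphere})" by (simp add: open_Compl)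

text \<open>The Moebius transformation of the matrix with rows (p, - cnj q) and (q, cnj p), unitary
  when |p|^2 + |q|^2 = 1. It sends \<open>Infty\<close> to \<open>homog p q\<close>, so infinity can
  be moved to any point.\<close>

definition rot :: "complex \<Rightarrow> complex \<Rightarrow> riemann_sphere \<Rightarrow> riemann_sphere" where
  "rot p q x = (case x of Fin z \<Rightarrow> homog (p * z - cnj q) (q * z + cnj p) | Infty \<Rightarrow> homog p q)"

lemma rot_homog:
  assumes "u \<noteq> 0 \<or> v \<noteq> 0"
  shows "rot p q (homog u v) = homog (p * u - cnj q * v) (q * u + cnj p * v)"
proof (cases "v = 0")
  case True
  then show ?thesis using assms homog_scale[of u p q] by (simp add: homog_def[of u 0] rot_def mult.commute)
next
  case False
  then have "homog (p * u - cnj q * v) (q * u + cnj p * v) = homog (p * (u / v) - cnj q) (q * (u / v) + cnj p)"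
    using homog_scale[of v "p * (u / v) - cnj q" "q * (u / v) + cnj p"]
    by (simp add: algebra_simps)
  then show ?thesis using False by (simp add: homog_def[of u v] rot_def)
qed

lemma cnj_mult_self: "(cmod p)\<^sup>2 + (cmod q)\<^sup>2 = 1 \<Longrightarrow> cnj p * p + cnj q * q = 1"
  by (metis complex_norm_square mult.commute of_real_1 of_real_add)

lemma rot_norm:
  assumes "(cmod p)\<^sup>2 + (cmod q)\<^sup>2 = 1"
  shows "(cmod (p * u - cnj q * v))\<^sup>2 + (cmod (q * u + cnj p * v))\<^sup>2 = (cmod u)\<^sup>2 + (cmod v)\<^sup>2"
proof -
  have "(cmod (p * u - cnj q * v))\<^sup>2 + (cmod (q * u + cnj p * v))\<^sup>2
    = ((cmod p)\<^sup>2 + (cmod q)\<^sup>2) * ((cmod u)\<^sup>2 + (cmod v)\<^sup>2)"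
    unfolding cmod_power2 by (simp add: power2_eq_square algebra_simps)
  then show ?thesis using assms by simp
qed

lemma rot_nonzero:
  assumes "(cmod p)\<^sup>2 + (cmod q)\<^sup>2 = 1" "u \<noteq> 0 \<or> v \<noteq> 0"
  shows "p * u - cnj q * v \<noteq> 0 \<or> q * u + cnj p * v \<noteq> 0"
proof (rule ccontr)
  assume "\<not> ?thesis"
  then have "(cmod u)\<^sup>2 + (cmod v)\<^sup>2 = 0"
    using rot_norm[OF assms(1), of u v] by simp
  then show False using assms(2) by (simp add: sum_power2_eq_zero_iff)
qed

text \<open>The parameters \<open>cnj p\<close> and \<open>- q\<close> belong to the conjugate
  transpose, which inverts a unitary matrix.\<close>

lemma rot_inverse:
  assumes pq: "(cmod p)\<^sup>2 + (cmod q)\<^sup>2 = 1"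
  shows "rot (cnj p) (- q) (rot p q x) = x"
proof -
  obtain u v where uv: "(cmod u)\<^sup>2 + (cmod v)\<^sup>2 = 1" "x = homog u v" by (rule homog_exists)
  then have nz: "u \<noteq> 0 \<or> v \<noteq> 0" by auto
  have 1: "cnj p * (p * u - cnj q * v) - cnj (- q) * (q * u + cnj p * v) = (cnj p * p + cnj q * q) * u"
    by (simp add: algebra_simps)
  have 2: "(- q) * (p * u - cnj q * v) + cnj (cnj p) * (q * u + cnj p * v) = (cnj p * p + cnj q * q) * v"
    by (simp add: algebra_simps)
  show ?thesis
    unfolding uv(2) rot_homog[OF nz] rot_homog[OF rot_nonzero[OF pq nz]] 1 2 cnj_mult_self[OF pq] by simp
qed

lemma dist_rot:
  assumes pq: "(cmod p)\<^sup>2 + (cmod q)\<^sup>2 = 1"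
  shows "dist (rot p q x) (rot p q y) = dist x y"
proof -
  obtain u v where uv: "(cmod u)\<^sup>2 + (cmod v)\<^sup>2 = 1" "x = homog u v" by (rule homog_exists)
  obtain u' v' where uv': "(cmod u')\<^sup>2 + (cmod v')\<^sup>2 = 1" "y = homog u' v'" by (rule homog_exists)
  have nz: "u \<noteq> 0 \<or> v \<noteq> 0" "u' \<noteq> 0 \<or> v' \<noteq> 0" using uv uv' by auto
  have "(p * u - cnj q * v) * cnj (p * u' - cnj q * v') + (q * u + cnj p * v) * cnj (q * u' + cnj p * v')
     = (cnj p * p + cnj q * q) * (u * cnj u' + v * cnj v')"
    by (simp add: algebra_simps)
  then show ?thesis
    unfolding dist_riemann_sphere_def uv(2) uv'(2) rot_homog[OF nz(1)] rot_homog[OF nz(2)]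
      inner_stereo_homog[OF rot_nonzero[OF pq nz(1)] rot_nonzero[OF pq nz(2)]]
      inner_stereo_homog[OF nz] rot_norm[OF pq] cnj_mult_self[OF pq] by simp
qed

section \<open>Neighbourhoods of complementary components\<close>

lemma rot_inverse':
  assumes pq: "(cmod p)\<^sup>2 + (cmod q)\<^sup>2 = 1"
  shows "rot p q (rot (cnj p) (- q) x) = x"
  using rot_inverse[of "cnj p" "- q" x] pq by simp

lemma continuous_on_rot:
  assumes "(cmod p)\<^sup>2 + (cmod q)\<^sup>2 = 1"
  shows "continuous_on S (rot p q)"
  unfolding continuous_on_iff dist_rot[OF assms] by blast

text \<open>\<open>rot 0 1\<close> sends z to -1/z, so it carries the closed unit disk to the
  complement of the open one; two compact sets cover the sphere.\<close>

lemma compact_sphere_UNIV: "compact (UNIV :: riemann_sphere set)"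
proof -
  have "x \<in> Fin ` cball 0 1 \<union> rot 0 1 ` Fin ` cball 0 1" for x
  proof (cases x)
    case Infty
    then show ?thesis by (auto simp: rot_def homog_def intro!: rev_image_eqI[of "Fin 0"])
  next
    case (Fin z)
    then show ?thesis
    proof (cases "cmod z \<le> 1")
      case False
      then have "x = rot 0 1 (Fin (- 1 / z))" "cmod (- 1 / z) \<le> 1"
        using Fin by (auto simp: rot_def homog_def norm_divide divide_le_eq_1)
      then show ?thesis by (metis UnI2 imageI mem_cball_0)
    qed simp
  qed
  then have "UNIV = Fin ` cball 0 1 \<union> rot 0 1 ` Fin ` cball 0 1" by blast
  also have "compact \<dots>"
    by (intro compact_Un compact_continuous_image continuous_on_rot continuous_on_Fin compact_cball) simp
  finally show ?thesis .
qed

lemma compact_sphere_closed: "closed S \<Longrightarrow> compact (S :: riemann_sphere set)"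
  using compact_Int_closed[OF compact_sphere_UNIV, of S] by simp

lemma bounded_sphere: "bounded (S :: riemann_sphere set)"
  using compact_imp_bounded[OF compact_sphere_UNIV] bounded_subset by blast

text \<open>Stereographic projection from an arbitrary point, obtained by rotating that point to
  infinity. It gives access to plane topology for subsets that omit the point.\<close>

lemma sphere_chart_exists:
  fixes o' :: riemann_sphere
  obtains N :: "complex \<Rightarrow> riemann_sphere" and M where "homeomorphism UNIV (- {o'}) N M"
proof -
  obtain p q where pq: "(cmod p)\<^sup>2 + (cmod q)\<^sup>2 = 1" "o' = homog p q" by (rule homog_exists)
  let ?N = "\<lambda>z. rot p q (Fin z)" and ?M = "\<lambda>x. unfin (rot (cnj p) (- q) x)"
  have pq': "(cmod (cnj p))\<^sup>2 + (cmod (- q))\<^sup>2 = 1" using pq by simp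
  have o: "rot p q Infty = o'" by (simp add: rot_def pq)
  have o2: "rot (cnj p) (- q) x = Infty \<longleftrightarrow> x = o'" for x
    using rot_inverse[OF pq(1)] rot_inverse'[OF pq(1)] o by metis
  have o3: "rot p q x = o' \<longleftrightarrow> x = Infty" for x
    using rot_inverse[OF pq(1)] o by metis
  have cN: "continuous_on UNIV ?N"
    by (rule continuous_on_compose2[OF continuous_on_rot[OF pq(1), of UNIV] continuous_on_Fin]) auto
  have "rot (cnj p) (- q) ` (- {o'}) \<subseteq> - {Infty}"
    by (intro image_subsetI) (simp add: o2)
  then have cM: "continuous_on (- {o'}) ?M"
    by (rule continuous_on_compose2[OF continuous_on_unfin continuous_on_rot[OF pq']])
  have "homeomorphism UNIV (- {o'}) ?N ?M"
  proof (rule homeomorphismI[OF cN cM])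
    show "range ?N \<subseteq> - {o'}" using o3 by (intro image_subsetI) simp
    show "?M (?N z) = z" for z by (simp add: rot_inverse[OF pq(1)])
    show "?N (?M x) = x" if "x \<in> - {o'}" for x
      using that by (simp add: o2 Fin_unfin rot_inverse'[OF pq(1)])
  qed auto
  then show thesis by (rule that)
qed

lemma large_points_near_Infty:
  assumes "0 < r"
  obtains R where "0 < R" "\<And>z. R \<le> cmod z \<Longrightarrow> dist (Fin z) Infty \<le> r"
proof -
  define \<rho> where "\<rho> = min r pi"
  have \<rho>: "0 < \<rho>" "\<rho> \<le> pi" "\<rho> \<le> r" using assms pi_gt_zero by (auto simp: \<rho>_def)
  have c: "cos \<rho> < 1" using cos_monotone_0_pi[of 0 \<rho>] \<rho> by simp
  \<comment> \<open>Chosen so that (t - 1) / (t + 1) >= cos \<rho> as soon as t >= R. The summand 1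
    ensures R >= 1, hence |z|^2 >= R whenever |z| >= R.\<close>
  define R where "R = 1 + 2 / (1 - cos \<rho>)"
  have R: "1 \<le> R" using c by (simp add: R_def)
  show thesis
  proof (rule that)
    show "0 < R" using R by simp
    fix z assume z: "R \<le> cmod z"
    define t where "t = (cmod z)\<^sup>2"
    have "R * 1 \<le> cmod z * cmod z" using z R by (intro mult_mono) auto
    then have tR: "R \<le> t" by (simp add: t_def power2_eq_square)
    have "2 / (1 - cos \<rho>) \<le> t + 1" using tR by (simp add: R_def)
    then have "2 \<le> (t + 1) * (1 - cos \<rho>)" using c by (simp add: pos_divide_le_eq)
    then have "cos \<rho> * (t + 1) \<le> t - 1" by (simp add: algebra_simps)
    moreover have "0 < t + 1" using tR R by simp
    ultimately have "cos \<rho> \<le> (t - 1) / (t + 1)" by (simp add: pos_le_divide_eq)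
    then have "dist (Fin z) Infty \<le> \<rho>"
      unfolding dist_sphere_le_iff[OF less_imp_le[OF \<rho>(1)] \<rho>(2)] inner_stereo_Fin_Infty t_def .
    then show "dist (Fin z) Infty \<le> r" using \<rho>(3) by simp
  qed
qed

text \<open>As the frontier of V misses K, both K \<inter> V and K - V are compact. A component of
  the complement of K \<inter> V lying inside K would lie in K - V and be closed as well as open,
  hence the whole space, against boundedness. So every component meets the connected set - K, and
  there is just one.\<close>

lemma connected_Compl_Int_if_frontier_disjoint:
  fixes K V :: "'a::euclidean_space set"
  assumes K: "compact K" and cU: "connected (- K)" and V: "frontier V \<inter> K = {}"
  shows "compact (K \<inter> V)" "connected (- (K \<inter> V))"
proof -
  have 1: "K \<inter> V = K \<inter> closure V" using V closure_Un_frontier[of V] by blast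
  have 2: "K - V = K \<inter> closure (- V)"
    using V closure_Un_frontier[of "- V"] by (auto simp: frontier_complement)
  show c1: "compact (K \<inter> V)" unfolding 1 using K by (simp add: compact_Int_closed)
  have c2: "compact (K - V)" unfolding 2 using K by (simp add: compact_Int_closed)
  let ?O = "- (K \<inter> V)"
  have opO: "open ?O" using c1 using compact_imp_closed by blast
  have meet: "C \<inter> - K \<noteq> {}" if C: "C \<in> components ?O" for C
  proof
    assume "C \<inter> - K = {}"
    moreover have "C \<subseteq> ?O" using C in_components_subset by blast
    ultimately have CK: "C \<subseteq> K - V" by blast
    then have clK: "closure C \<subseteq> K - V" using c2 by (simp add: closure_minimal compact_imp_closed)
    have "connected (closure C)" using C in_components_connected connected_imp_connected_closure by blast
    moreover have "closure C \<subseteq> ?O" using clK by blast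
    moreover have "C \<inter> closure C \<noteq> {}"
      using closure_subset[of C] in_components_nonempty[OF C] by auto
    ultimately have "closure C \<subseteq> C"
      by (rule components_maximal[OF C])
    then have "closed C" by (metis closed_closure closure_subset subset_antisym)
    moreover have "open C" using C opO open_components by blast
    ultimately have "C = UNIV" using clopen[of C] in_components_nonempty[OF C] by simp
    then have "UNIV \<subseteq> K" using CK by auto
    then have "bounded (UNIV :: 'a set)" by (rule bounded_subset[OF compact_imp_bounded[OF K]])
    then show False by (simp add: not_bounded_UNIV)
  qed
  show "connected ?O"
  proof (subst connected_iff_eq_connected_component_set, intro ballI)
    fix x assume x: "x \<in> ?O"
    have "\<exists>y\<in>-K. y \<in> connected_component_set ?O x" if "x \<in> ?O" for x
      using meet[of "connected_component_set ?O x"] that by (auto simp: components_def)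
    note ex = this
    have "connected_component ?O x z" if z: "z \<in> ?O" for z
    proof -
      obtain y y' where y: "y \<in> - K" "connected_component ?O x y" "y' \<in> - K" "connected_component ?O z y'"
        using ex[OF x] ex[OF z] by auto
      have "connected_component ?O y y'"
        using cU y by (meson Compl_anti_mono Int_lower1 connected_component_def)
      then show ?thesis using y by (meson connected_component_sym connected_component_trans)
    qed
    then show "connected_component_set ?O x = ?O"
      using connected_component_subset by fastforce
  qed
qed

text \<open>By the Sura-Bura theorem p has arbitrarily small relatively clopen neighbourhoods A in
  K. A thin open tube around A has its frontier off K, and V is the component of the tube that
  contains p. Neither K \<inter> V nor the complement of V separates the space, and two disjoint
  closed nonseparating sets do not separate together, so V - K is connected.\<close>

lemma planar_component_neighbourhood:
  fixes K p W :: "'a::euclidean_space set"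
  assumes K: "compact K" and cU: "connected (- K)" and p: "p \<in> components K"
    and W: "open W" "p \<subseteq> W"
  obtains V where "open V" "bounded V" "p \<subseteq> V" "closure V \<subseteq> W" "frontier V \<inter> K = {}"
    "connected (V - K)" "V - K \<noteq> {}"
proof -
  have cp: "compact p" using compact_components K p by blast
  have pne: "p \<noteq> {}" "p \<subseteq> K" "connected p"
    using p in_components_nonempty in_components_subset in_components_connected by blast+
  obtain A where A: "openin (top_of_set K) A" "compact A" "p \<subseteq> A" "A \<subseteq> W"
    using Sura_Bura_clopen_subset[OF closed_imp_locally_compact[OF compact_imp_closed[OF K]] p cp W] by blast
  obtain G where G: "open G" "A = K \<inter> G" using A(1) by (auto simp: openin_open)
  \<comment> \<open>All that the closure of the tube must avoid: the rest of K and the outside of W.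
    Its distance from A is at least e, and the tube has radius e / 2.\<close>
  define B where "B = (K - A) \<union> - W"
  have "K - A = K \<inter> - G" using G by blast
  then have "closed B" unfolding B_def using K G W by (simp add: closed_Un closed_Compl compact_imp_closed closed_Int)
  moreover have AB: "A \<inter> B = {}" using A by (auto simp: B_def)
  ultimately obtain e where e: "e > 0" "\<And>x y. x \<in> A \<Longrightarrow> y \<in> B \<Longrightarrow> e \<le> dist x y"
    using separate_compact_closed[of A B] A by blast
  define V0 where "V0 = {y. infdist y A < e / 2}"
  have A0: "A \<noteq> {}" using A pne by blast
  have opV0: "open V0" unfolding V0_def
    by (intro open_Collect_less continuous_intros)
  have "closed {y. infdist y A \<le> e / 2}" by (intro closed_Collect_le continuous_intros)
  then have clV0: "closure V0 \<subseteq> {y. infdist y A \<le> e / 2}"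
    by (intro closure_minimal) (auto simp: V0_def)
  have att: "\<exists>x\<in>A. infdist y A = dist y x" for y
    using infdist_attains_inf[of A y] A A0 compact_imp_closed by blast
  have clB: "closure V0 \<inter> B = {}"
  proof (rule ccontr)
    assume "closure V0 \<inter> B \<noteq> {}"
    then obtain y where y: "y \<in> closure V0" "y \<in> B" by blast
    obtain x where "x \<in> A" "infdist y A = dist y x" using att by blast
    then show False using e(2)[of x y] y clV0 e(1) by (auto simp: dist_commute)
  qed
  have AV0: "A \<subseteq> V0" using e by (auto simp: V0_def infdist_zero)
  have bV0: "bounded V0"
  proof -
    obtain a R where R: "\<forall>x\<in>A. dist a x \<le> R" using compact_imp_bounded[OF A(2)] by (auto simp: bounded_def)
    have "dist a y \<le> R + e" if "y \<in> V0" for y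
    proof -
      obtain x where "x \<in> A" "infdist y A = dist y x" using att by blast
      then show ?thesis using that R dist_triangle[of a y x] e by (force simp: V0_def dist_commute)
    qed
    then show ?thesis unfolding bounded_def by blast
  qed
  have fV0: "frontier V0 \<inter> K = {}"
    using clB AV0 opV0 by (auto simp: B_def frontier_def interior_open)
  obtain x0 where x0: "x0 \<in> p" using pne by blast
  define V where "V = connected_component_set V0 x0"
  have Vc: "V \<in> components V0" using x0 A AV0 by (auto simp: V_def components_def)
  have opV: "open V" using Vc opV0 open_components by blast
  have pV: "p \<subseteq> V" unfolding V_def
    by (rule connected_component_maximal) (use x0 A AV0 pne in auto)
  have VV0: "V \<subseteq> V0" using Vc in_components_subset by blast
  have fV: "frontier V \<inter> K = {}"
    using frontier_of_components_subset[OF Vc] fV0 by blast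
  have bV: "bounded V" using bV0 VV0 bounded_subset by blast
  have clV: "closure V \<subseteq> W" using closure_mono[OF VV0] clB by (auto simp: B_def)
  have "connected (- ((K \<inter> V) \<union> (- V)))"
    using connected_Compl_Int_if_frontier_disjoint[OF K cU fV] opV Vc
    by (intro separation_by_Un_closed) (auto simp: compact_imp_closed in_components_connected)
  moreover have "- ((K \<inter> V) \<union> (- V)) = V - K" by blast
  ultimately have con: "connected (V - K)" by simp
  \<comment> \<open>If V were inside K, its frontier would be both in K and off K, so V would be
    clopen, nonempty and bounded.\<close>
  have "V - K \<noteq> {}"
  proof
    assume "V - K = {}"
    then have "closure V \<subseteq> K" using K by (simp add: closure_minimal compact_imp_closed)
    then have "frontier V = {}" using fV by (auto simp: frontier_def)
    then have "V = {} \<or> V = UNIV" by (simp add: frontier_eq_empty)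
    then show False using bV pV pne not_bounded_UNIV by auto
  qed
  with that opV bV pV clV fV con show thesis by blast
qed

lemma chart_image_eq_vimage:
  assumes "\<And>z. M (N z) = z" "\<And>x. x \<noteq> o' \<Longrightarrow> N (M x) = x" "T \<subseteq> - {o'}"
  shows "M ` T = N -` T"
proof
  show "M ` T \<subseteq> N -` T" using assms(2,3) by (auto simp: subset_iff)
  show "N -` T \<subseteq> M ` T" using assms(1) by (metis image_eqI subsetI vimageE)
qed

lemma chart_image_image:
  assumes "\<And>x. x \<noteq> o' \<Longrightarrow> N (M x) = x" "T \<subseteq> - {o'}"
  shows "N ` (M ` T) = T"
proof -
  have "N (M x) = x" if "x \<in> T" for x using assms(1)[of x] assms(2) that by blast
  then show ?thesis by (simp add: image_image cong: image_cong)
qed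

lemma chart_image_eq:
  assumes "\<And>z. M (N z) = z" "\<And>x. x \<noteq> o' \<Longrightarrow> N (M x) = x" "\<And>z. N z \<noteq> o'"
  shows "N ` T = - {o'} \<inter> M -` T"
  using assms by (auto simp: image_iff) (metis assms(2))

text \<open>A chart omitting a point outside U makes U a connected open plane set, from which one
  point can be deleted. The purpose is to delete from a domain the point that the chart of
  \<open>comps_neighbourhood\<close> omits.\<close>

lemma sphere_open_connected_delete:
  assumes U: "open U" "connected U" "U \<noteq> (UNIV :: riemann_sphere set)"
  shows "connected (U - {a})"
proof -
  obtain o' where o': "o' \<notin> U" using U by blast
  obtain N :: "complex \<Rightarrow> riemann_sphere" and M where NM: "homeomorphism UNIV (- {o'}) N M"
    by (rule sphere_chart_exists[of o'])
  note cN = homeomorphism_cont1[OF NM] and cM = homeomorphism_cont2[OF NM]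
  have Uo: "U \<subseteq> - {o'}" using o' by auto
  have MN: "M (N z) = z" for z using NM by (simp add: homeomorphism_def)
  have NM': "N (M x) = x" if "x \<noteq> o'" for x using NM that by (simp add: homeomorphism_def)
  have MU: "M ` U = N -` U"
    using MN NM' Uo by (rule chart_image_eq_vimage)
  have op: "open (M ` U)" unfolding MU using U(1) cN by (rule open_vimage)
  have con: "connected (M ` U)"
    using U Uo cM by (meson connected_continuous_image continuous_on_subset)
  show ?thesis
  proof (cases "a \<in> U")
    case True
    have "connected (M ` U - {M a})" by (rule connected_open_delete[OF op con]) simp
    then have "connected (N ` (M ` U - {M a}))"
      using cN connected_continuous_image continuous_on_subset by blast
    moreover have NMx: "N (M x) = x" if "x \<in> U" for x using NM'[of x] o' that by auto
    have "N ` (M ` U - {M a}) = U - {a}"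
    proof
      show "N ` (M ` U - {M a}) \<subseteq> U - {a}" using NMx by auto
      show "U - {a} \<subseteq> N ` (M ` U - {M a})"
      proof
        fix x assume x: "x \<in> U - {a}"
        then have "M x \<in> M ` U - {M a}" using NMx[OF True] NMx[of x] by auto
        then show "x \<in> N ` (M ` U - {M a})" using NMx[of x] x by (metis DiffD1 imageI)
      qed
    qed
    ultimately show ?thesis by simp
  next
    case False
    then show ?thesis using U by simp
  qed
qed

lemma comps_facts:
  assumes "open U" "p \<in> comps U"
  shows "compact p" "connected p" "p \<noteq> {}" "p \<subseteq> - U"
proof -
  have p: "p \<in> components (- U)" using assms by (simp add: comps_def)
  then show "connected p" "p \<noteq> {}" "p \<subseteq> - U"
    using in_components_nonempty in_components_subset in_components_connected by blast+
  show "compact p"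
    using compact_sphere_closed[OF closed_components[OF _ p]] assms by (simp add: closed_Compl)
qed

text \<open>A chart that omits a point of U turns the complement of U into a compact plane set with
  connected complement, to which the planar statement applies. Connectedness of V \<inter> U is what
  later keeps the images of points near p from accumulating at two different components.\<close>

lemma comps_neighbourhood:
  assumes U: "sphere_domain U" and p: "p \<in> comps U" and W: "open W" "p \<subseteq> W"
  obtains V where "open V" "p \<subseteq> V" "closure V \<subseteq> W" "frontier V \<inter> - U = {}"
    "connected (V \<inter> U)" "V \<inter> U \<noteq> {}"
proof -
  have oU: "open U" "connected U" "U \<noteq> {}" using U by (auto simp: sphere_domain_def)
  note pf = comps_facts[OF oU(1) p]
  obtain o' where o': "o' \<in> U" using oU by blast
  obtain N :: "complex \<Rightarrow> riemann_sphere" and M where NM: "homeomorphism UNIV (- {o'}) N M"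
    by (rule sphere_chart_exists[of o'])
  note cN = homeomorphism_cont1[OF NM] and cM = homeomorphism_cont2[OF NM]
  have MN [simp]: "M (N z) = z" for z using NM by (simp add: homeomorphism_def)
  have NM' [simp]: "N (M x) = x" if "x \<noteq> o'" for x using NM that by (simp add: homeomorphism_def)
  have No [simp]: "N z \<noteq> o'" for z using NM by (auto simp: homeomorphism_def)
  have Ko: "- U \<subseteq> - {o'}" using o' by auto
  have ext: "M ` T = N -` T" if "T \<subseteq> - {o'}" for T
    using MN NM' that by (rule chart_image_eq_vimage)
  have NMT: "N ` (M ` T) = T" if "T \<subseteq> - {o'}" for T
    using NM' that by (rule chart_image_image)
  define K where "K = M ` (- U)"
  have K: "compact K" unfolding K_def
    using oU(1) compact_sphere_closed[of "- U"] continuous_on_subset[OF cM Ko]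
    by (intro compact_continuous_image) (auto simp: closed_Compl)
  have "- K = M ` (U - {o'})"
    unfolding K_def using ext[OF Ko] ext[of "U - {o'}"] by auto
  moreover have "connected (U - {o'})"
    using sphere_open_connected_delete oU pf by blast
  ultimately have cK: "connected (- K)"
    using connected_continuous_image continuous_on_subset[OF cM, of "U - {o'}"] by auto
  have po: "p \<subseteq> - {o'}" using pf Ko by blast
  \<comment> \<open>Components are maximal connected subsets, and the chart carries connected sets
    over in both directions.\<close>
  have p': "M ` p \<in> components K"
  proof (rule in_components_maximal[THEN iffD2], intro conjI allI impI)
    show "M ` p \<noteq> {}" "M ` p \<subseteq> K" using pf by (auto simp: K_def)
    show "connected (M ` p)"
      using connected_continuous_image continuous_on_subset[OF cM po] pf by blast
    fix c assume c: "c \<noteq> {} \<and> M ` p \<subseteq> c \<and> c \<subseteq> K \<and> connected c"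
    have "connected (N ` c)" using c cN connected_continuous_image continuous_on_subset by blast
    moreover have "N ` c \<subseteq> - U" using c NMT[OF Ko] by (force simp: K_def)
    moreover have "p \<subseteq> N ` c" using c NMT[OF po] by blast
    moreover have "\<forall>d. d \<noteq> {} \<and> p \<subseteq> d \<and> d \<subseteq> - U \<and> connected d \<longrightarrow> d = p"
      using p in_components_maximal[of p "- U"] by (simp add: comps_def)
    moreover have "N ` c \<noteq> {}" using c by simp
    ultimately have eq: "N ` c = p" by metis
    show "c = M ` p" unfolding eq[symmetric] by (simp add: image_image)
  qed
  have W': "open (N -` W)" "M ` p \<subseteq> N -` W"
    using open_vimage[OF W(1) cN] W(2) ext[OF po] by auto
  obtain V where V: "open V" "bounded V" "M ` p \<subseteq> V" "closure V \<subseteq> N -` W" "frontier V \<inter> K = {}"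
    "connected (V - K)" "V - K \<noteq> {}"
    using planar_component_neighbourhood[OF K cK p' W'] by blast
  have NV: "N ` T = - {o'} \<inter> M -` T" for T
    using MN NM' No by (rule chart_image_eq)
  have opNV: "open (N ` V)"
    unfolding NV using cM V(1) by (intro continuous_open_preimage) auto
  have "compact (N ` closure V)"
    using continuous_on_subset[OF cN subset_UNIV] V(2) by (intro compact_continuous_image) simp_all
  then have clNV: "closure (N ` V) \<subseteq> N ` closure V"
    using image_mono[OF closure_subset[of V], of N] by (intro closure_minimal compact_imp_closed)
  have e1: "N ` (V - K) = N ` V \<inter> (U)"
  proof
    have K': "z \<in> K \<longleftrightarrow> N z \<notin> U" for z unfolding K_def ext[OF Ko] by simp
    show "N ` (V - K) \<subseteq> N ` V \<inter> U"
      by (rule image_subsetI) (simp add: K')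
    show "N ` V \<inter> U \<subseteq> N ` (V - K)"
    proof
      fix x assume "x \<in> N ` V \<inter> U"
      then obtain z where "z \<in> V" "x = N z" "x \<in> U" by blast
      then show "x \<in> N ` (V - K)" using K'[of z] by simp
    qed
  qed
  show thesis
  proof (rule that)
    show "open (N ` V)" by fact
    show "p \<subseteq> N ` V" using image_mono[OF V(3), of N] NMT[OF po] by simp
    have "N ` closure V \<subseteq> W" using V(4) by (simp add: image_subset_iff_subset_vimage)
    then show "closure (N ` V) \<subseteq> W" using clNV by (rule order_trans[rotated])
    show "frontier (N ` V) \<inter> - U = {}"
    proof (rule ccontr)
      assume "frontier (N ` V) \<inter> - U \<noteq> {}"
      then obtain x where x: "x \<in> closure (N ` V)" "x \<notin> N ` V" "x \<notin> U"
        using opNV by (auto simp: frontier_def interior_open)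
      then obtain z where z: "x = N z" "z \<in> closure V" using clNV by blast
      then have "z \<in> frontier V" using x V(1) by (auto simp: frontier_def interior_open)
      moreover have "z \<in> K" using z x unfolding K_def ext[OF Ko] by auto
      ultimately show False using V(5) by blast
    qed
    show "connected (N ` V \<inter> U)"
      using V(6) cN unfolding e1[symmetric] by (meson connected_continuous_image continuous_on_subset subset_UNIV)
    show "N ` V \<inter> U \<noteq> {}" using V(7) e1 by blast
  qed
qed

section \<open>Extension of homeomorphisms to the quotient spaces\<close>

instance riemann_sphere :: heine_borel
proof
  fix f :: "nat \<Rightarrow> riemann_sphere"
  show "\<exists>l r. strict_mono r \<and> (f \<circ> r) \<longlonglongrightarrow> l"
    using compact_imp_seq_compact[OF compact_sphere_UNIV] unfolding seq_compact_def by blast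
qed

lemma hat_proj_mem: "x \<in> hat_proj U x"
  by (simp add: hat_proj_def)

lemma hat_proj_comps: "x \<notin> U \<Longrightarrow> hat_proj U x \<in> comps U"
  by (auto simp: hat_proj_def comps_def components_def)

lemma hat_proj_eq_comp: "p \<in> comps U \<Longrightarrow> x \<in> p \<Longrightarrow> hat_proj U x = p"
  unfolding comps_def
  by (metis ComplD connected_component_in components_iff connected_component_eq hat_proj_def mem_Collect_eq)

lemma comps_not_singleton:
  assumes "p \<in> comps U" "x \<in> U" shows "p \<noteq> {x}"
  using assms in_components_subset[of p "- U"] by (auto simp: comps_def)

lemma comps_disjoint: "p \<in> comps U \<Longrightarrow> q \<in> comps U \<Longrightarrow> p \<noteq> q \<Longrightarrow> p \<inter> q = {}"
  unfolding comps_def using components_nonoverlap by blast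

lemma component_subset_if_frontier_disjoint:
  assumes "frontier V \<inter> - U = {}" "p \<in> comps U" "p \<inter> V \<noteq> {}"
  shows "p \<subseteq> V"
proof (rule ccontr)
  assume "\<not> p \<subseteq> V"
  then have "p \<inter> frontier V \<noteq> {}"
    using assms in_components_connected[of p "- U"] by (intro connected_Int_frontier) (auto simp: comps_def)
  then show False using assms in_components_subset[of p "- U"] by (auto simp: comps_def)
qed

text \<open>A frontier inside U means that V is a union of fibres of \<open>hat_proj\<close>, so
  that it is open in the quotient as well.\<close>

definition end_nbhd :: "riemann_sphere set \<Rightarrow> riemann_sphere set \<Rightarrow> riemann_sphere set \<Rightarrow> bool" where
  "end_nbhd U p V \<longleftrightarrow> open V \<and> p \<subseteq> V \<and> frontier V \<inter> - U = {} \<and> connected (V \<inter> U) \<and> V \<inter> U \<noteq> {}"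

lemma end_nbhd_exists:
  assumes "sphere_domain U" "p \<in> comps U" "open W" "p \<subseteq> W"
  obtains V where "end_nbhd U p V" "closure V \<subseteq> W"
  using comps_neighbourhood[OF assms] unfolding end_nbhd_def by metis

text \<open>The clause on W says that f tends to q at p. The last clause serves the components close
  to another component: they lie in a neighbourhood V of it, their values meet the closure of f(V
  \<inter> U), and so these values are caught by the same saturated open set.\<close>

definition ends_at :: "riemann_sphere set \<Rightarrow> riemann_sphere set \<Rightarrow> (riemann_sphere \<Rightarrow> riemann_sphere)
    \<Rightarrow> riemann_sphere set \<Rightarrow> riemann_sphere set \<Rightarrow> bool" where
  "ends_at U D f p q \<longleftrightarrow> q \<in> comps D \<and>
     (\<forall>W. open W \<and> q \<subseteq> W \<longrightarrow> (\<exists>V. end_nbhd U p V \<and> closure (f ` (V \<inter> U)) \<subseteq> W)) \<and>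
     (\<forall>V. open V \<and> p \<subseteq> V \<longrightarrow> closure (f ` (V \<inter> U)) \<inter> q \<noteq> {})"

lemma homeomorphism_open_image:
  assumes "homeomorphism U D f g" "open D" "open S" "S \<subseteq> U"
  shows "open (f ` S)"
proof -
  have "openin (top_of_set U) S" using assms by (auto simp: openin_open)
  then have "openin (top_of_set D) (f ` S)" by (rule homeomorphism_imp_open_map[OF assms(1)])
  then show ?thesis using assms(2) by (rule openin_open_trans)
qed

text \<open>Along end neighbourhoods shrinking to p, the closures of the images are nested compact
  sets with intersection \<open>Cl\<close>. It misses D because f is open onto D. It lies in one
  component because connected images cannot cross a frontier contained in D that they eventually
  avoid.\<close>

lemma ends_at_exists:
  assumes U: "sphere_domain U" and D: "sphere_domain D" and fg: "homeomorphism U D f g"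
    and p: "p \<in> comps U"
  obtains q where "ends_at U D f p q"
proof -
  have oU: "open U" and oD: "open D" using U D by (auto simp: sphere_domain_def)
  note pf = comps_facts[OF oU p]
  let ?B = "\<lambda>n. {x. infdist x p < 1 / real (Suc n)}"
  let ?P = "\<lambda>n V. end_nbhd U p V \<and> closure V \<subseteq> (?B n)"
  have opn: "open (?B n)" for n
    by (intro open_Collect_less continuous_intros)
  have "\<exists>V. \<forall>n. ?P n (V n) \<and> V (Suc n) \<subseteq> V n"
  proof (rule dependent_nat_choice)
    show "\<exists>V. ?P 0 V"
      using end_nbhd_exists[OF U p opn[of 0]] by (auto simp: infdist_zero subset_iff)
    fix V n assume V: "?P n V"
    have "open (V \<inter> (?B (Suc n)))" using V opn[of "Suc n"] by (auto simp: end_nbhd_def)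
    moreover have "p \<subseteq> V \<inter> (?B (Suc n))"
      using V by (auto simp: end_nbhd_def infdist_zero)
    ultimately obtain V' where "end_nbhd U p V'" "closure V' \<subseteq> V \<inter> (?B (Suc n))"
      using end_nbhd_exists[OF U p] by metis
    then show "\<exists>V'. ?P (Suc n) V' \<and> V' \<subseteq> V" using closure_subset[of V'] by blast
  qed
  then obtain V where V: "\<And>n. end_nbhd U p (V n)"
    "\<And>n. closure (V n) \<subseteq> (?B n)" "\<And>n. V (Suc n) \<subseteq> V n" by blast
  have anti: "V n \<subseteq> V m" if "m \<le> n" for m n
    using V(3) lift_Suc_antimono_le[of V m n] that by blast
  have small: "\<exists>n. closure (V n) \<subseteq> W" if W: "open W" "p \<subseteq> W" for W
  proof -
    have "p \<inter> - W = {}" using W by blast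
    then have "\<exists>e>0. \<forall>x\<in>p. \<forall>y\<in>- W. e \<le> dist x y"
      using pf W by (intro separate_compact_closed) (auto simp: closed_Compl)
    then obtain e where e: "e > 0" "\<And>x y. x \<in> p \<Longrightarrow> y \<in> - W \<Longrightarrow> e \<le> dist x y" by metis
    obtain n where n: "1 / real (Suc n) < e" using e reals_Archimedean[of e] by (auto simp: inverse_eq_divide)
    have "x \<in> W" if "infdist x p < 1 / real (Suc n)" for x
    proof (rule ccontr)
      assume "x \<notin> W"
      obtain y where "y \<in> p" "infdist x p = dist x y"
        using infdist_attains_inf[of p x] pf compact_imp_closed by blast
      then show False using e(2)[of y x] \<open>x \<notin> W\<close> that n by (simp add: dist_commute)
    qed
    then show ?thesis using V(2)[of n] by blast
  qed
  define F where "F n = closure (f ` (V n \<inter> U))" for n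
  have F: "compact (F n)" "F n \<noteq> {}" for n
    using V(1)[of n] compact_sphere_closed[OF closed_closure, of "f ` (V n \<inter> U)"]
    by (auto simp: F_def end_nbhd_def simp del: compact_closure)
  have Fanti: "F n \<subseteq> F m" if "m \<le> n" for m n
    using anti[OF that] by (auto simp: F_def intro!: closure_mono)
  define Cl where "Cl = \<Inter> (range F)"
  have "Cl \<noteq> {}" unfolding Cl_def using F Fanti by (rule compact_nest)
  then obtain y0 where y0: "y0 \<in> Cl" by blast
  have ClD: "y \<notin> D" if y: "y \<in> Cl" for y
  proof
    assume yD: "y \<in> D"
    have gy: "g y \<in> U" "f (g y) = y" using fg yD by (auto simp: homeomorphism_def)
    \<comment> \<open>The neighbourhoods of p eventually stay away from g y, while the image of the
      remaining part of U is an open neighbourhood of y.\<close>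
    have "open (- {g y})" "p \<subseteq> - {g y}" using pf gy by auto
    then obtain n where n: "closure (V n) \<subseteq> - {g y}" using small by blast
    have op: "open (f ` (U - closure (V n)))"
      by (rule homeomorphism_open_image[OF fg oD]) (auto simp: oU open_Diff)
    have "y \<in> f ` (U - closure (V n))" using gy n by (metis ComplD DiffI imageI singletonI subsetD)
    moreover have "f ` (U - closure (V n)) \<inter> f ` (V n \<inter> U) = {}"
    proof -
      have "inj_on f U" using fg by (metis homeomorphism_def inj_on_inverseI)
      then show ?thesis using closure_subset[of "V n"] by (auto simp: inj_on_def)
    qed
    ultimately have "y \<notin> F n" using op open_Int_closure_eq_empty[OF op, of "f ` (V n \<inter> U)"] unfolding F_def by blast
    then show False using y by (auto simp: Cl_def)
  qed
  define q where "q = hat_proj D y0"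
  have q: "q \<in> comps D" unfolding q_def using ClD[OF y0] by (rule hat_proj_comps)
  note qf = comps_facts[OF oD q]
  have Clq: "Cl \<subseteq> q"
  proof
    fix y assume y: "y \<in> Cl"
    show "y \<in> q"
    proof (rule ccontr)
      assume "y \<notin> q"
      then have "open (- {y})" "q \<subseteq> - {y}" by auto
      then obtain V' where V': "end_nbhd D q V'" "closure V' \<subseteq> - {y}"
        using end_nbhd_exists[OF D q] by metis
      \<comment> \<open>The frontier of V' is compact in D, so it corresponds to a compact subset of
        U, away from p. For large n the connected image of the trace of \<open>V n\<close> misses
        this frontier, although it has points inside V' near y0 and outside V' near y.\<close>
      have cfr: "compact (g ` frontier V')"
        using V' homeomorphism_cont2[OF fg]
        by (intro compact_continuous_image) (auto simp: end_nbhd_def compact_sphere_closed intro: continuous_on_subset)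
      have gU: "g ` frontier V' \<subseteq> U" using V' fg by (auto simp: end_nbhd_def homeomorphism_def)
      have "open (- (g ` frontier V'))" "p \<subseteq> - (g ` frontier V')"
        using cfr gU pf by (auto simp: compact_imp_closed open_Compl)
      then obtain n where n: "closure (V n) \<subseteq> - (g ` frontier V')" using small by blast
      have dis: "f ` (V n \<inter> U) \<inter> frontier V' = {}"
      proof (rule ccontr)
        assume "f ` (V n \<inter> U) \<inter> frontier V' \<noteq> {}"
        then obtain x where x: "x \<in> V n" "x \<in> U" "f x \<in> frontier V'" by blast
        then have "x \<in> g ` frontier V'" using fg by (metis homeomorphism_apply1 imageI)
        then show False using n x closure_subset by blast
      qed
      have con: "connected (f ` (V n \<inter> U))"
        using V(1)[of n] homeomorphism_cont1[OF fg]
        by (intro connected_continuous_image) (auto simp: end_nbhd_def intro: continuous_on_subset)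
      have "y0 \<in> V'" using V' hat_proj_mem[of y0 D] by (auto simp: end_nbhd_def q_def)
      moreover have opV': "open V'" using V' by (simp add: end_nbhd_def)
      moreover have "y0 \<in> closure (f ` (V n \<inter> U))" "y \<in> closure (f ` (V n \<inter> U))"
        using y0 y by (auto simp: Cl_def F_def)
      note ycl = this
      ultimately have 1: "f ` (V n \<inter> U) \<inter> V' \<noteq> {}"
        using open_Int_closure_eq_empty[OF opV', of "f ` (V n \<inter> U)"] by auto
      have "- closure V' \<inter> closure (f ` (V n \<inter> U)) \<noteq> {}"
        using V'(2) ycl(2) by auto
      then have "- closure V' \<inter> f ` (V n \<inter> U) \<noteq> {}"
        using open_Int_closure_eq_empty[of "- closure V'" "f ` (V n \<inter> U)"] by auto
      then have 2: "f ` (V n \<inter> U) - V' \<noteq> {}"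
        using closure_subset[of V'] by blast
      show False using connected_Int_frontier[OF con 1 2] dis by blast
    qed
  qed
  have "\<exists>V. end_nbhd U p V \<and> closure (f ` (V \<inter> U)) \<subseteq> W" if W: "open W" "q \<subseteq> W" for W
  proof -
    have "\<exists>n. F n \<subseteq> W"
    proof (rule ccontr)
      assume "\<not> ?thesis"
      then have ne: "F n \<inter> - W \<noteq> {}" for n by blast
      have "\<Inter> (range (\<lambda>n. F n \<inter> - W)) \<noteq> {}"
      proof (rule compact_nest)
        show "compact (F n \<inter> - W)" for n using F(1) W(1) by (simp add: compact_Int_closed closed_Compl)
        show "F n \<inter> - W \<subseteq> F m \<inter> - W" if "m \<le> n" for m n using Fanti[OF that] by blast
      qed (rule ne)
      then obtain y where "y \<in> Cl" "y \<notin> W" by (auto simp: Cl_def)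
      then show False using Clq W by blast
    qed
    then show ?thesis using V(1) F_def by blast
  qed
  moreover have "closure (f ` (W \<inter> U)) \<inter> q \<noteq> {}" if W: "open W" "p \<subseteq> W" for W
  proof -
    obtain n where "closure (V n) \<subseteq> W" using small W by blast
    then have "F n \<subseteq> closure (f ` (W \<inter> U))"
      unfolding F_def using closure_subset[of "V n"] by (intro closure_mono) blast
    then show ?thesis using y0 Clq unfolding Cl_def by blast
  qed
  ultimately have "ends_at U D f p q" using q by (auto simp: ends_at_def)
  then show thesis by (rule that)
qed

text \<open>A component is never a singleton {x} with x in U, so the two branches do not compete;
  \<open>the_elem\<close> recovers the point of a singleton fibre.\<close>

definition hat_ext :: "riemann_sphere set \<Rightarrow> riemann_sphere set \<Rightarrow> (riemann_sphere \<Rightarrow> riemann_sphere)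
    \<Rightarrow> riemann_sphere set \<Rightarrow> riemann_sphere set" where
  "hat_ext U D f P = (if \<exists>x\<in>U. P = {x} then {f (the_elem P)} else SOME q. ends_at U D f P q)"

lemma hat_ext_singleton [simp]: "x \<in> U \<Longrightarrow> hat_ext U D f {x} = {f x}"
  by (simp add: hat_ext_def)

lemma hat_ext_ends_at:
  assumes "sphere_domain U" "sphere_domain D" "homeomorphism U D f g" "p \<in> comps U"
  shows "ends_at U D f p (hat_ext U D f p)"
proof -
  have "\<not> (\<exists>x\<in>U. p = {x})" using comps_not_singleton[OF assms(4)] by blast
  then show ?thesis using ends_at_exists[OF assms] by (auto simp: hat_ext_def intro: someI)
qed

text \<open>Continuity is tested on the sphere, through the quotient map. Close to a component,
  points of U are handled by the limit clause of \<open>ends_at\<close> and other components by its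
  closure clause.\<close>

lemma continuous_hat_ext:
  assumes U: "sphere_domain U" and D: "sphere_domain D" and fg: "homeomorphism U D f g"
  shows "continuous_map (hat_space U) (hat_space D) (hat_ext U D f)"
proof (rule continuous_compose_quotient_map[OF quotient_map_hat_proj])
  let ?E = "hat_ext U D f \<circ> hat_proj U"
  have oU: "open U" and oD: "open D" using U D by (auto simp: sphere_domain_def)
  have in1: "?E x = {f x}" if "x \<in> U" for x using that by (simp add: hat_proj_def)
  have in2: "ends_at U D f (hat_proj U x) (?E x)" if "x \<notin> U" for x
    using hat_ext_ends_at[OF assms hat_proj_comps[OF that]] by simp
  have fU: "f ` U = D" using fg by (simp add: homeomorphism_def)
  show "continuous_map euclidean (hat_space D) ?E"
    unfolding continuous_map_def
  proof (intro conjI allI impI)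
    show "?E \<in> topspace euclidean \<rightarrow> topspace (hat_space D)"
    proof
      fix x show "?E x \<in> topspace (hat_space D)"
      proof (cases "x \<in> U")
        case True
        then show ?thesis using in1 fU by (auto simp: topspace_hat_space range_hat_proj)
      next
        case False
        then show ?thesis using in2 by (auto simp: topspace_hat_space range_hat_proj ends_at_def)
      qed
    qed
    fix W assume "openin (hat_space D) W"
    then have W: "open (hat_proj D -` W)" by (simp add: openin_hat_space)
    have sat: "q \<in> W \<longleftrightarrow> q \<subseteq> hat_proj D -` W" "q \<in> W \<longleftrightarrow> q \<inter> hat_proj D -` W \<noteq> {}" if "q \<in> comps D" for q
      using hat_proj_eq_comp[OF that] comps_facts(3)[OF oD that] by auto
    have "open {x. ?E x \<in> W}"
    proof (subst open_subopen, intro ballI)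
      fix x assume x: "x \<in> {x. ?E x \<in> W}"
      show "\<exists>T. open T \<and> x \<in> T \<and> T \<subseteq> {x. ?E x \<in> W}"
      proof (cases "x \<in> U")
        case True
        have "open (U \<inter> f -` (hat_proj D -` W))"
          using homeomorphism_cont1[OF fg] oU W by (rule continuous_open_preimage)
        moreover have "z \<in> U \<inter> f -` (hat_proj D -` W) \<longleftrightarrow> z \<in> U \<and> ?E z \<in> W" for z
          using in1[of z] fU by (auto simp: hat_proj_def)
        ultimately show ?thesis using x True by blast
      next
        case False
        note e = in2[OF False]
        have q: "?E x \<in> comps D" using e by (simp add: ends_at_def)
        then have "?E x \<subseteq> hat_proj D -` W" using sat x by blast
        then obtain V where V: "end_nbhd U (hat_proj U x) V" "closure (f ` (V \<inter> U)) \<subseteq> hat_proj D -` W"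
          using e W unfolding ends_at_def by blast
        have "?E z \<in> W" if z: "z \<in> V" for z
        proof (cases "z \<in> U")
          case True
          then have "f z \<in> f ` (V \<inter> U)" using z by blast
          then have "f z \<in> hat_proj D -` W" using V(2) closure_subset[of "f ` (V \<inter> U)"] by blast
          then show ?thesis using in1[OF True] fU True by (auto simp: hat_proj_def)
        next
          case False
          have "hat_proj U z \<subseteq> V"
            using V(1) z hat_proj_mem[of z U] unfolding end_nbhd_def
            by (intro component_subset_if_frontier_disjoint[OF _ hat_proj_comps[OF False]]) auto
          then have "closure (f ` (V \<inter> U)) \<inter> ?E z \<noteq> {}"
            using in2[OF False] V(1) unfolding ends_at_def end_nbhd_def by blast
          then show ?thesis using V(2) sat(2)[of "?E z"] in2[OF False] unfolding ends_at_def by blast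
        qed
        moreover have "x \<in> V" using V(1) hat_proj_mem[of x U] by (auto simp: end_nbhd_def)
        ultimately show ?thesis using V(1) unfolding end_nbhd_def by blast
      qed
    qed
    then show "openin euclidean {x \<in> topspace euclidean. ?E x \<in> W}" by simp
  qed
qed

text \<open>A component that meets V cannot leave it without crossing the frontier, so V is a union
  of fibres.\<close>

lemma openin_hat_saturated:
  assumes "open V" "frontier V \<inter> - U = {}"
  shows "openin (hat_space U) (hat_proj U ` V)" "hat_proj U -` (hat_proj U ` V) = V"
proof -
  show "hat_proj U -` (hat_proj U ` V) = V"
  proof safe
    fix x y assume xy: "hat_proj U x = hat_proj U y" "y \<in> V"
    show "x \<in> V"
    proof (cases "y \<in> U")
      case True
      then show ?thesis using xy hat_proj_mem[of x U] by (auto simp: hat_proj_def[of U y])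
    next
      case False
      have "hat_proj U y \<subseteq> V"
        using component_subset_if_frontier_disjoint[OF assms(2) hat_proj_comps[OF False]] xy hat_proj_mem[of y U] by blast
      then show ?thesis using xy hat_proj_mem[of x U] by auto
    qed
  qed auto
  then show "openin (hat_space U) (hat_proj U ` V)" using assms by (auto simp: openin_hat_space)
qed

text \<open>A component is separated from any other fibre by the images of an end neighbourhood V
  and of the exterior of V, both of which are saturated.\<close>

lemma Hausdorff_hat_space:
  assumes U: "sphere_domain U"
  shows "Hausdorff_space (hat_space U)"
proof -
  have oU: "open U" using U by (auto simp: sphere_domain_def)
  have sep: "\<exists>A B. openin (hat_space U) A \<and> openin (hat_space U) B \<and> P \<in> A \<and> Q \<in> B \<and> disjnt A B"
    if PQ: "P \<in> comps U" "Q \<in> topspace (hat_space U)" "P \<noteq> Q" for P Q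
  proof -
    have Qc: "closed Q" "P \<inter> Q = {}" "Q \<noteq> {}"
    proof -
      consider x where "x \<in> U" "Q = {x}" | "Q \<in> comps U" using PQ by (auto simp: topspace_hat_space range_hat_proj)
      then have "closed Q \<and> P \<inter> Q = {} \<and> Q \<noteq> {}"
      proof cases
        case 1
        then show ?thesis using comps_facts(4)[OF oU PQ(1)] by auto
      next
        case 2
        then show ?thesis using comps_facts[OF oU 2] comps_disjoint[OF PQ(1) 2 PQ(3)] by (auto simp: compact_imp_closed)
      qed
      then show "closed Q" "P \<inter> Q = {}" "Q \<noteq> {}" by auto
    qed
    then have "open (- Q)" "P \<subseteq> - Q" by auto
    then obtain V where V: "end_nbhd U P V" "closure V \<subseteq> - Q" using end_nbhd_exists[OF U PQ(1)] by metis
    have fV: "open V" "frontier V \<inter> - U = {}" "P \<subseteq> V" using V by (auto simp: end_nbhd_def)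
    \<comment> \<open>Passing to the closure can only lose frontier points, so the exterior of V has
      its frontier in U too.\<close>
    have "frontier (closure V) \<subseteq> frontier V"
      using fV(1) closure_subset[of V] by (auto simp: frontier_def interior_open) (metis closure_subset interior_maximal subsetD)
    then have fC: "open (- closure V)" "frontier (- closure V) \<inter> - U = {}"
      using fV by (auto simp: frontier_complement)
    obtain x y where x: "x \<in> P" "P = hat_proj U x" and y: "y \<in> Q" "Q = hat_proj U y"
      using PQ comps_facts(3)[OF oU PQ(1)] hat_proj_eq_comp[OF PQ(1)] hat_proj_mem[of _ U] Qc
      unfolding topspace_hat_space by (metis all_not_in_conv imageE)
    show ?thesis
    proof (intro exI conjI)
      show "openin (hat_space U) (hat_proj U ` V)" "openin (hat_space U) (hat_proj U ` (- closure V))"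
        using openin_hat_saturated(1) fV fC by blast+
      show "P \<in> hat_proj U ` V" using x fV by blast
      show "Q \<in> hat_proj U ` (- closure V)" using y V(2) by blast
      show "disjnt (hat_proj U ` V) (hat_proj U ` (- closure V))"
        using openin_hat_saturated(2)[OF fV(1,2)] openin_hat_saturated(2)[OF fC] closure_subset[of V]
        unfolding disjnt_def by blast
    qed
  qed
  have sep': "\<exists>A B. openin (hat_space U) A \<and> openin (hat_space U) B \<and> {x} \<in> A \<and> {y} \<in> B \<and> disjnt A B"
    if xy: "x \<in> U" "y \<in> U" "x \<noteq> y" for x y
  proof -
    obtain A B where AB: "open A" "open B" "x \<in> A" "y \<in> B" "A \<inter> B = {}" using xy separation_t2 by metis
    have im: "hat_proj U ` (A \<inter> U) = (\<lambda>x. {x}) ` (A \<inter> U)" for A by (auto simp: hat_proj_def)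
    have op: "openin (hat_space U) (hat_proj U ` (A \<inter> U))" if A: "open A" for A
    proof -
      have "hat_proj U -` (hat_proj U ` (A \<inter> U)) = A \<inter> U"
        unfolding im using hat_proj_mem[of _ U] by (auto simp: hat_proj_def[of U])
          (metis hat_proj_def hat_proj_mem singletonD)+
      then show ?thesis using A oU by (auto simp: openin_hat_space)
    qed
    show ?thesis
      using op[OF AB(1)] op[OF AB(2)] AB xy
      by (intro exI[of _ "hat_proj U ` (A \<inter> U)"] exI[of _ "hat_proj U ` (B \<inter> U)"]) (auto simp: im disjnt_def)
  qed
  show ?thesis
    unfolding Hausdorff_space_def
  proof (intro allI impI)
    fix P Q assume PQ: "P \<in> topspace (hat_space U) \<and> Q \<in> topspace (hat_space U) \<and> P \<noteq> Q"
    then have "P \<in> comps U \<or> (\<exists>x\<in>U. P = {x})" "Q \<in> comps U \<or> (\<exists>x\<in>U. Q = {x})"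
      by (auto simp: topspace_hat_space range_hat_proj)
    then show "\<exists>A B. openin (hat_space U) A \<and> openin (hat_space U) B \<and> P \<in> A \<and> Q \<in> B \<and> disjnt A B"
      using sep[of P Q] sep[of Q P] sep' PQ by (metis disjnt_sym)
  qed
qed

lemma hat_space_dense:
  assumes U: "sphere_domain U"
  shows "hat_space U closure_of ((\<lambda>x. {x}) ` U) = topspace (hat_space U)"
proof -
  have oU: "open U" using U by (auto simp: sphere_domain_def)
  have "\<exists>x\<in>U. {x} \<in> T" if T: "openin (hat_space U) T" "P \<in> T" for T P
  proof -
    have "P \<in> topspace (hat_space U)" using T openin_subset by blast
    then consider x where "x \<in> U" "P = {x}" | "P \<in> comps U" by (auto simp: topspace_hat_space range_hat_proj)
    then show ?thesis
    proof cases
      case 2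
      have "open (hat_proj U -` T)" "P \<subseteq> hat_proj U -` T"
        using T hat_proj_eq_comp[OF 2] by (auto simp: openin_hat_space)
      then obtain V where V: "end_nbhd U P V" "closure V \<subseteq> hat_proj U -` T" using end_nbhd_exists[OF U 2] by metis
      then obtain x where "x \<in> V" "x \<in> U" by (auto simp: end_nbhd_def)
      then have "hat_proj U x \<in> T" using V(2) closure_subset[of V] by blast
      then show ?thesis using \<open>x \<in> U\<close> by (auto simp: hat_proj_def)
    qed (use T in blast)
  qed
  then show ?thesis
    unfolding closure_of_def by blast
qed

text \<open>The two extensions are inverse to each other because their composites fix the dense set
  of singletons and the spaces are Hausdorff. Uniqueness in the definite description holds for the
  same reason, so the explicit \<open>hat_ext\<close> can replace \<open>hat_map\<close>.\<close>

lemma hat_map_eq: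
  assumes U: "sphere_domain U" and D: "sphere_domain D" and fg: "homeomorphism U D f g"
  shows "hat_map U D f = restrict (hat_ext U D f) (topspace (hat_space U))"
    and "homeomorphic_maps (hat_space U) (hat_space D) (hat_ext U D f) (hat_ext D U g)"
proof -
  have gf: "homeomorphism D U g f" using fg by (rule homeomorphism_symD)
  have fD: "f ` U = D" "g ` D = U" using fg by (auto simp: homeomorphism_def)
  have inv: "hat_ext D U g (hat_ext U D f P) = P"
    if U: "sphere_domain U" and D: "sphere_domain D" and fg: "homeomorphism U D f g"
      and P: "P \<in> topspace (hat_space U)" for U D f g P
  proof (rule forall_in_closure_of_eq[of P "hat_space U" "(\<lambda>x. {x}) ` U" "hat_space U" "\<lambda>P. hat_ext D U g (hat_ext U D f P)" "\<lambda>P. P"])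
    have gf: "homeomorphism D U g f" using fg by (rule homeomorphism_symD)
    show "P \<in> hat_space U closure_of ((\<lambda>x. {x}) ` U)" using P hat_space_dense[OF U] by simp
    show "Hausdorff_space (hat_space U)" by (rule Hausdorff_hat_space[OF U])
    show "continuous_map (hat_space U) (hat_space U) (\<lambda>P. hat_ext D U g (hat_ext U D f P))"
      using continuous_map_compose[OF continuous_hat_ext[OF U D fg] continuous_hat_ext[OF D U gf]]
      by (simp add: o_def)
    show "continuous_map (hat_space U) (hat_space U) (\<lambda>P. P)" by simp
    fix Q assume "Q \<in> (\<lambda>x. {x}) ` U"
    then obtain x where "x \<in> U" "Q = {x}" by blast
    then show "hat_ext D U g (hat_ext U D f Q) = Q"
      using fg by (auto simp: homeomorphism_def)
  qed
  show hm: "homeomorphic_maps (hat_space U) (hat_space D) (hat_ext U D f) (hat_ext D U g)"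
    unfolding homeomorphic_maps_def
    using continuous_hat_ext[OF U D fg] continuous_hat_ext[OF D U gf] inv[OF U D fg] inv[OF D U gf] by blast
  have top: "{x} \<in> topspace (hat_space U)" if "x \<in> U" for x
    using that by (auto simp: topspace_hat_space range_hat_proj)
  show "hat_map U D f = restrict (hat_ext U D f) (topspace (hat_space U))"
    unfolding hat_map_def
  proof (rule the_equality, intro conjI)
    show "homeomorphic_map (hat_space U) (hat_space D) (restrict (hat_ext U D f) (topspace (hat_space U)))"
      using hm homeomorphic_map_eq[of "hat_space U" "hat_space D" "hat_ext U D f"]
      by (auto simp: homeomorphic_maps_map)
    fix G assume G: "G \<in> extensional (topspace (hat_space U)) \<and>
         homeomorphic_map (hat_space U) (hat_space D) G \<and> (\<forall>x\<in>U. G {x} = {f x})"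
    show "G = restrict (hat_ext U D f) (topspace (hat_space U))"
    proof (rule extensionalityI[of _ "topspace (hat_space U)"])
      fix P assume P: "P \<in> topspace (hat_space U)"
      have "G P = hat_ext U D f P"
        using P hat_space_dense[OF U] Hausdorff_hat_space[OF D] G continuous_hat_ext[OF U D fg]
        by (intro forall_in_closure_of_eq[of P "hat_space U" "(\<lambda>x. {x}) ` U" "hat_space D" G])
          (auto simp: homeomorphic_imp_continuous_map)
      then show "G P = restrict (hat_ext U D f) (topspace (hat_space U)) P" using P by simp
    qed (use G in auto)
  qed (use top in auto)
qed

section \<open>The slit domain\<close>

definition rad :: "nat \<Rightarrow> real" where "rad k = 1 + 1 / real (Suc k)"

text \<open>Half the distance between the circles k and k + 1. These distances decrease with k, so
  the annulus of half-width \<open>width k\<close> about circle k stays away from all other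
  circles.\<close>

definition width :: "nat \<Rightarrow> real" where "width k = 1 / (2 * (real (Suc k) * real (Suc (Suc k))))"

lemma rad_gt_1: "1 < rad k" by (simp add: rad_def)
lemma rad_le_2: "rad k \<le> 2" by (simp add: rad_def)
lemma width_pos: "width k > 0" by (simp add: width_def)

lemma rad_Suc: "rad (Suc k) = rad k - 2 * width k"
proof -
  have "1 + 1 / (x + 1) = 1 + 1 / x - 2 * (1 / (2 * (x * (x + 1))))" if "x > 0" for x :: real
    using that by (simp add: divide_simps) (simp add: algebra_simps)
  from this[of "real (Suc k)"] show ?thesis by (simp add: rad_def width_def add.commute)
qed

lemma rad_antimono: "k \<le> l \<Longrightarrow> rad l \<le> rad k"
  by (simp add: rad_def frac_le)

lemma rad_sep_gt: "k < l \<Longrightarrow> rad l \<le> rad k - 2 * width k"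
  using rad_antimono[of "Suc k" l] by (simp add: rad_Suc)

lemma rad_sep_lt:
  assumes "l < k" shows "rad k + 2 * width k \<le> rad l"
proof -
  obtain m where m: "k = Suc m" using assms by (cases k) auto
  have "width k \<le> width m" unfolding width_def m
    by (intro divide_left_mono mult_left_mono mult_mono) auto
  then show ?thesis using rad_antimono[of l m] rad_Suc[of m] assms m by simp
qed

lemma rad_eq_iff: "rad k = rad l \<longleftrightarrow> k = l"
  using rad_sep_gt[of k l] rad_sep_gt[of l k] width_pos[of k] width_pos[of l]
  by (cases k l rule: linorder_cases) auto

lemma rad_tendsto: "1 < x \<Longrightarrow> \<exists>m. rad m < x"
  using reals_Archimedean[of "x - 1"] by (auto simp: rad_def inverse_eq_divide algebra_simps)

section \<open>Arguments of points on a circle\<close>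

lemma cis_inj_0_2pi:
  assumes "0 < a" "a < 2 * pi" "0 < b" "b < 2 * pi" "cis a = cis b"
  shows "a = b"
proof -
  have "cis (a - b) = 1" using assms(5) by (simp flip: cis_divide)
  then have "cos (a - b) = 1" by (simp add: complex_eq_iff)
  then obtain n :: int where "a - b = of_int n * 2 * pi" using cos_one_2pi_int by auto
  moreover have "\<bar>a - b\<bar> < 2 * pi" using assms by linarith
  ultimately have "\<bar>real_of_int n\<bar> < 1" using pi_gt_zero by (simp add: abs_mult)
  then have "n = 0" by linarith
  then show ?thesis using \<open>a - b = of_int n * 2 * pi\<close> by simp
qed

lemma cis_ne_1:
  assumes "0 < a" "a < 2 * pi" shows "cis a \<noteq> 1"
proof
  assume "cis a = 1"
  then have "cos a = 1" by (simp add: complex_eq_iff)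
  then obtain n :: int where n: "a = of_int n * 2 * pi" using cos_one_2pi_int by auto
  then have "0 < n" "n < 1" using assms pi_gt_zero by (auto simp: zero_less_mult_iff)
  then show False by simp
qed

lemma norm_cis_diff_le: "cmod (cis a - cis b) \<le> \<bar>a - b\<bar>"
proof -
  have "cis a - cis b = cis b * (cis (a - b) - 1)" by (simp add: algebra_simps cis_mult)
  then have "cmod (cis a - cis b) = cmod (cis (a - b) - 1)" by (simp add: norm_mult)
  also have "\<dots> = 2 * \<bar>sin ((a - b) / 2)\<bar>" using dist_exp_i_1[of "a - b"] by (simp add: cis_conv_exp dist_norm)
  also have "\<dots> \<le> \<bar>a - b\<bar>" using abs_sin_x_le_abs_x[of "(a - b) / 2"] by simp
  finally show ?thesis .
qed

text \<open>The arcs accumulate only on the unit circle. The union is therefore the intersection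
  over m of the disk of radius \<open>rad m\<close> enlarged by the finitely many arcs of levels
  below m, and these sets are closed. The index sets \<open>J\<close> are general so that a single
  arc can be left out.\<close>

lemma closed_union_accumulating_on_disk:
  fixes A :: "nat \<Rightarrow> 'b \<Rightarrow> complex set"
  assumes cl: "\<And>k j. j \<in> J k \<Longrightarrow> closed (A k j)" and fin: "\<And>k. finite (J k)"
    and sub: "\<And>k j. j \<in> J k \<Longrightarrow> A k j \<subseteq> sphere 0 (rad k)"
  shows "closed (cball 0 1 \<union> (\<Union>k. \<Union>j\<in>J k. A k j))"
proof -
  have "cball 0 1 \<union> (\<Union>k. \<Union>j\<in>J k. A k j) = (\<Inter>m. cball 0 (rad m) \<union> (\<Union>k<m. \<Union>j\<in>J k. A k j))" (is "?L = ?R")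
  proof
    show "?L \<subseteq> ?R"
    proof (rule INT_greatest, rule subsetI)
      fix m z assume "z \<in> ?L"
      then consider "cmod z \<le> 1" | k j where "j \<in> J k" "z \<in> A k j" by auto
      then show "z \<in> cball 0 (rad m) \<union> (\<Union>k<m. \<Union>j\<in>J k. A k j)"
      proof cases
        case 1 then show ?thesis using rad_gt_1[of m] by auto
      next
        case 2
        then have "cmod z = rad k" using sub by force
        then show ?thesis using rad_antimono[of m k] 2 by (cases "k < m") auto
      qed
    qed
    show "?R \<subseteq> ?L"
    proof
      fix z assume z: "z \<in> ?R"
      show "z \<in> ?L"
      proof (cases "cmod z \<le> 1")
        case False
        then obtain m where m: "rad m < cmod z" using rad_tendsto[of "cmod z"] by auto
        have "z \<in> cball 0 (rad m) \<union> (\<Union>k<m. \<Union>j\<in>J k. A k j)" using z by (rule INT_D) simp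
        moreover have "z \<notin> cball 0 (rad m)" using m by simp
        ultimately have "z \<in> (\<Union>k<m. \<Union>j\<in>J k. A k j)" by blast
        then show ?thesis by blast
      qed auto
    qed
  qed
  moreover have "closed ?R"
    using cl fin by (intro closed_INT ballI closed_Un closed_UN) auto
  ultimately show ?thesis by simp
qed

lemma components_eqI:
  assumes "\<And>S. S \<in> F \<Longrightarrow> S \<noteq> {} \<and> connected S" "\<Union>F = K"
    and sub: "\<And>S C. S \<in> F \<Longrightarrow> connected C \<Longrightarrow> C \<subseteq> K \<Longrightarrow> C \<inter> S \<noteq> {} \<Longrightarrow> C \<subseteq> S"
  shows "components K = F"
proof -
  have 1: "S \<in> components K" if S: "S \<in> F" for S
    unfolding in_components_maximal
  proof (intro conjI allI impI)
    show "S \<noteq> {}" "S \<subseteq> K" "connected S" using assms S by auto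
    fix d assume "d \<noteq> {} \<and> S \<subseteq> d \<and> d \<subseteq> K \<and> connected d"
    then show "d = S" using sub[OF S, of d] assms(1)[OF S] by blast
  qed
  have "p \<in> F" if p: "p \<in> components K" for p
  proof -
    obtain x where x: "x \<in> p" "x \<in> K" using in_components_nonempty[OF p] in_components_subset[OF p] by blast
    then obtain S where S: "S \<in> F" "x \<in> S" using assms(2) by blast
    then have "S = p" using components_nonoverlap[OF 1[OF S(1)] p] x by blast
    then show ?thesis using S by simp
  qed
  then show ?thesis using 1 by blast
qed

text \<open>\<open>\<beta> k\<close> is half the angular width of a gap on circle k, and
  \<open>gap_le\<close> keeps the arcs nonempty. The actual size is fixed only after the cutoff
  functions are known.\<close>

locale slit_system =
  fixes \<beta> :: "nat \<Rightarrow> real"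
  assumes gap_pos: "\<And>k. 0 < \<beta> k" and gap_le: "\<And>k. \<beta> k * real (Suc k) \<le> 1"
begin

definition slit_angles :: "nat \<Rightarrow> nat \<Rightarrow> real set" where
  "slit_angles k j = {2 * pi * real j / real (Suc k) + \<beta> k .. 2 * pi * real (Suc j) / real (Suc k) - \<beta> k}"

definition slit :: "nat \<Rightarrow> nat \<Rightarrow> complex set" where
  "slit k j = (\<lambda>t. of_real (rad k) * cis t) ` slit_angles k j"

definition slits :: "complex set" where
  "slits = cball 0 1 \<union> (\<Union>k. \<Union>j\<in>{..k}. slit k j)"

definition slit_dom :: "riemann_sphere set" where "slit_dom = - (Fin ` slits)"

lemma slit_subset_sphere: "slit k j \<subseteq> sphere 0 (rad k)"
  using rad_gt_1[of k] by (auto simp: slit_def norm_mult)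

lemma slit_angles_length: "2 * pi * real (Suc j) / c = 2 * pi * real j / c + 2 * pi / c"
proof -
  have "2 * pi * real (Suc j) = 2 * pi * real j + 2 * pi" by (simp add: algebra_simps)
  then show ?thesis by (simp only: add_divide_distrib)
qed

lemma slit_angles_nonempty: "slit_angles k j \<noteq> {}"
proof -
  have "2 * \<beta> k \<le> 2 * pi / real (Suc k)"
    using gap_le[of k] pi_gt3 by (simp add: pos_le_divide_eq)
  moreover have "2 * pi * real (Suc j) / real (Suc k) = 2 * pi * real j / real (Suc k) + 2 * pi / real (Suc k)"
    by (rule slit_angles_length)
  ultimately show ?thesis unfolding slit_angles_def atLeastatMost_empty_iff not_not by linarith
qed

lemma slit_angles_bounds:
  assumes "t \<in> slit_angles k j" "j \<le> k"
  shows "0 < t" "t < 2 * pi"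
proof -
  have t: "2 * pi * real j / real (Suc k) + \<beta> k \<le> t" "t \<le> 2 * pi * real (Suc j) / real (Suc k) - \<beta> k"
    using assms(1) by (simp_all only: slit_angles_def atLeastAtMost_iff)
  have "0 \<le> 2 * pi * real j / real (Suc k)" by (intro divide_nonneg_nonneg mult_nonneg_nonneg) auto
  then show "0 < t" using t(1) gap_pos[of k] by linarith
  have "2 * pi * real (Suc j) / real (Suc k) \<le> 2 * pi" using assms by (simp add: divide_le_eq)
  then show "t < 2 * pi" using t(2) gap_pos[of k] by linarith
qed

lemma slit_angles_disjoint:
  assumes "t \<in> slit_angles k j" "t \<in> slit_angles k i"
  shows "i = j"
proof -
  have *: False if "t \<in> slit_angles k j" "t \<in> slit_angles k i" "i < j" for i j
  proof -
    have "2 * pi * real (Suc i) / real (Suc k) \<le> 2 * pi * real j / real (Suc k)"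
      using that by (intro divide_right_mono mult_left_mono) auto
    then show False using that gap_pos[of k] by (auto simp: slit_angles_def)
  qed
  show ?thesis using *[of j i] *[of i j] assms by (cases i j rule: linorder_cases) auto
qed

lemma slit_disjoint:
  assumes "j \<le> k" "i \<le> l" "(k, j) \<noteq> (l, i)"
  shows "slit k j \<inter> slit l i = {}"
proof (rule ccontr)
  assume "slit k j \<inter> slit l i \<noteq> {}"
  then obtain z where z: "z \<in> slit k j" "z \<in> slit l i" by blast
  then have "z \<in> sphere 0 (rad k)" "z \<in> sphere 0 (rad l)" using slit_subset_sphere by blast+
  then have "rad k = rad l" by simp
  then have kl: "k = l" by (simp add: rad_eq_iff)
  obtain s t where st: "s \<in> slit_angles k j" "t \<in> slit_angles l i"
    "of_real (rad k) * cis s = of_real (rad l) * cis t"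
    using z by (auto simp: slit_def)
  then have "cis s = cis t" using kl rad_gt_1[of l] by simp
  then have "s = t" using slit_angles_bounds st assms cis_inj_0_2pi by metis
  then show False using slit_angles_disjoint st kl assms by blast
qed

lemma slit_compact_connected: "compact (slit k j)" "connected (slit k j)" "slit k j \<noteq> {}"
proof -
  have "continuous_on (slit_angles k j) (\<lambda>t. of_real (rad k) * cis t)"
    by (intro continuous_intros)
  then show "compact (slit k j)" "connected (slit k j)" unfolding slit_def slit_angles_def
    by (auto intro!: compact_continuous_image connected_continuous_image)
  show "slit k j \<noteq> {}" using slit_angles_nonempty by (simp add: slit_def)
qed

lemma slit_outside_disk: "slit k j \<inter> cball 0 1 = {}"
  using slit_subset_sphere[of k j] rad_gt_1[of k] by auto

lemma compact_slits: "compact slits"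
proof -
  have "closed slits" unfolding slits_def
    using slit_compact_connected slit_subset_sphere
    by (intro closed_union_accumulating_on_disk) (auto simp: compact_imp_closed)
  moreover have "slits \<subseteq> cball 0 2"
    unfolding slits_def using slit_subset_sphere rad_le_2 by fastforce
  ultimately show ?thesis using bounded_subset[OF bounded_cball] by (auto simp: compact_eq_bounded_closed)
qed

text \<open>The arc and the union B of everything else are disjoint closed sets, so a connected
  subset of their union lies in one of them. B is closed because its arcs accumulate only on the
  unit disk, which belongs to B.\<close>

lemma connected_subset_slit:
  assumes C: "connected C" "C \<subseteq> slits" and j: "j \<le> k" and ne: "C \<inter> slit k j \<noteq> {}"
  shows "C \<subseteq> slit k j"
proof -
  let ?J = "\<lambda>l. {i. i \<le> l \<and> (l, i) \<noteq> (k, j)}"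
  define B where "B = cball 0 1 \<union> (\<Union>l. \<Union>i\<in>?J l. slit l i)"
  have clB: "closed B" unfolding B_def
  proof (rule closed_union_accumulating_on_disk)
    show "closed (slit l i)" for l i using slit_compact_connected(1) by (rule compact_imp_closed)
    show "finite (?J l)" for l by (rule finite_subset[of _ "{..l}"]) auto
  qed (rule slit_subset_sphere)
  have dis: "slit k j \<inter> slit l i = {}" if "i \<in> ?J l" for l i
    using slit_disjoint[OF j, of i l] that by auto
  have "z \<notin> B" if "z \<in> slit k j" for z
    using slit_outside_disk[of k j] dis that unfolding B_def by fastforce
  then have dB: "slit k j \<inter> B = {}" by blast
  have sub: "C \<subseteq> slit k j \<union> B"
  proof
    fix z assume "z \<in> C"
    then consider "z \<in> cball 0 1" | l i where "i \<le> l" "z \<in> slit l i" using C(2) by (auto simp: slits_def)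
    then show "z \<in> slit k j \<union> B"
    proof cases
      case 2
      then show ?thesis by (cases "(l, i) = (k, j)") (auto simp: B_def)
    qed (simp add: B_def)
  qed
  have "slit k j \<inter> B \<inter> C = {}" using dB by simp
  then have "slit k j \<inter> C = {} \<or> B \<inter> C = {}"
    using connected_closedD[OF C(1) _ sub compact_imp_closed[OF slit_compact_connected(1)[of k j]] clB] by simp
  then have "C \<inter> B = {}"
    using ne by auto
  then show ?thesis using sub by blast
qed

lemma connected_subset_disk:
  assumes C: "connected C" "C \<subseteq> slits" and ne: "C \<inter> cball 0 1 \<noteq> {}"
  shows "C \<subseteq> cball 0 1"
proof
  fix z assume "z \<in> C"
  show "z \<in> cball 0 1"
  proof (rule ccontr)
    assume "z \<notin> cball 0 1"
    then obtain k j where kj: "j \<le> k" "z \<in> slit k j" using C(2) \<open>z \<in> C\<close> by (auto simp: slits_def)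
    then have "C \<subseteq> slit k j" using connected_subset_slit[OF C kj(1)] \<open>z \<in> C\<close> by blast
    then show False using slit_outside_disk ne by blast
  qed
qed

definition levels :: "(nat \<times> nat) set" where "levels = (SIGMA k:UNIV. {..k})"

lemma comps_slit_dom: "comps slit_dom = insert unit_disk ((\<lambda>(k, j). Fin ` slit k j) ` levels)"
proof -
  have im: "unfin ` (Fin ` S) = S" for S by (simp add: image_image)
  have Fi: "Fin ` (unfin ` C) = C" if "C \<subseteq> Fin ` S" for C S using that by (force simp: image_image)
  have con: "connected (Fin ` S)" if "connected S" for S
    using that continuous_on_Fin by (rule connected_continuous_image[rotated])
  have con': "connected (unfin ` C)" if "connected C" "C \<subseteq> Fin ` S" for C S
    using continuous_on_subset[OF continuous_on_unfin, of C] that by (intro connected_continuous_image) auto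
  have "components (Fin ` slits) = insert unit_disk ((\<lambda>(k, j). Fin ` slit k j) ` levels)" (is "_ = ?F")
  proof (rule components_eqI)
    fix S assume S: "S \<in> ?F"
    then consider "S = Fin ` cball 0 1" | k j where "S = Fin ` slit k j" "j \<le> k"
      by (auto simp: unit_disk_def levels_def)
    note cases = this
    then show "S \<noteq> {} \<and> connected S"
      by cases (use con[of "cball 0 1"] con[OF slit_compact_connected(2)] slit_compact_connected(3) in
          \<open>auto simp: convex_connected\<close>)
    fix C assume C: "connected C" "C \<subseteq> Fin ` slits" "C \<inter> S \<noteq> {}"
    have uC: "unfin ` C \<subseteq> slits" using C(2) im[of slits] by blast
    have meet: "unfin ` C \<inter> T \<noteq> {}" if "S = Fin ` T" for T using C(3) that by force
    from cases show "C \<subseteq> S"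
    proof cases
      case 1
      then have "unfin ` C \<subseteq> cball 0 1"
        using connected_subset_disk[OF con'[OF C(1,2)] uC meet] by blast
      then show ?thesis using Fi[OF C(2)] 1 by blast
    next
      case 2
      then have "unfin ` C \<subseteq> slit k j"
        using connected_subset_slit[OF con'[OF C(1,2)] uC 2(2) meet] by blast
      then show ?thesis using Fi[OF C(2)] 2 by blast
    qed
  next
    show "\<Union> ?F = Fin ` slits" unfolding slits_def unit_disk_def levels_def by auto
  qed
  then show ?thesis by (simp add: comps_def slit_dom_def)
qed

text \<open>On every circle the angle 0 is the centre of a gap, so one ray from the unit disk to
  infinity passes through all levels.\<close>

lemma positive_reals_avoid_slits:
  assumes "1 < x" shows "complex_of_real x \<notin> slits"
proof
  assume "complex_of_real x \<in> slits"
  then obtain k j t where t: "j \<le> k" "t \<in> slit_angles k j" "complex_of_real x = of_real (rad k) * cis t"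
    using assms by (auto simp: slits_def slit_def)
  then have "cmod (complex_of_real x) = rad k" using rad_gt_1[of k] by (simp add: norm_mult)
  then have "x = rad k" using assms by simp
  then have "cis t = 1" using t(3) assms by simp
  then show False using cis_ne_1 slit_angles_bounds t by blast
qed

lemma circle_avoids_slits:
  assumes "1 < r" "r \<notin> range rad" shows "sphere 0 r \<inter> slits = {}"
  using assms slit_subset_sphere by (fastforce simp: slits_def)

text \<open>A point on a circle without slits can be turned along it to the positive ray, which
  avoids all slits. A point in a gap is moved slightly outwards beforehand.\<close>

lemma connected_Compl_slits: "connected (- slits)"
proof -
  let ?C = "- slits"
  let ?X = "complex_of_real ` {1<..}"
  have "continuous_on {1<..} complex_of_real" by (intro continuous_intros)
  then have X: "connected ?X" "?X \<subseteq> ?C"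
    using positive_reals_avoid_slits by (auto simp: connected_continuous_image)
  have circ: "connected_component ?C z (of_real (cmod z))" if "1 < cmod z" "cmod z \<notin> range rad" for z
  proof -
    have "connected (sphere (0::complex) (cmod z))" by (rule connected_sphere) simp
    moreover have "sphere 0 (cmod z) \<subseteq> ?C" using circle_avoids_slits[OF that] by blast
    ultimately show ?thesis unfolding connected_component_def by (intro exI[of _ "sphere 0 (cmod z)"]) auto
  qed
  have far: "\<exists>x>1. connected_component ?C z (of_real x)" if z: "z \<in> ?C" for z
  proof -
    have z1: "1 < cmod z" using z by (auto simp: slits_def)
    show ?thesis
    proof (cases "cmod z \<in> range rad")
      case False
      then show ?thesis using circ z1 by blast
    next
      case True
      then obtain k where k: "cmod z = rad k" by blast
      \<comment> \<open>Since \<open>rad k \<le> 2\<close>, the modulus grows by at most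
        \<open>width k\<close>, which stops short of the next larger circle.\<close>
      define w where "w = of_real (1 + width k / 2) * z"
      have seg: "closed_segment z w \<subseteq> ?C \<and> cmod w \<notin> range rad \<and> 1 < cmod w"
      proof -
        have no: "s * rad k \<notin> range rad" if s: "1 < s" "s \<le> 1 + width k / 2" for s
        proof
          assume "s * rad k \<in> range rad"
          then obtain l where l: "s * rad k = rad l" by blast
          have "rad k < rad l" using mult_strict_right_mono[OF s(1), of "rad k"] l rad_gt_1[of k] by simp
          moreover have "rad l \<le> rad k + width k"
          proof -
            have "s * rad k \<le> (1 + width k / 2) * rad k" using s rad_gt_1[of k] by (intro mult_right_mono) auto
            also have "\<dots> \<le> rad k + width k" using rad_le_2[of k] width_pos[of k] by (simp add: algebra_simps)
            finally show ?thesis using l by simp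
          qed
          ultimately show False using rad_sep_gt[of k l] rad_sep_lt[of l k] width_pos[of k]
            by (cases k l rule: linorder_cases) auto
        qed
        have "u \<in> ?C" if u: "u \<in> closed_segment z w" for u
        proof -
          obtain t where t: "0 \<le> t" "t \<le> 1" "u = (1 - t) *\<^sub>R z + t *\<^sub>R w" using u by (auto simp: closed_segment_def)
          have u2: "u = of_real (1 + t * width k / 2) * z" unfolding t w_def by (simp add: scaleR_conv_of_real algebra_simps)
          have nn: "0 \<le> t * width k / 2" "t * width k / 2 \<le> width k / 2"
            using t width_pos[of k] by (auto intro: mult_left_le_one_le)
          show ?thesis
          proof (cases "t = 0")
            case True then show ?thesis using t z by simp
          next
            case False
            then have g: "1 < 1 + t * width k / 2" using t width_pos[of k] by simp
            have cu: "cmod u = (1 + t * width k / 2) * rad k" unfolding u2 norm_mult k norm_of_real using g by simp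
            have "1 < cmod u" unfolding cu using g rad_gt_1[of k] by (metis less_1_mult)
            moreover have "cmod u \<notin> range rad" unfolding cu using no[OF g] nn by simp
            ultimately show ?thesis using circle_avoids_slits[of "cmod u"] by auto
          qed
        qed
        moreover have cw: "cmod w = (1 + width k / 2) * rad k" unfolding w_def norm_mult k norm_of_real using width_pos[of k] by simp
        moreover have "1 < cmod w" unfolding cw using width_pos[of k] rad_gt_1[of k] by (intro less_1_mult) auto
        moreover have "cmod w \<notin> range rad" unfolding cw using no[of "1 + width k / 2"] width_pos[of k] by simp
        ultimately show ?thesis by blast
      qed
      have "connected_component ?C z w" unfolding connected_component_def
        using seg by (intro exI[of _ "closed_segment z w"]) auto
      then show ?thesis using circ[of w] seg connected_component_trans by blast
    qed
  qed
  have "connected_component ?C z w" if zw: "z \<in> ?C" "w \<in> ?C" for z w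
  proof -
    obtain x y where xy: "x > 1" "connected_component ?C z (of_real x)" "y > 1" "connected_component ?C w (of_real y)"
      using far zw by blast
    have "connected_component ?C (of_real x) (of_real y)"
      unfolding connected_component_def using X xy by (intro exI[of _ ?X]) auto
    then show ?thesis using xy connected_component_sym connected_component_trans by metis
  qed
  then show ?thesis unfolding connected_iff_connected_component by blast
qed

lemma sphere_domain_slit_dom: "sphere_domain slit_dom"
  unfolding sphere_domain_def
proof (intro conjI)
  have "compact (Fin ` slits)"
    using compact_slits continuous_on_Fin by (rule compact_continuous_image[rotated])
  then show op: "open slit_dom" by (simp add: slit_dom_def compact_imp_closed open_Compl)
  have Inf: "Infty \<in> slit_dom" by (auto simp: slit_dom_def)
  then show "slit_dom \<noteq> {}" by blast
  have eq: "slit_dom = insert Infty (Fin ` (- slits))"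
  proof (rule set_eqI)
    fix x show "x \<in> slit_dom \<longleftrightarrow> x \<in> insert Infty (Fin ` (- slits))"
      by (cases x) (auto simp: slit_dom_def)
  qed
  have con: "connected (Fin ` (- slits))"
    using connected_Compl_slits continuous_on_Fin by (rule connected_continuous_image[rotated])
  have "Infty \<in> closure (Fin ` (- slits))"
  proof (unfold closure_approachable, intro allI impI)
    fix e :: real assume e: "0 < e"
    obtain d where d: "d > 0" "ball Infty d \<subseteq> slit_dom" using op Inf open_contains_ball by blast
    obtain R where R: "0 < R" "\<And>z. R \<le> cmod z \<Longrightarrow> dist (Fin z) Infty \<le> min d e / 2"
      using large_points_near_Infty[of "min d e / 2"] d e by auto
    define z where "z = complex_of_real R"
    have z: "dist (Fin z) Infty < min d e" using R(2)[of z] R(1) d e by (auto simp: z_def)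
    then have "Fin z \<in> slit_dom" using d by (auto simp: dist_commute)
    then show "\<exists>y\<in>Fin ` (- slits). dist y Infty < e" using z by (auto simp: slit_dom_def)
  qed
  then have "insert Infty (Fin ` (- slits)) \<subseteq> closure (Fin ` (- slits))"
    using closure_subset[of "Fin ` (- slits)"] by simp
  then show "connected slit_dom"
    unfolding eq by (rule connected_intermediate_closure[OF con _, rotated]) auto
qed

section \<open>Countability and the sum of the diameters\<close>

lemma countably_connected_slit_dom: "countably_connected slit_dom"
  unfolding countably_connected_def comps_slit_dom by simp

text \<open>The constant is 4 from the comparison of spherical and Euclidean distance, times 2 for
  \<open>rad k \<le> 2\<close>, times 2 pi for the angle 2 pi / (k + 1).\<close>

lemma diameter_slit_le: "diameter (Fin ` slit k j) \<le> 16 * pi / real (Suc k)"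
proof -
  have "dist x y \<le> 16 * pi / real (Suc k)" if xy: "x \<in> Fin ` slit k j" "y \<in> Fin ` slit k j" for x y
  proof -
    obtain s t where st: "s \<in> slit_angles k j" "t \<in> slit_angles k j"
      "x = Fin (of_real (rad k) * cis s)" "y = Fin (of_real (rad k) * cis t)" using xy by (auto simp: slit_def)
    have "dist x y \<le> 4 * cmod (of_real (rad k) * cis s - of_real (rad k) * cis t)"
      unfolding st by (rule dist_Fin_le)
    also have "of_real (rad k) * cis s - of_real (rad k) * cis t = of_real (rad k) * (cis s - cis t)"
      by (simp add: algebra_simps)
    also have "4 * cmod (of_real (rad k) * (cis s - cis t)) \<le> 4 * (2 * \<bar>s - t\<bar>)"
      unfolding norm_mult using rad_le_2[of k] rad_gt_1[of k] norm_cis_diff_le[of s t]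
      by (intro mult_left_mono mult_mono) auto
    also have "\<bar>s - t\<bar> \<le> 2 * pi / real (Suc k)"
    proof -
      have "2 * pi * real (Suc j) / real (Suc k) = 2 * pi * real j / real (Suc k) + 2 * pi / real (Suc k)"
        by (rule slit_angles_length)
      then show ?thesis using st(1,2) gap_pos[of k] unfolding slit_angles_def atLeastAtMost_iff by linarith
    qed
    finally show ?thesis by simp
  qed
  then show ?thesis
    unfolding diameter_def using slit_compact_connected(3)[of k j] by (auto intro!: cSUP_least)
qed

lemma summable_diameters:
  assumes "\<alpha> > 2"
  shows "(\<lambda>p. diameter p powr \<alpha>) summable_on comps slit_dom"
proof -
  define c where "c = (16 * pi) powr \<alpha>"
  have inj: "inj_on (\<lambda>(k, j). Fin ` slit k j) levels"
  proof (rule inj_onI, clarify)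
    fix k j l i assume kj: "(k, j) \<in> levels" "(l, i) \<in> levels" "Fin ` slit k j = Fin ` slit l i"
    have "slit k j = slit l i" using kj(3) by (simp add: inj_image_eq_iff inj_def)
    then show "k = l \<and> j = i" using slit_disjoint[of j k i l] slit_compact_connected(3)[of k j] kj by (auto simp: levels_def)
  qed
  have bd: "diameter (Fin ` slit k j) powr \<alpha> \<le> c * real (Suc k) powr (- \<alpha>)" for k j
  proof -
    have "diameter (Fin ` slit k j) powr \<alpha> \<le> (16 * pi / real (Suc k)) powr \<alpha>"
      using diameter_slit_le assms by (intro powr_mono2) (auto simp: diameter_ge_0 bounded_sphere)
    also have "\<dots> = c * real (Suc k) powr (- \<alpha>)"
      by (simp add: c_def powr_divide powr_minus_divide)
    finally show ?thesis .
  qed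
  have "(\<lambda>k. c * real (Suc k) powr (1 - \<alpha>)) summable_on UNIV"
  proof (rule norm_summable_imp_summable_on)
    have "summable (\<lambda>k. real (Suc k) powr (1 - \<alpha>))"
      using assms by (subst summable_Suc_iff) (simp add: summable_real_powr_iff)
    then show "summable (\<lambda>k. norm (c * real (Suc k) powr (1 - \<alpha>)))" by (simp add: c_def summable_mult)
  qed
  then have "(\<lambda>(k, j). c * real (Suc k) powr (- \<alpha>)) summable_on levels"
    unfolding levels_def
  proof (intro summable_on_SigmaI)
    fix k
    have "real (Suc k) * real (Suc k) powr (- \<alpha>) = real (Suc k) powr (1 - \<alpha>)"
      using powr_add[of "real (Suc k)" 1 "- \<alpha>"] by simp
    then show "((\<lambda>j. case (k, j) of (k, j) \<Rightarrow> c * real (Suc k) powr (- \<alpha>)) has_sum c * real (Suc k) powr (1 - \<alpha>)) {..k}"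
      by (intro has_sum_finiteI) (auto simp: algebra_simps)
  qed (auto simp: c_def)
  then have "(\<lambda>x. diameter ((\<lambda>(k, j). Fin ` slit k j) x) powr \<alpha>) summable_on levels"
    by (rule summable_on_comparison_test) (use bd in auto)
  then have "(\<lambda>p. diameter p powr \<alpha>) summable_on ((\<lambda>(k, j). Fin ` slit k j) ` levels)"
    by (subst summable_on_reindex[OF inj]) (simp add: o_def)
  then show ?thesis unfolding comps_slit_dom by (simp add: summable_on_insert_iff)
qed

lemma unit_disk_comps_N: "unit_disk \<in> comps_N slit_dom"
proof -
  have "dist (Fin 0) (Fin 1) \<le> diameter unit_disk"
    by (rule diameter_bounded_bound[OF bounded_sphere]) (auto simp: unit_disk_def)
  moreover have "dist (Fin 0) (Fin 1) > 0" by (simp only: zero_less_dist_iff) simp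
  ultimately have "0 < diameter unit_disk" by linarith
  then show ?thesis unfolding comps_N_def comps_slit_dom by simp
qed

text \<open>The index runs to k + 1: the centres for 0 and k + 1 coincide, but an argument just
  below 2 pi is close to 2 pi and not to 0. The factor 2 bounds \<open>rad k\<close>.\<close>

lemma gap_near_centre:
  assumes z: "z \<notin> slits" "cmod z = rad k"
  obtains j where "j \<le> Suc k" "cmod (z - of_real (rad k) * cis (2 * pi * real j / real (Suc k))) \<le> 2 * \<beta> k"
proof -
  define t where "t = Arg2pi z"
  have t: "0 \<le> t" "t < 2 * pi" "z = of_real (rad k) * cis t"
    using Arg2pi[of z] z by (auto simp: t_def cis_conv_exp is_Arg_def)
  \<comment> \<open>Index of the sector that contains the argument t; a point off the slits is then
    close to one of the two ends of this sector.\<close>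
  define j where "j = nat \<lfloor>t * real (Suc k) / (2 * pi)\<rfloor>"
  define c where "c = 2 * pi / real (Suc k)"
  have c: "c > 0" by (simp add: c_def)
  have tc: "t * real (Suc k) / (2 * pi) = t / c" by (simp add: c_def field_simps)
  have "real j \<le> t / c" "t / c < real j + 1"
    unfolding j_def tc using t c by (auto simp: of_nat_nat)
  then have j: "c * real j \<le> t" "t < c * real (Suc j)" using c by (auto simp: field_simps)
  have "c * real j < c * real (Suc k)" using j t by (simp add: c_def)
  then have jk: "j \<le> k" using c by (simp add: mult_less_cancel_left_pos)
  note result = that
  have near: thesis if i: "i \<le> Suc k" "\<bar>t - c * real i\<bar> \<le> \<beta> k" for i
  proof (rule result[OF i(1)])
    have e: "2 * pi * real i / real (Suc k) = c * real i" by (simp add: c_def)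
    have "z - of_real (rad k) * cis (c * real i) = of_real (rad k) * (cis t - cis (c * real i))"
      by (simp add: t(3) algebra_simps)
    then have "cmod (z - of_real (rad k) * cis (c * real i)) = rad k * cmod (cis t - cis (c * real i))"
      using rad_gt_1[of k] by (simp add: norm_mult)
    also have "\<dots> \<le> 2 * \<beta> k"
      using rad_le_2[of k] rad_gt_1[of k] norm_cis_diff_le[of t "c * real i"] i by (intro mult_mono) auto
    finally show "cmod (z - of_real (rad k) * cis (2 * pi * real i / real (Suc k))) \<le> 2 * \<beta> k" unfolding e .
  qed
  have "t \<notin> slit_angles k j" using z jk t by (auto simp: slits_def slit_def)
  moreover have "2 * pi * real j / real (Suc k) = c * real j" "2 * pi * real (Suc j) / real (Suc k) = c * real (Suc j)"
    by (simp_all add: c_def)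
  ultimately have "t < c * real j + \<beta> k \<or> c * real (Suc j) - \<beta> k < t"
    unfolding slit_angles_def by auto
  then show thesis using near[of j] near[of "Suc j"] j jk by auto
qed

end

section \<open>Logarithmic cutoff functions\<close>

text \<open>Differentiable everywhere, unlike the positive part itself. The step built from it
  replaces a clamped linear function, whose corners would disturb the fundamental theorem of
  calculus along lines.\<close>

definition sq_pos :: "real \<Rightarrow> real" where "sq_pos x = (max 0 x)\<^sup>2"

lemma sq_pos_deriv: "(sq_pos has_real_derivative 2 * max 0 x) (at x)"
proof (cases x "0::real" rule: linorder_cases)
  case less
  have "(sq_pos has_real_derivative 0) (at x)"
    by (rule has_field_derivative_transform_within_open[of "\<lambda>_. 0" _ _ "{..<0}"])
      (use less in \<open>auto simp: sq_pos_def\<close>)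
  then show ?thesis using less by simp
next
  case greater
  have "((\<lambda>y. y\<^sup>2) has_real_derivative 2 * x) (at x)" by (auto intro!: derivative_eq_intros)
  then have "(sq_pos has_real_derivative 2 * x) (at x)"
    by (rule has_field_derivative_transform_within_open[of _ _ _ "{0<..}"])
      (use greater in \<open>auto simp: sq_pos_def\<close>)
  then show ?thesis using greater by simp
next
  case equal
  have "(\<lambda>h. sq_pos h / h) \<midarrow>0\<rightarrow> 0"
  proof (rule Lim_null_comparison)
    show "eventually (\<lambda>h. norm (sq_pos h / h) \<le> \<bar>h\<bar>) (at 0)"
      by (intro always_eventually allI) (auto simp: sq_pos_def max_def power2_eq_square)
    show "(\<lambda>h. \<bar>h\<bar>) \<midarrow>0\<rightarrow> (0::real)" using tendsto_rabs[OF tendsto_ident_at, of "0::real" UNIV] by simp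
  qed
  then show ?thesis using equal by (simp add: DERIV_def sq_pos_def)
qed

definition smooth_step :: "real \<Rightarrow> real" where "smooth_step x = 1 - sq_pos (1 - sq_pos x)"

definition smooth_step' :: "real \<Rightarrow> real" where
  "smooth_step' x = 4 * max 0 (1 - sq_pos x) * max 0 x"

lemma smooth_step_deriv: "(smooth_step has_real_derivative smooth_step' x) (at x)"
proof -
  have "((\<lambda>x. sq_pos (1 - sq_pos x)) has_real_derivative 2 * max 0 (1 - sq_pos x) * (0 - 2 * max 0 x)) (at x)"
    by (rule DERIV_chain2[where f = sq_pos, OF sq_pos_deriv]) (intro derivative_intros sq_pos_deriv)
  then have "(smooth_step has_real_derivative 0 - 2 * max 0 (1 - sq_pos x) * (0 - 2 * max 0 x)) (at x)"
    unfolding smooth_step_def[abs_def] by (intro DERIV_diff DERIV_const)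
  then show ?thesis by (simp add: smooth_step'_def mult.assoc)
qed

lemma smooth_step_eq_0: "x \<le> 0 \<Longrightarrow> smooth_step x = 0"
  and smooth_step_eq_1: "1 \<le> x \<Longrightarrow> smooth_step x = 1"
  and smooth_step_bounds: "0 \<le> smooth_step x" "smooth_step x \<le> 1"
proof -
  show "x \<le> 0 \<Longrightarrow> smooth_step x = 0" by (simp add: smooth_step_def sq_pos_def)
  show "1 \<le> x \<Longrightarrow> smooth_step x = 1"
    by (auto simp: smooth_step_def sq_pos_def max_def intro: antisym one_le_power)
  have "0 \<le> sq_pos x" by (simp add: sq_pos_def)
  then have "(max 0 (1 - sq_pos x))\<^sup>2 \<le> 1\<^sup>2" by (intro power_mono) auto
  then show "0 \<le> smooth_step x" "smooth_step x \<le> 1" by (auto simp: smooth_step_def sq_pos_def)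
qed

lemma smooth_step'_eq_0: "x \<le> 0 \<or> 1 \<le> x \<Longrightarrow> smooth_step' x = 0"
  by (auto simp: smooth_step'_def sq_pos_def max_def intro: antisym one_le_power)

lemma smooth_step'_bound: "\<bar>smooth_step' x\<bar> \<le> 4"
proof (cases "x \<le> 0 \<or> 1 \<le> x")
  case True then show ?thesis by (simp add: smooth_step'_eq_0)
next
  case False
  then have "max 0 (1 - sq_pos x) * max 0 x \<le> 1 * 1"
    by (intro mult_mono) (auto simp: sq_pos_def)
  then show ?thesis by (simp add: smooth_step'_def)
qed

text \<open>A logarithmic cutoff: points of the plane have zero capacity.\<close>

lemma cutoff_exists:
  fixes \<delta> \<epsilon> :: real
  assumes \<delta>: "0 < \<delta>" and \<epsilon>: "0 < \<epsilon>"
  obtains \<eta> and \<phi> \<rho> :: "complex \<Rightarrow> real" where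
    "0 < \<eta>"
    "\<And>z. \<exists>D. (\<phi> has_derivative D) (at z) \<and> (\<forall>h. \<bar>D h\<bar> \<le> \<rho> z * cmod h)"
    "\<And>z. 0 \<le> \<phi> z" "\<And>z. cmod z < \<eta> \<Longrightarrow> \<phi> z = 1" "\<And>z. \<delta> \<le> cmod z \<Longrightarrow> \<phi> z = 0"
    "\<rho> \<in> borel_measurable borel" "\<And>z. 0 \<le> \<rho> z"
    "(\<integral>\<^sup>+ z. ennreal ((\<rho> z)\<^sup>2) \<partial>lborel) \<le> ennreal \<epsilon>"
proof -
  \<comment> \<open>The energy computed below is bounded by 16 e^2 pi / n.\<close>
  obtain n :: nat where n: "16 * exp 2 * pi / \<epsilon> < real n" using reals_Archimedean2 by blast
  have n0: "0 < real n" using n \<epsilon> by (smt (verit) divide_nonneg_pos exp_ge_zero mult_nonneg_nonneg pi_ge_zero)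
  define \<eta> where "\<eta> = \<delta> * exp (- real n)"
  have \<eta>: "0 < \<eta>" "\<eta> < \<delta>" using \<delta> n0 by (auto simp: \<eta>_def)
  define l where "l z = (ln \<delta> - ln (cmod z)) / real n" for z :: complex
  \<comment> \<open>As \<open>ln 0 = 0\<close>, the logarithmic formula would in general give a
    wrong value at the centre, which is therefore set apart.\<close>
  define \<phi> where "\<phi> z = (if z = 0 then 1 else smooth_step (l z))" for z
  define R where "R = {z :: complex. \<eta> \<le> cmod z \<and> cmod z \<le> \<delta>}"
  define \<rho> where "\<rho> z = (if z \<in> R then 4 / (real n * cmod z) else 0)" for z
  have ln\<eta>: "ln \<eta> = ln \<delta> - real n" using \<delta> by (simp add: \<eta>_def ln_mult)
  have l1: "1 \<le> l z" if "z \<noteq> 0" "cmod z \<le> \<eta>" for z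
  proof -
    have "ln (cmod z) \<le> ln \<eta>" using that \<eta> by (subst ln_le_cancel_iff) auto
    then show ?thesis using n0 by (simp add: l_def ln\<eta>)
  qed
  have l0: "l z \<le> 0" if "\<delta> \<le> cmod z" for z
  proof -
    have "ln \<delta> \<le> ln (cmod z)" using that \<delta> by (subst ln_le_cancel_iff) linarith+
    then show ?thesis using n0 by (simp add: l_def divide_nonpos_pos)
  qed
  have phi1: "\<phi> z = 1" if "cmod z < \<eta>" for z
    using l1[of z] that by (auto simp: \<phi>_def smooth_step_eq_1)
  have phi0: "\<phi> z = 0" if "\<delta> \<le> cmod z" for z
    using l0[OF that] that \<delta> by (auto simp: \<phi>_def smooth_step_eq_0)
  have der: "\<exists>D. (\<phi> has_derivative D) (at z) \<and> (\<forall>h. \<bar>D h\<bar> \<le> \<rho> z * cmod h)" for z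
  proof (cases "cmod z < \<eta>")
    case True
    have "((\<lambda>_. 1) has_derivative (\<lambda>_. 0)) (at z)" by simp
    moreover have "open (ball 0 \<eta>)" "z \<in> ball 0 \<eta>" using True by auto
    ultimately have "(\<phi> has_derivative (\<lambda>_. 0)) (at z)"
      by (rule has_derivative_transform_within_open) (simp add: phi1)
    then show ?thesis by (intro exI[of _ "\<lambda>_. 0"]) (auto simp: \<rho>_def n0 less_imp_le)
  next
    case False
    then have z: "z \<noteq> 0" using \<eta> by auto
    let ?D = "\<lambda>h. ((0 - 1 / cmod z * (sgn z \<bullet> h)) / real n) * smooth_step' (l z)"
    have "(norm has_derivative (\<lambda>h. sgn z \<bullet> h)) (at z)"
      using has_derivative_norm[OF z] by (simp add: inner_commute)
    then have "((\<lambda>z. ln (cmod z)) has_derivative (\<lambda>h. 1 / cmod z * (sgn z \<bullet> h))) (at z)"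
      using z by (auto intro!: derivative_eq_intros simp: divide_inverse)
    then have "((\<lambda>z. ln \<delta> - ln (cmod z)) has_derivative (\<lambda>h. 0 - 1 / cmod z * (sgn z \<bullet> h))) (at z)"
      by (intro derivative_intros)
    then have "(l has_derivative (\<lambda>h. (0 - 1 / cmod z * (sgn z \<bullet> h)) / real n)) (at z)"
      unfolding l_def[abs_def] by (rule bounded_linear.has_derivative[OF bounded_linear_divide])
    then have "((\<lambda>z. smooth_step (l z)) has_derivative ?D) (at z)"
      by (rule DERIV_compose_FDERIV[OF smooth_step_deriv])
    then have d: "(\<phi> has_derivative ?D) (at z)"
      by (rule has_derivative_transform_within_open[of _ _ _ _ "- {0}"]) (use z in \<open>auto simp: \<phi>_def\<close>)
    have "\<bar>?D h\<bar> \<le> \<rho> z * cmod h" for h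
    proof (cases "z \<in> R")
      case True
      have "\<bar>sgn z \<bullet> h\<bar> \<le> cmod h" using Cauchy_Schwarz_ineq2[of "sgn z" h] z by (simp add: norm_sgn)
      then have "\<bar>sgn z \<bullet> h\<bar> * \<bar>smooth_step' (l z)\<bar> \<le> cmod h * 4"
        by (intro mult_mono smooth_step'_bound) auto
      then have "\<bar>sgn z \<bullet> h\<bar> * \<bar>smooth_step' (l z)\<bar> / (cmod z * real n) \<le> cmod h * 4 / (cmod z * real n)"
        using z n0 by (intro divide_right_mono) auto
      then show ?thesis using True z n0 by (simp add: \<rho>_def abs_mult mult.commute)
    next
      case nR: False
      then have "\<delta> < cmod z" using False by (auto simp: R_def)
      then have "smooth_step' (l z) = 0" using l0[of z] by (simp add: smooth_step'_eq_0)
      then show ?thesis using nR by (simp add: \<rho>_def)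
    qed
    then show ?thesis using d by blast
  qed
  have mR: "R \<in> sets borel"
  proof -
    have "R = cball 0 \<delta> - ball 0 \<eta>" by (auto simp: R_def)
    then show ?thesis by simp
  qed
  have m\<rho>: "\<rho> \<in> borel_measurable borel" unfolding \<rho>_def[abs_def] using mR by measurable
  define c where "c = 16 / (real n)\<^sup>2"
  \<comment> \<open>Shells with radii in ratio e. On each of the n shells the squared density is at
    most its value on the inner circle and the area at most that of the outer disk, so every shell
    contributes at most 16 e^2 pi / n^2.\<close>
  define a where "a i = \<delta> * exp (- real i)" for i :: nat
  have a: "0 < a i" for i using \<delta> by (simp add: a_def)
  let ?t = "\<lambda>i z. ennreal (c / (a (Suc i))\<^sup>2) * indicator (cball 0 (a i)) z"
  have bound: "ennreal ((\<rho> z)\<^sup>2) \<le> (\<Sum>i<n. ?t i z)" for z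
  proof (cases "z \<in> R")
    case True
    then have z: "\<eta> \<le> cmod z" "cmod z \<le> \<delta>" "z \<noteq> 0" using \<eta> by (auto simp: R_def)
    have "\<exists>i<n. a (Suc i) \<le> cmod z \<and> cmod z \<le> a i"
    proof (rule ccontr)
      assume no: "\<not> ?thesis"
      have step: "cmod z < a (Suc i)" if "i < n" "cmod z \<le> a i" for i
        using no that not_le by blast
      have all: "cmod z \<le> a i" if "i \<le> n" for i
        using that
      proof (induction i)
        case 0 then show ?case using z by (simp add: a_def)
      next
        case (Suc i) then show ?case using step[of i] by simp
      qed
      obtain m where m: "n = Suc m" using n0 by (cases n) auto
      have "cmod z < a (Suc m)" using step[of m] all[of m] m by simp
      then show False using z(1) m by (simp add: a_def \<eta>_def)
    qed
    then obtain i where i: "i < n" "a (Suc i) \<le> cmod z" "cmod z \<le> a i" by blast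
    have "(\<rho> z)\<^sup>2 = c / (cmod z)\<^sup>2" using True by (simp add: \<rho>_def c_def power_divide power_mult_distrib)
    also have "\<dots> \<le> c / (a (Suc i))\<^sup>2"
      using i a[of "Suc i"] z by (intro divide_left_mono power_mono mult_pos_pos) (auto simp: c_def)
    finally have "ennreal ((\<rho> z)\<^sup>2) \<le> ?t i z"
      using i by (simp add: ennreal_leI)
    also have "\<dots> \<le> (\<Sum>i<n. ?t i z)"
      using i by (intro member_le_sum) auto
    finally show ?thesis .
  qed (simp add: \<rho>_def)
  have "(\<integral>\<^sup>+ z. ennreal ((\<rho> z)\<^sup>2) \<partial>lborel)
      \<le> (\<integral>\<^sup>+ z. (\<Sum>i<n. ennreal (c / (a (Suc i))\<^sup>2) * indicator (cball (0::complex) (a i)) z) \<partial>lborel)"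
    by (intro nn_integral_mono bound)
  also have "\<dots> = (\<Sum>i<n. ennreal (c / (a (Suc i))\<^sup>2) * emeasure lborel (cball (0::complex) (a i)))"
  proof -
    have "(\<lambda>z::complex. ennreal k * indicator (cball 0 r) z) \<in> borel_measurable lborel" for k r
    proof -
      have [measurable]: "cball (0::complex) r \<in> sets borel" by simp
      show ?thesis by measurable
    qed
    then show ?thesis by (subst nn_integral_sum) (auto simp: nn_integral_cmult_indicator)
  qed
  also have "\<dots> = (\<Sum>i<n. ennreal (c * exp 2 * pi))"
  proof (rule sum.cong)
    fix i
    have "exp (- real i) = exp 1 * exp (- real (Suc i))" by (simp flip: exp_add)
    then have "a i = exp 1 * a (Suc i)" by (simp add: a_def)
    then have "c / (a (Suc i))\<^sup>2 * (pi * (a i)\<^sup>2) = c * (exp 1)\<^sup>2 * pi"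
      using a[of "Suc i"] by (simp add: power_mult_distrib)
    moreover have "(exp 1 :: real)\<^sup>2 = exp 2" by (simp flip: exp_of_nat_mult[of 2 "1::real", simplified] add: power2_eq_square exp_add[symmetric])
    moreover have "emeasure lborel (cball (0::complex) (a i)) = ennreal (pi * (a i)\<^sup>2)"
      using a[of i] by (simp add: emeasure_cball unit_ball_vol_2)
    ultimately show "ennreal (c / (a (Suc i))\<^sup>2) * emeasure lborel (cball (0::complex) (a i)) = ennreal (c * exp 2 * pi)"
      using a[of i] by (simp add: c_def flip: ennreal_mult)
  qed simp
  also have "\<dots> = ennreal (real n * (c * exp 2 * pi))"
    by (simp add: c_def ennreal_of_nat_eq_real_of_nat flip: ennreal_mult)
  also have "\<dots> \<le> ennreal \<epsilon>"
  proof (rule ennreal_leI)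
    have "real n * (c * exp 2 * pi) = 16 * exp 2 * pi / real n"
      using n0 by (simp add: c_def power2_eq_square)
    also have "\<dots> \<le> \<epsilon>" using n n0 \<epsilon> by (simp add: field_simps)
    finally show "real n * (c * exp 2 * pi) \<le> \<epsilon>" .
  qed
  finally have en: "(\<integral>\<^sup>+ z. ennreal ((\<rho> z)\<^sup>2) \<partial>lborel) \<le> ennreal \<epsilon>" .
  show thesis
  proof (rule that[of \<eta> \<phi> \<rho>])
    show "0 \<le> \<phi> z" for z by (simp add: \<phi>_def smooth_step_bounds)
    show "0 \<le> \<rho> z" for z by (simp add: \<rho>_def)
  qed (use \<eta>(1) der phi1 phi0 m\<rho> en in auto)
qed

section \<open>Area and length in the plane\<close>

definition vec_complex :: "real^2 \<Rightarrow> complex" where "vec_complex v = Complex (v $ 1) (v $ 2)"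
definition complex_vec :: "complex \<Rightarrow> real^2" where "complex_vec z = vector [Re z, Im z]"

lemma vec_complex_inverse [simp]: "complex_vec (vec_complex v) = v" "vec_complex (complex_vec z) = z"
  by (simp_all add: vec_complex_def complex_vec_def vec_eq_iff forall_2)

lemma complex_vec_image: "complex_vec ` T = vec_complex -` T"
proof
  show "complex_vec ` T \<subseteq> vec_complex -` T" by (rule image_subsetI) simp
  show "vec_complex -` T \<subseteq> complex_vec ` T"
    by (rule subsetI, rule rev_image_eqI[where f = complex_vec]) auto
qed

lemma bounded_linear_vec_complex: "bounded_linear vec_complex"
  by (intro linear_conv_bounded_linear[THEN iffD1] linearI)
    (simp_all add: vec_complex_def complex_eq_iff)

lemma bounded_linear_complex_vec: "bounded_linear complex_vec"
  by (intro linear_conv_bounded_linear[THEN iffD1] linearI)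
    (simp_all add: complex_vec_def vec_eq_iff forall_2)

lemma measurable_vec_complex [measurable]: "vec_complex \<in> borel_measurable borel"
  by (intro borel_measurable_continuous_onI linear_continuous_on bounded_linear_vec_complex)

lemma measurable_Complex [measurable]: "(\<lambda>(x, y). Complex x y) \<in> borel_measurable (lborel \<Otimes>\<^sub>M lborel)"
proof -
  have "(\<lambda>p. Complex (fst p) (snd p)) \<in> borel_measurable (lborel \<Otimes>\<^sub>M lborel)"
    unfolding lborel_prod measurable_lborel2
    by (intro borel_measurable_continuous_onI) (auto simp: Complex_eq intro!: continuous_intros)
  then show ?thesis by (simp add: case_prod_beta')
qed

lemma lborel_complex_eq_distr_pair: "(lborel :: complex measure) = distr (lborel \<Otimes>\<^sub>M lborel) borel (\<lambda>(x, y). Complex x y)"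
proof (rule lborel_eqI)
  let ?M = "distr (lborel \<Otimes>\<^sub>M lborel) borel (\<lambda>(x, y). Complex x y)"
  fix l u :: complex assume lu: "\<And>b. b \<in> Basis \<Longrightarrow> l \<bullet> b \<le> u \<bullet> b"
  have le: "Re l \<le> Re u" "Im l \<le> Im u" using lu[of 1] lu[of \<i>] by (auto simp: Basis_complex_def)
  have "(\<lambda>(x, y). Complex x y) -` box l u \<inter> space (lborel \<Otimes>\<^sub>M lborel) = {Re l<..<Re u} \<times> {Im l<..<Im u}"
    by (auto simp: mem_box Basis_complex_def space_pair_measure)
  then have "emeasure ?M (box l u)
    = emeasure (lborel \<Otimes>\<^sub>M lborel) ({Re l<..<Re u} \<times> {Im l<..<Im u})"
    by (subst emeasure_distr) (auto simp: measurable_Complex)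
  also have "\<dots> = ennreal (Re u - Re l) * ennreal (Im u - Im l)"
    by (subst lborel.emeasure_pair_measure_Times) (auto simp: le)
  also have "\<dots> = ennreal (\<Prod>b\<in>Basis. (u - l) \<bullet> b)"
    using le by (simp add: Basis_complex_def ennreal_mult)
  finally show "emeasure ?M (box l u)
    = ennreal (\<Prod>b\<in>Basis. (u - l) \<bullet> b)" .
qed simp

text \<open>The inner integral runs over vertical lines, the family of lines for which lengths are
  estimated.\<close>

lemma nn_integral_complex_iterated:
  assumes [measurable]: "f \<in> borel_measurable borel"
  shows "(\<integral>\<^sup>+ z. f z \<partial>lborel) = (\<integral>\<^sup>+ x. \<integral>\<^sup>+ y. f (Complex x y) \<partial>lborel \<partial>lborel)"
proof -
  have "(\<integral>\<^sup>+ z. f z \<partial>lborel) = (\<integral>\<^sup>+ p. f (case p of (x, y) \<Rightarrow> Complex x y) \<partial>(lborel \<Otimes>\<^sub>M lborel))"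
    by (subst lborel_complex_eq_distr_pair, rule nn_integral_distr) (auto simp: measurable_Complex)
  also have "\<dots> = (\<integral>\<^sup>+ x. \<integral>\<^sup>+ y. f (case (x, y) of (x, y) \<Rightarrow> Complex x y) \<partial>lborel \<partial>lborel)"
    by (rule lborel.nn_integral_fst[symmetric]) (rule measurable_compose[OF measurable_Complex], simp)
  finally show ?thesis by simp
qed

lemma lborel_complex_eq_distr_vec: "(lborel :: complex measure) = distr lborel borel vec_complex"
proof (rule lborel_eqI)
  fix l u :: complex assume lu: "\<And>b. b \<in> Basis \<Longrightarrow> l \<bullet> b \<le> u \<bullet> b"
  have le: "Re l \<le> Re u" "Im l \<le> Im u" using lu[of 1] lu[of \<i>] by (auto simp: Basis_complex_def)
  have B: "(Basis :: (real^2) set) = {axis 1 1, axis 2 1}" by (auto simp: Basis_vec_def UNIV_2)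
  have ne: "axis 1 1 \<noteq> (axis 2 1 :: real^2)" by (simp add: axis_eq_axis)
  have "vec_complex -` box l u = box (complex_vec l) (complex_vec u)"
    by (auto simp: mem_box Basis_complex_def B inner_axis vec_complex_def complex_vec_def)
  then have "emeasure (distr lborel borel vec_complex) (box l u) = emeasure lborel (box (complex_vec l) (complex_vec u))"
    by (subst emeasure_distr) auto
  also have "\<dots> = ennreal (\<Prod>b\<in>Basis. (complex_vec u - complex_vec l) \<bullet> b)"
    using le by (intro emeasure_lborel_box) (auto simp: B inner_axis complex_vec_def)
  also have "(\<Prod>b\<in>Basis. (complex_vec u - complex_vec l) \<bullet> b) = (\<Prod>b\<in>Basis. (u - l) \<bullet> b)"
    using ne by (simp add: B inner_axis Basis_complex_def complex_vec_def)
  finally show "emeasure (distr lborel borel vec_complex) (box l u) = ennreal (\<Prod>b\<in>Basis. (u - l) \<bullet> b)" .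
qed simp

lemma nn_integral_complex_vec:
  assumes [measurable]: "f \<in> borel_measurable borel"
  shows "(\<integral>\<^sup>+ z. f z \<partial>lborel) = (\<integral>\<^sup>+ v. f (vec_complex v) \<partial>lborel)"
  by (subst lborel_complex_eq_distr_vec, rule nn_integral_distr) auto

lemma det_matrix_complex_mult:
  "det (matrix (\<lambda>v. complex_vec (d * vec_complex v))) = (cmod d)\<^sup>2"
proof -
  have "vec_complex (axis 1 1) = 1" "vec_complex (axis 2 1) = \<i>"
    by (simp_all add: vec_complex_def axis_def complex_eq_iff)
  then show ?thesis
    using cmod_power2[of d] by (simp add: det_2 matrix_def complex_vec_def power2_eq_square)
qed

text \<open>The Jacobian of a holomorphic map is |h'|^2, so by injectivity the left side is the
  integral of \<rho> over h(S). Applied to a squared density this is the conformal invariance of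
  Dirichlet energy.\<close>

lemma holomorphic_area_inequality:
  fixes \<rho> :: "complex \<Rightarrow> real"
  assumes S: "open S" and h: "h holomorphic_on S" and inj: "inj_on h S"
    and m [measurable]: "\<rho> \<in> borel_measurable borel" and nn: "\<And>z. 0 \<le> \<rho> z"
    and fin: "(\<integral>\<^sup>+ z. ennreal (\<rho> z) \<partial>lborel) < \<infinity>"
    and mg: "(\<lambda>z. indicator S z * ((cmod (deriv h z))\<^sup>2 * \<rho> (h z))) \<in> borel_measurable borel"
  shows "(\<integral>\<^sup>+ z. ennreal (indicator S z * ((cmod (deriv h z))\<^sup>2 * \<rho> (h z))) \<partial>lborel) \<le> (\<integral>\<^sup>+ z. ennreal (\<rho> z) \<partial>lborel)"
proof -
  define S2 where "S2 = vec_complex -` S"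
  define g where "g v = complex_vec (h (vec_complex v))" for v
  define g' where "g' v = (\<lambda>w. complex_vec (deriv h (vec_complex v) * vec_complex w))" for v
  define f where "f v = \<rho> (vec_complex v)" for v
  let ?k = "\<lambda>z. indicator S z * ((cmod (deriv h z))\<^sup>2 * \<rho> (h z))"
  let ?d = "\<lambda>x. \<bar>det (matrix (g' x))\<bar> *\<^sub>R f (g x)"
  let ?h = "\<lambda>x. indicator (g ` S2) x * f x"
  let ?I2 = "\<integral>\<^sup>+ x. ennreal (indicator S2 x * ?d x) \<partial>lborel"
  have opS2: "open S2" unfolding S2_def
    using S by (intro open_vimage linear_continuous_on bounded_linear_vec_complex)
  have der: "(g has_derivative g' v) (at v within S2)" if v: "v \<in> S2" for v
  proof -
    have "(h has_field_derivative deriv h (vec_complex v)) (at (vec_complex v))"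
      using v h S by (auto simp: S2_def intro: holomorphic_derivI)
    then have "(h has_derivative (*) (deriv h (vec_complex v))) (at (vec_complex v))"
      by (simp add: has_field_derivative_def)
    then have "((\<lambda>v. h (vec_complex v)) has_derivative (\<lambda>w. deriv h (vec_complex v) * vec_complex w)) (at v)"
      by (rule has_derivative_compose[OF bounded_linear_imp_has_derivative[OF bounded_linear_vec_complex]])
    then have "(g has_derivative g' v) (at v)"
      unfolding g_def[abs_def] g'_def by (rule bounded_linear.has_derivative[OF bounded_linear_complex_vec])
    then show ?thesis by (rule has_derivative_at_withinI)
  qed
  have injg: "inj_on g S2"
  proof (rule inj_onI)
    fix x y assume xy: "x \<in> S2" "y \<in> S2" "g x = g y"
    then have "h (vec_complex x) = h (vec_complex y)" by (metis g_def vec_complex_inverse(2))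
    then have "vec_complex x = vec_complex y" using inj xy by (auto simp: S2_def inj_on_def)
    then show "x = y" by (metis vec_complex_inverse(1))
  qed
  have f0: "0 \<le> f v" for v by (simp add: f_def nn)
  have ft: "(\<integral>\<^sup>+ v. ennreal (f v) \<partial>lborel) = (\<integral>\<^sup>+ z. ennreal (\<rho> z) \<partial>lborel)"
    unfolding f_def by (rule nn_integral_complex_vec[symmetric]) simp
  have mf: "f \<in> borel_measurable borel" unfolding f_def[abs_def] by measurable
  have "integrable lborel f"
    using mf nn fin ft by (intro integrableI_nonneg) (auto simp: f_def)
  then have fU: "f absolutely_integrable_on UNIV"
    by (simp add: set_integrable_def integrable_completion mf)
  have gS: "g ` S2 = complex_vec ` (h ` S)"
  proof -
    have "surj vec_complex" by (rule surjI) (rule vec_complex_inverse(2))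
    then have "vec_complex ` S2 = S" unfolding S2_def by (rule surj_image_vimage_eq)
    then have "(\<lambda>z. complex_vec (h z)) ` (vec_complex ` S2) = complex_vec ` (h ` S)"
      by (simp only: image_image)
    then show ?thesis by (simp only: image_image g_def[abs_def])
  qed
  have "open (h ` S)" using h S inj by (rule open_mapping_thm3)
  moreover have "complex_vec ` (h ` S) = vec_complex -` (h ` S)" by (rule complex_vec_image)
  ultimately have opg: "open (g ` S2)" unfolding gS
    by (simp add: open_vimage linear_continuous_on bounded_linear_vec_complex)
  have fg: "f absolutely_integrable_on (g ` S2)"
    using fU by (rule set_integrable_subset) (use opg in auto)
  \<comment> \<open>The change of variables theorem concerns vector-valued integrands; real values
    are wrapped as vectors of dimension 1 and unwrapped afterwards.\<close>
  have bl: "bounded_linear (vec :: real \<Rightarrow> real^1)" "bounded_linear (\<lambda>v :: real^1. v $ 1)"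
    by (auto intro!: linear_conv_bounded_linear[THEN iffD1] linearI simp: vec_eq_iff)
  define b' where "b' = integral (g ` S2) ((vec :: real \<Rightarrow> real^1) \<circ> f)"
  define b where "b = integral (g ` S2) f"
  have b: "b' = vec b"
    unfolding b'_def b_def using fg bl(1)
    by (intro integral_linear) (auto dest: set_lebesgue_integral_eq_integral)
  have S2l: "S2 \<in> sets lebesgue" using opS2 by auto
  let ?K = "\<lambda>x. \<bar>det (matrix (g' x))\<bar> *\<^sub>R ((vec :: real \<Rightarrow> real^1) \<circ> f) (g x)"
  have K: "?K absolutely_integrable_on S2" "integral S2 ?K = b'"
    using has_absolute_integral_change_of_variables[OF S2l der injg, of "vec \<circ> f" b']
      absolutely_integrable_linear[OF fg bl(1)] b'_def by simp_all
  have "(?K has_integral b') S2"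
    using K by (auto simp: has_integral_iff dest: set_lebesgue_integral_eq_integral)
  then have "((\<lambda>v. v $ 1) \<circ> ?K has_integral b' $ 1) S2"
    using bl(2) by (rule has_integral_linear)
  then have hi: "(?d has_integral b) S2"
    by (simp add: o_def b)
  have nn1: "?I2 = b"
    by (rule nn_integral_has_integral_lebesgue[OF _ hi]) (simp add: f0)
  have hi2: "(f has_integral b) (g ` S2)"
    using fg by (auto simp: has_integral_iff b_def dest: set_lebesgue_integral_eq_integral)
  have nn2: "(\<integral>\<^sup>+ x. ennreal (?h x) \<partial>lborel) = b"
    by (rule nn_integral_has_integral_lebesgue[OF _ hi2]) (simp add: f0)
  have "(\<integral>\<^sup>+ z. ennreal (?k z) \<partial>lborel)
     = (\<integral>\<^sup>+ v. ennreal (indicator S (vec_complex v) * ((cmod (deriv h (vec_complex v)))\<^sup>2 * \<rho> (h (vec_complex v)))) \<partial>lborel)"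
    using mg by (intro nn_integral_complex_vec) auto
  also have "\<dots> = ?I2"
    unfolding g'_def det_matrix_complex_mult
    by (intro nn_integral_cong) (auto simp: S2_def f_def g_def indicator_def)
  also have "\<dots> = (\<integral>\<^sup>+ x. ennreal (?h x) \<partial>lborel)" using nn1 nn2 by simp
  also have "\<dots> \<le> (\<integral>\<^sup>+ x. ennreal (f x) \<partial>lborel)"
    using nn by (intro nn_integral_mono ennreal_leI) (auto simp: indicator_def f_def)
  finally show ?thesis using ft by simp
qed

text \<open>The derivative is only known to exist, so it is integrated in the gauge sense, where the
  fundamental theorem holds for every derivative. The bound by G then leads back to the Lebesgue
  integral. If the integral of G is infinite, the claim is trivial.\<close>

lemma increment_le_nn_integral:
  fixes w G :: "real \<Rightarrow> real"
  assumes ab: "a \<le> b" and d: "\<And>y. a \<le> y \<Longrightarrow> y \<le> b \<Longrightarrow> (w has_real_derivative w' y) (at y)"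
    and le: "\<And>y. a \<le> y \<Longrightarrow> y \<le> b \<Longrightarrow> \<bar>w' y\<bar> \<le> G y"
    and m [measurable]: "G \<in> borel_measurable borel" and nn: "\<And>y. 0 \<le> G y"
  shows "ennreal \<bar>w b - w a\<bar> \<le> (\<integral>\<^sup>+ y. ennreal (G y) \<partial>lborel)"
proof (cases "(\<integral>\<^sup>+ y. ennreal (G y) \<partial>lborel) = \<infinity>")
  case False
  then have "(\<integral>\<^sup>+ y. ennreal (G y) \<partial>lborel) < \<infinity>" by (simp add: less_top)
  then have i: "integrable lborel G" using nn by (intro integrableI_nonneg) auto
  then have hi: "(G has_integral (LINT y|lborel. G y)) UNIV" by (rule has_integral_integral_lborel)
  then have GU: "G integrable_on UNIV" by blast
  then have Gab: "G integrable_on {a..b}" by (rule integrable_on_subinterval) simp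
  have fund: "(w' has_integral (w b - w a)) {a..b}"
    using ab d by (intro fundamental_theorem_of_calculus)
      (auto simp flip: has_real_derivative_iff_has_vector_derivative intro: has_field_derivative_at_within)
  have "norm (integral {a..b} w') \<le> integral {a..b} G"
    using fund Gab le by (intro integral_norm_bound_integral) auto
  then have "\<bar>w b - w a\<bar> \<le> integral {a..b} G" using fund by (simp add: integral_unique)
  also have "\<dots> \<le> integral UNIV G" using Gab GU nn by (intro integral_subset_le) auto
  also have "\<dots> = (LINT y|lborel. G y)" using hi by (rule integral_unique)
  finally have "ennreal \<bar>w b - w a\<bar> \<le> ennreal (LINT y|lborel. G y)" by (rule ennreal_leI)
  also have "\<dots> = (\<integral>\<^sup>+ y. ennreal (G y) \<partial>lborel)" using i nn by (simp add: nn_integral_eq_integral)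
  finally show ?thesis .
qed simp

text \<open>The vertical lines through a small disk on which \<open>w = 0\<close> end in the region where \<open>w = 1\<close>, so each
  of them meets an exceptional disk or carries a total variation at least 1 of \<open>w\<close>.\<close>

lemma length_area_inequality:
  fixes w :: "complex \<Rightarrow> real" and \<rho> :: "complex \<Rightarrow> real" and c :: "'i \<Rightarrow> complex"
  assumes S: "open S" "S \<subseteq> ball 0 R" and h: "h holomorphic_on S" "inj_on h S"
    and m: "\<rho> \<in> borel_measurable borel" "\<And>z. 0 \<le> \<rho> z"
    and E: "(\<integral>\<^sup>+ z. ennreal ((\<rho> z)\<^sup>2) \<partial>lborel) \<le> ennreal E" "0 \<le> E"
    and J: "finite J" "\<And>j. j \<in> J \<Longrightarrow> 0 \<le> r j"
    and w: "\<And>z. z \<notin> (\<Union>j\<in>J. cball (c j) (r j)) \<Longrightarrow> \<exists>D. (w has_derivative D) (at z) \<and>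
        (\<forall>u. \<bar>D u\<bar> \<le> (if z \<in> S then cmod (deriv h z) * \<rho> (h z) else 0) * cmod u)"
    and w1: "\<And>z. R \<le> cmod z \<Longrightarrow> w z = 1" and w0: "\<And>z. z \<in> ball z0 s \<Longrightarrow> w z = 0"
    and pos: "0 < s" "0 < R" "0 < l"
  shows "2 * s \<le> (l * E + pi * R\<^sup>2 / l) / 2 + 2 * (\<Sum>j\<in>J. r j)"
proof -
  let ?b = "(l * E + pi * R\<^sup>2 / l) / 2"
  define g where "g z = (if z \<in> S then cmod (deriv h z) * \<rho> (h z) else 0)" for z
  have dh: "deriv h holomorphic_on S" using h(1) S(1) by (rule holomorphic_deriv)
  have m1: "(\<lambda>z. indicator S z *\<^sub>R h z) \<in> borel_measurable borel"
    using S(1) h(1) by (intro borel_measurable_continuous_on_indicator) (auto intro: holomorphic_on_imp_continuous_on)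
  have m2: "(\<lambda>z. indicator S z *\<^sub>R deriv h z) \<in> borel_measurable borel"
    using S(1) dh by (intro borel_measurable_continuous_on_indicator) (auto intro: holomorphic_on_imp_continuous_on)
  \<comment> \<open>With both functions cut off outside S, measurability becomes a matter of
    continuity on S; outside S the first factor is 0.\<close>
  have geq: "g z = cmod (indicator S z *\<^sub>R deriv h z) * \<rho> (indicator S z *\<^sub>R h z)" for z
    by (simp add: g_def)
  have mg [measurable]: "g \<in> borel_measurable borel"
    unfolding geq[abs_def]
    by (rule borel_measurable_times[OF measurable_compose[OF m2 borel_measurable_norm] measurable_compose[OF m1 m(1)]])
  have g0: "0 \<le> g z" for z using m(2) by (simp add: g_def)
  have Sb [measurable]: "S \<in> sets borel" using S by simp
  have gsq: "indicator S z * ((cmod (deriv h z))\<^sup>2 * (\<rho> (h z))\<^sup>2) = (g z)\<^sup>2" for z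
    by (simp add: g_def power_mult_distrib)
  have "(\<integral>\<^sup>+ z. ennreal (indicator S z * ((cmod (deriv h z))\<^sup>2 * (\<rho> (h z))\<^sup>2)) \<partial>lborel)
      \<le> (\<integral>\<^sup>+ z. ennreal ((\<rho> z)\<^sup>2) \<partial>lborel)"
  proof (rule holomorphic_area_inequality[OF S(1) h])
    show "(\<lambda>z. (\<rho> z)\<^sup>2) \<in> borel_measurable borel" using m(1) by measurable
    show "(\<integral>\<^sup>+ z. ennreal ((\<rho> z)\<^sup>2) \<partial>lborel) < \<infinity>" using E(1) by (auto simp: less_top[symmetric] top_unique)
    show "(\<lambda>z. indicator S z * ((cmod (deriv h z))\<^sup>2 * (\<rho> (h z))\<^sup>2)) \<in> borel_measurable borel"
      unfolding gsq by measurable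
  qed simp
  then have area: "(\<integral>\<^sup>+ z. ennreal ((g z)\<^sup>2) \<partial>lborel) \<le> ennreal E" unfolding gsq using E(1) by simp
  \<comment> \<open>Pointwise AM-GM with a free parameter l takes the place of the Cauchy-Schwarz
    inequality for integrals. It can be integrated termwise, and l is chosen where the estimate is
    used.\<close>
  have amgm: "g z \<le> l / 2 * (g z)\<^sup>2 + 1 / (2 * l) * indicator (ball 0 R) z" for z
  proof (cases "z \<in> S")
    case True
    have "0 \<le> (l * g z - 1)\<^sup>2" by simp
    then have "2 * l * g z \<le> l\<^sup>2 * (g z)\<^sup>2 + 1" by (simp add: power2_eq_square algebra_simps)
    then have "g z \<le> (l\<^sup>2 * (g z)\<^sup>2 + 1) / (2 * l)" using pos by (simp add: field_simps)
    also have "\<dots> = l / 2 * (g z)\<^sup>2 + 1 / (2 * l)" using pos by (simp add: field_simps power2_eq_square)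
    finally show ?thesis using True S(2) by (auto simp: indicator_def)
  next
    case False
    then show ?thesis using pos by (simp add: g_def)
  qed
  have "(\<integral>\<^sup>+ z. ennreal (g z) \<partial>lborel)
      \<le> (\<integral>\<^sup>+ z. ennreal (l / 2) * ennreal ((g z)\<^sup>2) + ennreal (1 / (2 * l)) * indicator (ball 0 R) z \<partial>lborel)"
  proof (rule nn_integral_mono)
    fix z
    have "ennreal (g z) \<le> ennreal (l / 2 * (g z)\<^sup>2 + 1 / (2 * l) * indicator (ball 0 R) z)"
      by (rule ennreal_leI[OF amgm])
    also have "\<dots> = ennreal (l / 2) * ennreal ((g z)\<^sup>2) + ennreal (1 / (2 * l)) * indicator (ball 0 R) z"
    proof -
      have "ennreal (l / 2 * (g z)\<^sup>2) = ennreal (l / 2) * ennreal ((g z)\<^sup>2)"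
        using pos by (intro ennreal_mult) auto
      moreover have "ennreal (1 / (2 * l) * indicator (ball 0 R) z) = ennreal (1 / (2 * l)) * indicator (ball 0 R) z"
        by (simp add: indicator_def)
      ultimately show ?thesis using pos by (subst ennreal_plus) auto
    qed
    finally show "ennreal (g z) \<le> ennreal (l / 2) * ennreal ((g z)\<^sup>2) + ennreal (1 / (2 * l)) * indicator (ball 0 R) z" .
  qed
  also have "\<dots> = ennreal (l / 2) * (\<integral>\<^sup>+ z. ennreal ((g z)\<^sup>2) \<partial>lborel) + ennreal (1 / (2 * l)) * emeasure lborel (ball (0::complex) R)"
  proof -
    have [measurable]: "ball (0::complex) R \<in> sets borel" by simp
    show ?thesis
      by (subst nn_integral_add) (auto simp: nn_integral_cmult nn_integral_cmult_indicator)
  qed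
  also have "\<dots> \<le> ennreal (l / 2) * ennreal E + ennreal (1 / (2 * l)) * ennreal (pi * R\<^sup>2)"
    using area pos by (intro add_mono mult_left_mono) (auto simp: emeasure_ball unit_ball_vol_2)
  also have "\<dots> = ennreal ?b"
  proof -
    have "l / 2 * E + 1 / (2 * l) * (pi * R\<^sup>2) = ?b"
      using pos by (simp add: field_simps)
    then show ?thesis using pos E(2) by (simp flip: ennreal_mult ennreal_plus del: times_divide_eq_left times_divide_eq_right)
  qed
  finally have total: "(\<integral>\<^sup>+ z. ennreal (g z) \<partial>lborel) \<le> ennreal ?b" .
  let ?I = "{Re z0 - s<..<Re z0 + s}"
  let ?P = "\<lambda>j. {Re (c j) - r j..Re (c j) + r j}"
  let ?L = "\<lambda>t. \<integral>\<^sup>+ y. ennreal (g (Complex t y)) \<partial>lborel"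
  have line: "indicator ?I t \<le> ?L t + (\<Sum>j\<in>J. indicator (?P j) t)" for t
  proof (cases "t \<in> ?I \<and> (\<forall>j\<in>J. t \<notin> ?P j)")
    case True
    have out: "Complex t y \<notin> (\<Union>j\<in>J. cball (c j) (r j))" for y
    proof
      assume "Complex t y \<in> (\<Union>j\<in>J. cball (c j) (r j))"
      then obtain j where j: "j \<in> J" "cmod (c j - Complex t y) \<le> r j" by (auto simp: dist_norm)
      then have "\<bar>Re (c j - Complex t y)\<bar> \<le> r j" using abs_Re_le_cmod order_trans by blast
      then show False using True j by (auto simp: abs_le_iff)
    qed
    \<comment> \<open>A height not below \<open>Im z0\<close> at which every point of the plane has
      modulus at least R.\<close>
    define Y where "Y = \<bar>Im z0\<bar> + R"
    have "\<forall>y. \<exists>d. ((\<lambda>y. w (Complex t y)) has_real_derivative d) (at y) \<and> \<bar>d\<bar> \<le> g (Complex t y)"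
    proof
      fix y
      obtain D where D: "(w has_derivative D) (at (Complex t y))" "\<And>u. \<bar>D u\<bar> \<le> g (Complex t y) * cmod u"
        using w[OF out[of y]] unfolding g_def by blast
      have "((\<lambda>y. Complex t y) has_derivative (\<lambda>h. h *\<^sub>R \<i>)) (at y)"
        unfolding Complex_eq by (auto intro!: derivative_eq_intros simp: scaleR_conv_of_real)
      then have "((\<lambda>y. w (Complex t y)) has_derivative (\<lambda>h. D (h *\<^sub>R \<i>))) (at y)"
        using D(1) by (rule has_derivative_compose)
      moreover have "D (h *\<^sub>R \<i>) = D \<i> * h" for h
        using linear_scale[OF has_derivative_linear[OF D(1)]] by simp
      ultimately have "((\<lambda>y. w (Complex t y)) has_real_derivative D \<i>) (at y)"
        by (simp add: has_field_derivative_def)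
      then show "\<exists>d. ((\<lambda>y. w (Complex t y)) has_real_derivative d) (at y) \<and> \<bar>d\<bar> \<le> g (Complex t y)"
        using D(2)[of \<i>] by auto
    qed
    then obtain w' where w': "\<And>y. ((\<lambda>y. w (Complex t y)) has_real_derivative w' y) (at y)"
      "\<And>y. \<bar>w' y\<bar> \<le> g (Complex t y)" by metis
    have mt: "(\<lambda>y. g (Complex t y)) \<in> borel_measurable borel"
    proof (rule measurable_compose[OF _ mg])
      show "Complex t \<in> borel_measurable borel"
        by (intro borel_measurable_continuous_onI) (auto simp: Complex_eq intro!: continuous_intros)
    qed
    have "ennreal \<bar>w (Complex t Y) - w (Complex t (Im z0))\<bar> \<le> ?L t"
      by (rule increment_le_nn_integral[OF _ w'(1) w'(2) mt]) (auto simp: Y_def g0 pos less_imp_le intro: order_trans[OF abs_ge_self])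
    moreover have "w (Complex t Y) = 1"
    proof (rule w1)
      have "R \<le> \<bar>Im (Complex t Y)\<bar>" using pos by (simp add: Y_def)
      then show "R \<le> cmod (Complex t Y)" using abs_Im_le_cmod order_trans by blast
    qed
    moreover have "w (Complex t (Im z0)) = 0"
    proof (rule w0)
      have "z0 - Complex t (Im z0) = of_real (Re z0 - t)" by (simp add: complex_eq_iff)
      then have "dist z0 (Complex t (Im z0)) = \<bar>Re z0 - t\<bar>" by (simp only: dist_norm norm_of_real)
      then show "Complex t (Im z0) \<in> ball z0 s" using True by auto
    qed
    ultimately have "1 \<le> ?L t" by simp
    moreover have "indicator ?I t \<le> (1::ennreal)" by (simp add: indicator_def)
    ultimately show ?thesis by (meson le_add_same_cancel1 order_trans zero_le add_increasing2)
  next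
    case False
    then show ?thesis
    proof (cases "t \<in> ?I")
      case True
      then obtain j where j: "j \<in> J" "t \<in> ?P j" using False by blast
      have "(1::ennreal) = indicator (?P j) t" using j by simp
      also have "\<dots> \<le> (\<Sum>j\<in>J. indicator (?P j) t)" using j J(1) by (intro member_le_sum) auto
      finally show ?thesis using True by (simp add: add_increasing)
    qed simp
  qed
  have mC: "?L \<in> borel_measurable lborel"
  proof -
    have "(\<lambda>p. ennreal (g (case p of (x, y) \<Rightarrow> Complex x y))) \<in> borel_measurable (lborel \<Otimes>\<^sub>M lborel)"
      by (rule measurable_compose[OF measurable_Complex]) measurable
    then show ?thesis using lborel.borel_measurable_nn_integral_fst by fastforce
  qed
  have "ennreal (2 * s) = (\<integral>\<^sup>+ t. indicator ?I t \<partial>lborel)" using pos by simp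
  also have "\<dots> \<le> (\<integral>\<^sup>+ t. ?L t + (\<Sum>j\<in>J. indicator (?P j) t) \<partial>lborel)"
    by (intro nn_integral_mono line)
  also have "\<dots> = (\<integral>\<^sup>+ t. ?L t \<partial>lborel) + (\<Sum>j\<in>J. emeasure lborel (?P j))"
    using mC by (subst nn_integral_add) (auto simp: nn_integral_sum)
  also have "(\<integral>\<^sup>+ t. ?L t \<partial>lborel) = (\<integral>\<^sup>+ z. ennreal (g z) \<partial>lborel)"
    by (rule nn_integral_complex_iterated[symmetric]) measurable
  also have "(\<Sum>j\<in>J. emeasure lborel (?P j)) = (\<Sum>j\<in>J. ennreal (2 * r j))"
    using J(2) by (intro sum.cong) auto
  also have "\<dots> = ennreal (\<Sum>j\<in>J. 2 * r j)" using J(2) by (intro sum_ennreal) auto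
  also have "(\<integral>\<^sup>+ z. ennreal (g z) \<partial>lborel) + ennreal (\<Sum>j\<in>J. 2 * r j)
     \<le> ennreal ?b + ennreal (\<Sum>j\<in>J. 2 * r j)"
    using total by (rule add_right_mono)
  also have "\<dots> = ennreal (?b + (\<Sum>j\<in>J. 2 * r j))"
    using pos E(2) J(2) by (intro ennreal_plus[symmetric] sum_nonneg) auto
  finally have "2 * s \<le> ?b + (\<Sum>j\<in>J. 2 * r j)"
    using pos E(2) J(2) by (subst (asm) ennreal_le_iff) (auto intro!: add_nonneg_nonneg sum_nonneg)
  then show ?thesis by (simp add: sum_distrib_left)
qed

lemma sum_squares_disjoint_disks:
  fixes c :: "'i \<Rightarrow> complex"
  assumes J: "finite J" "\<And>j. j \<in> J \<Longrightarrow> 0 \<le> r j" and sub: "\<And>j. j \<in> J \<Longrightarrow> cball (c j) (r j) \<subseteq> ball 0 R"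
    and dis: "\<And>i j. i \<in> J \<Longrightarrow> j \<in> J \<Longrightarrow> i \<noteq> j \<Longrightarrow> cball (c i) (r i) \<inter> cball (c j) (r j) = {}" and R: "0 < R"
  shows "(\<Sum>j\<in>J. (r j)\<^sup>2) \<le> R\<^sup>2"
proof -
  have "(\<Sum>j\<in>J. ennreal (pi * (r j)\<^sup>2)) = (\<Sum>j\<in>J. emeasure lborel (cball (c j) (r j)))"
    using J(2) by (intro sum.cong) (auto simp: emeasure_cball unit_ball_vol_2)
  also have "\<dots> = emeasure lborel (\<Union>j\<in>J. cball (c j) (r j))"
    using J(1) dis by (intro sum_emeasure) (auto simp: disjoint_family_on_def)
  also have "\<dots> \<le> emeasure lborel (ball (0::complex) R)"
    using sub by (intro emeasure_mono) auto
  also have "\<dots> = ennreal (pi * R\<^sup>2)" using R by (simp add: emeasure_ball unit_ball_vol_2)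
  finally have "ennreal (\<Sum>j\<in>J. pi * (r j)\<^sup>2) \<le> ennreal (pi * R\<^sup>2)" by (simp add: sum_ennreal)
  then have "(\<Sum>j\<in>J. pi * (r j)\<^sup>2) \<le> pi * R\<^sup>2" by (subst (asm) ennreal_le_iff) auto
  then show ?thesis by (simp flip: sum_distrib_left)
qed

section \<open>Planar coordinates on the sphere\<close>

lemma unfin_homog: "unfin (homog u v) = u / v"
  by (simp add: homog_def unfin_def)

lemma unfin_rot_Fin: "unfin (rot s t (Fin u)) = (s * u - cnj t) / (t * u + cnj s)"
  by (simp add: rot_def unfin_homog)

lemma field_differentiable_transform_open:
  assumes "f field_differentiable (at z)" "open S" "z \<in> S" "\<And>w. w \<in> S \<Longrightarrow> f w = g w"
  shows "g field_differentiable (at z)"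
  using assms has_field_derivative_transform_within_open unfolding field_differentiable_def by blast

text \<open>The rotated map is a Moebius transformation of the coordinate m of f in a chart about
  f(z), and its denominator does not vanish at z because the rotated value is finite.\<close>

lemma field_differentiable_unfin_rot:
  assumes f: "sphere_holomorphic_on f \<Omega>" and op: "open \<Omega>" and z: "Fin z \<in> \<Omega>"
    and ne: "rot s t (f (Fin z)) \<noteq> Infty"
  shows "(\<lambda>w. unfin (rot s t (f (Fin w)))) field_differentiable (at z)"
proof -
  define m where "m w = chart (f (Fin z)) (f (Fin w))" for w
  have "(\<lambda>w. chart (f (Fin z)) (f (param (Fin z) w))) analytic_on {chart (Fin z) (Fin z)}"
    using f z unfolding sphere_holomorphic_on_def by blast
  then have m: "m field_differentiable (at z)"
    unfolding m_def by (simp add: analytic_on_imp_differentiable_at)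
  have nbhd: "open {w. Fin w \<in> \<Omega> \<and> f (Fin w) \<in> A}" if "open A" for A
  proof -
    have "open (\<Omega> \<inter> f -` A)"
      using f op that by (intro continuous_open_preimage) (auto simp: sphere_holomorphic_on_def)
    then have "open (Fin -` (\<Omega> \<inter> f -` A))" using continuous_on_Fin by (rule open_vimage)
    then show ?thesis by (simp add: vimage_def)
  qed
  show ?thesis
  proof (cases "f (Fin z)")
    case (Fin y)
    have den: "t * m z + cnj s \<noteq> 0"
      using ne Fin by (auto simp: m_def rot_def homog_def split: if_splits)
    have "(\<lambda>w. (s * m w - cnj t) / (t * m w + cnj s)) field_differentiable (at z)"
      using m den by (intro derivative_intros)
    then show ?thesis
    proof (rule field_differentiable_transform_open)
      show "open {w. Fin w \<in> \<Omega> \<and> f (Fin w) \<in> - {Infty}}" by (rule nbhd) (simp add: open_Compl)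
      show "z \<in> {w. Fin w \<in> \<Omega> \<and> f (Fin w) \<in> - {Infty}}" using z Fin by simp
      fix w assume "w \<in> {w. Fin w \<in> \<Omega> \<and> f (Fin w) \<in> - {Infty}}"
      then obtain u where u: "f (Fin w) = Fin u" by (cases "f (Fin w)") auto
      then show "(s * m w - cnj t) / (t * m w + cnj s) = unfin (rot s t (f (Fin w)))"
        by (simp add: unfin_rot_Fin m_def Fin)
    qed
  next
    case Infty
    have mz: "m z = 0" by (simp add: m_def Infty)
    have "t \<noteq> 0" using ne Infty by (auto simp: rot_def homog_def split: if_splits)
    then have den: "t + cnj s * m z \<noteq> 0" by (simp add: mz)
    have "(\<lambda>w. (s - cnj t * m w) / (t + cnj s * m w)) field_differentiable (at z)"
      using m den by (intro derivative_intros)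
    then show ?thesis
    proof (rule field_differentiable_transform_open)
      \<comment> \<open>\<open>chart Infty\<close> takes the value 0 at \<open>Fin 0\<close> as well
        as at \<open>Infty\<close>. The preimage of \<open>Fin 0\<close> is removed so that m is the
        true coordinate.\<close>
      show "open {w. Fin w \<in> \<Omega> \<and> f (Fin w) \<in> - {Fin 0}}" by (rule nbhd) (simp add: open_Compl)
      show "z \<in> {w. Fin w \<in> \<Omega> \<and> f (Fin w) \<in> - {Fin 0}}" using z Infty by simp
      fix w assume w: "w \<in> {w. Fin w \<in> \<Omega> \<and> f (Fin w) \<in> - {Fin 0}}"
      show "(s - cnj t * m w) / (t + cnj s * m w) = unfin (rot s t (f (Fin w)))"
      proof (cases "f (Fin w)")
        case (Fin u)
        then have u: "u \<noteq> 0" using w by auto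
        have "(s * u - cnj t) / (t * u + cnj s) = (u * (s - cnj t * (1 / u))) / (u * (t + cnj s * (1 / u)))"
          using u by (simp add: algebra_simps)
        then show ?thesis using u Fin by (simp add: unfin_rot_Fin m_def Infty)
      next
        case i: Infty
        then show ?thesis by (simp add: m_def Infty rot_def unfin_homog)
      qed
    qed
  qed
qed

text \<open>In the plane the spherical disk is |z - \<beta>|^2 \<le> K (1 + |z|^2), and K < 1 says
  exactly that infinity lies outside it. Completing the square gives a Euclidean disk with centre
  \<beta> / (1 - K).\<close>

lemma planar_trace_of_spherical_disk:
  assumes r: "0 \<le> r" "r \<le> pi" and far: "r < dist Infty b"
  obtains c \<rho> where "0 \<le> \<rho>" "{z. dist (Fin z) b \<le> r} = cball c \<rho>"
proof -
  obtain \<beta> where b: "b = Fin \<beta>" using far r by (cases b) auto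
  define t where "t = (cmod \<beta>)\<^sup>2"
  have t: "0 \<le> t" by (simp add: t_def)
  define K where "K = (1 - cos r) / 2 * (1 + t)"
  have K0: "0 \<le> K" using t by (simp add: K_def)
  have "stereo (Fin \<beta>) \<bullet> stereo Infty < cos r"
    using far dist_sphere_le_iff[OF r, of "Fin \<beta>" Infty] dist_commute[of "Fin \<beta>" Infty] unfolding b by linarith
  then have "(t - 1) / (t + 1) < cos r" by (simp only: inner_stereo_Fin_Infty t_def)
  then have "t - 1 < cos r * (t + 1)" using t by (simp add: divide_less_eq)
  then have K1: "K < 1" by (simp add: K_def algebra_simps)
  have iff: "dist (Fin z) b \<le> r \<longleftrightarrow> (cmod (z - \<beta>))\<^sup>2 \<le> K * (1 + (cmod z)\<^sup>2)" for z
  proof -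
    define A where "A = (1 + (cmod z)\<^sup>2)"
    have A: "0 < A" by (simp add: A_def add_pos_nonneg)
    have "dist (Fin z) b \<le> r \<longleftrightarrow> cos r \<le> 1 - 2 * (cmod (z - \<beta>))\<^sup>2 / (A * (1 + t))"
      unfolding b dist_sphere_le_iff[OF r] inner_stereo_Fin A_def t_def ..
    also have "\<dots> \<longleftrightarrow> 2 * (cmod (z - \<beta>))\<^sup>2 / (A * (1 + t)) \<le> 1 - cos r" by linarith
    also have "\<dots> \<longleftrightarrow> 2 * (cmod (z - \<beta>))\<^sup>2 \<le> (1 - cos r) * (A * (1 + t))"
      using A t by (intro pos_divide_le_eq) simp
    also have "(1 - cos r) * (A * (1 + t)) = 2 * (K * A)" by (simp add: K_def)
    finally show ?thesis by (simp add: A_def)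
  qed
  define c where "c = (1 / (1 - K)) *\<^sub>R \<beta>"
  define q where "q = t / (1 - K)\<^sup>2 - (t - K) / (1 - K)"
  have iff2: "(cmod (z - \<beta>))\<^sup>2 \<le> K * (1 + (cmod z)\<^sup>2) \<longleftrightarrow> (cmod (z - c))\<^sup>2 \<le> q" for z
  proof -
    have e1: "(cmod (z - \<beta>))\<^sup>2 = (cmod z)\<^sup>2 - 2 * (z \<bullet> \<beta>) + t"
      unfolding t_def power2_norm_eq_inner by (simp add: inner_diff_left inner_diff_right inner_commute)
    have "(cmod (z - c))\<^sup>2 = (cmod z)\<^sup>2 - 2 * (z \<bullet> c) + (cmod c)\<^sup>2"
      unfolding power2_norm_eq_inner by (simp add: inner_diff_left inner_diff_right inner_commute)
    moreover have "z \<bullet> c = (z \<bullet> \<beta>) / (1 - K)" by (simp add: c_def)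
    moreover have "(cmod c)\<^sup>2 = t / (1 - K)\<^sup>2" by (simp add: c_def t_def power_mult_distrib power_divide)
    ultimately have e2: "(cmod (z - c))\<^sup>2 = (cmod z)\<^sup>2 - 2 * (z \<bullet> \<beta>) / (1 - K) + t / (1 - K)\<^sup>2" by simp
    have "(cmod (z - c))\<^sup>2 \<le> q \<longleftrightarrow> (cmod z)\<^sup>2 - 2 * (z \<bullet> \<beta>) / (1 - K) + (t - K) / (1 - K) \<le> 0"
      unfolding e2 q_def by linarith
    also have "(cmod z)\<^sup>2 - 2 * (z \<bullet> \<beta>) / (1 - K) + (t - K) / (1 - K)
       = ((1 - K) * (cmod z)\<^sup>2 - 2 * (z \<bullet> \<beta>) + (t - K)) / (1 - K)"
      using K1 by (simp add: add_divide_distrib diff_divide_distrib)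
    also have "\<dots> \<le> 0 \<longleftrightarrow> (1 - K) * (cmod z)\<^sup>2 - 2 * (z \<bullet> \<beta>) + (t - K) \<le> 0"
      using K1 by (simp add: divide_le_0_iff)
    finally show ?thesis unfolding e1 by (simp add: algebra_simps)
  qed
  have "(cmod (\<beta> - c))\<^sup>2 \<le> q" using iff2[of \<beta>] K0 by (simp add: add_nonneg_nonneg)
  then have q: "0 \<le> q" using zero_le_power2 order_trans by blast
  show thesis
  proof (rule that)
    show "0 \<le> sqrt q" using q by simp
    show "{z. dist (Fin z) b \<le> r} = cball c (sqrt q)"
    proof (rule set_eqI)
      fix z
      have "(cmod (z - c))\<^sup>2 \<le> q \<longleftrightarrow> cmod (z - c) \<le> sqrt q"
        using real_le_rsqrt[of "cmod (z - c)" q] q by (metis norm_ge_zero real_sqrt_le_iff real_sqrt_abs abs_of_nonneg)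
      then show "z \<in> {z. dist (Fin z) b \<le> r} \<longleftrightarrow> z \<in> cball c (sqrt q)"
        using iff iff2 by (simp add: dist_norm norm_minus_commute)
    qed
  qed
qed

section \<open>Potentials of the slit levels\<close>

text \<open>\<open>\<phi> k\<close> is a cutoff about 0, to be translated to the gap centres of
  level k. By \<open>gap_less\<close> the ball on which it is 1 covers a whole gap. The budget 1 /
  (k + 2)^3 allows for k + 2 centres and for another factor k + 2 from squaring a sum.\<close>

locale slit_potential = slit_system +
  fixes \<eta> :: "nat \<Rightarrow> real" and \<phi> \<rho> :: "nat \<Rightarrow> complex \<Rightarrow> real"
  assumes gap_less: "\<And>k. 2 * \<beta> k < \<eta> k"
    and cutoff_deriv: "\<And>k z. \<exists>D. (\<phi> k has_derivative D) (at z) \<and> (\<forall>h. \<bar>D h\<bar> \<le> \<rho> k z * cmod h)"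
    and cutoff_nonneg: "\<And>k z. 0 \<le> \<phi> k z"
    and cutoff_near: "\<And>k z. cmod z < \<eta> k \<Longrightarrow> \<phi> k z = 1"
    and cutoff_far: "\<And>k z. width k \<le> cmod z \<Longrightarrow> \<phi> k z = 0"
    and cutoff_measurable: "\<And>k. \<rho> k \<in> borel_measurable borel"
    and density_nonneg: "\<And>k z. 0 \<le> \<rho> k z"
    and cutoff_energy: "\<And>k. (\<integral>\<^sup>+ z. ennreal ((\<rho> k z)\<^sup>2) \<partial>lborel) \<le> ennreal (1 / real (k + 2) ^ 3)"
begin

definition centre :: "nat \<Rightarrow> nat \<Rightarrow> complex" where
  "centre k j = of_real (rad k) * cis (2 * pi * real j / real (Suc k))"

text \<open>Equal to 0 about the gap centres and to 1 away from the circle. The sum of cutoffs may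
  exceed 1 where several overlap, as at the coinciding centres for j = 0 and j = k + 1;
  \<open>smooth_step\<close> absorbs the negative argument.\<close>

definition plateau :: "nat \<Rightarrow> complex \<Rightarrow> real" where
  "plateau k z = smooth_step (1 - (\<Sum>j\<le>Suc k. \<phi> k (z - centre k j)))"

text \<open>The potential of level \<open>k\<close> falls from 1 to 0 across the circle of radius \<open>rad k\<close>: it jumps across
  the slits and passes continuously through the value 1/2 in the gaps.\<close>

definition potential :: "nat \<Rightarrow> complex \<Rightarrow> real" where
  "potential k z = (if cmod z < rad k then (1 + plateau k z) / 2 else (1 - plateau k z) / 2)"

text \<open>The constant 2 is the bound 4 for \<open>smooth_step'\<close>, halved by the definition
  of \<open>potential\<close>.\<close>

definition slit_density :: "nat \<Rightarrow> complex \<Rightarrow> real" where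
  "slit_density k z = 2 * (\<Sum>j\<le>Suc k. \<rho> k (z - centre k j))"

lemma norm_centre: "cmod (centre k j) = rad k"
  using rad_gt_1[of k] by (simp add: centre_def norm_mult)

lemma plateau_deriv:
  "\<exists>D. (plateau k has_derivative D) (at z) \<and> (\<forall>h. \<bar>D h\<bar> \<le> 2 * slit_density k z * cmod h)"
proof -
  obtain D where D: "\<And>z. (\<phi> k has_derivative D z) (at z)" "\<And>z h. \<bar>D z h\<bar> \<le> \<rho> k z * cmod h"
    using cutoff_deriv[of k] by metis
  have "((\<lambda>z. \<phi> k (z - centre k j)) has_derivative D (z - centre k j)) (at z)" for j
  proof -
    have "((\<lambda>z. z - centre k j) has_derivative (\<lambda>h. h)) (at z)" by (auto intro!: derivative_eq_intros)
    then show ?thesis using D(1) by (rule has_derivative_compose)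
  qed
  then have "((\<lambda>z. 1 - (\<Sum>j\<le>Suc k. \<phi> k (z - centre k j))) has_derivative (\<lambda>h. 0 - (\<Sum>j\<le>Suc k. D (z - centre k j) h))) (at z)"
    by (intro has_derivative_diff has_derivative_const has_derivative_sum)
  then have d: "(plateau k has_derivative (\<lambda>h. (0 - (\<Sum>j\<le>Suc k. D (z - centre k j) h)) * smooth_step' (1 - (\<Sum>j\<le>Suc k. \<phi> k (z - centre k j))))) (at z)"
    unfolding plateau_def[abs_def] by (rule DERIV_compose_FDERIV[OF smooth_step_deriv])
  have "\<bar>(0 - (\<Sum>j\<le>Suc k. D (z - centre k j) h)) * smooth_step' x\<bar> \<le> 2 * slit_density k z * cmod h" for h x
  proof -
    have "\<bar>\<Sum>j\<le>Suc k. D (z - centre k j) h\<bar> \<le> (\<Sum>j\<le>Suc k. \<bar>D (z - centre k j) h\<bar>)" by (rule sum_abs)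
    also have "\<dots> \<le> (\<Sum>j\<le>Suc k. \<rho> k (z - centre k j) * cmod h)" by (intro sum_mono D(2))
    also have "\<dots> = slit_density k z * cmod h / 2" by (simp add: slit_density_def sum_distrib_right del: sum.atMost_Suc)
    finally have "\<bar>\<Sum>j\<le>Suc k. D (z - centre k j) h\<bar> * \<bar>smooth_step' x\<bar> \<le> slit_density k z * cmod h / 2 * 4"
      using smooth_step'_bound[of x] by (intro mult_mono) (auto simp: slit_density_def sum_nonneg density_nonneg)
    then show ?thesis by (simp only: abs_mult diff_0 abs_minus_cancel)
  qed
  then show ?thesis using d by blast
qed

lemma plateau_eq_1:
  assumes "width k \<le> \<bar>cmod z - rad k\<bar>"
  shows "plateau k z = 1"
proof -
  have "\<phi> k (z - centre k j) = 0" for j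
  proof (rule cutoff_far)
    have "\<bar>cmod z - cmod (centre k j)\<bar> \<le> cmod (z - centre k j)" by (rule norm_triangle_ineq3)
    then show "width k \<le> cmod (z - centre k j)" using assms by (simp add: norm_centre)
  qed
  then show ?thesis by (simp add: plateau_def smooth_step_eq_1)
qed

lemma plateau_eq_0:
  assumes "j \<le> Suc k" "cmod (z - centre k j) < \<eta> k"
  shows "plateau k z = 0"
proof -
  have "1 = \<phi> k (z - centre k j)" using cutoff_near assms by simp
  also have "\<dots> \<le> (\<Sum>j\<le>Suc k. \<phi> k (z - centre k j))"
    using assms cutoff_nonneg by (intro member_le_sum) auto
  finally show ?thesis by (simp add: plateau_def smooth_step_eq_0)
qed

lemma potential_inner: "cmod z \<le> rad k - width k \<Longrightarrow> potential k z = 1"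
  using plateau_eq_1[of k z] width_pos[of k] by (auto simp: potential_def)

lemma potential_outer: "rad k + width k \<le> cmod z \<Longrightarrow> potential k z = 0"
  using plateau_eq_1[of k z] width_pos[of k] by (auto simp: potential_def)

lemma slit_density_nonneg: "0 \<le> slit_density k z"
  by (simp add: slit_density_def sum_nonneg density_nonneg)

text \<open>A point of circle k off the slits lies within \<open>2 * \<beta> k < \<eta> k\<close> of
  a gap centre, and \<open>plateau\<close> vanishes on the ball of radius \<open>\<eta> k\<close>
  about it, so both branches of the definition give 1/2 there. Off the circle only one branch
  matters.\<close>

lemma potential_deriv:
  assumes z: "z \<notin> slits"
  shows "\<exists>D. (potential k has_derivative D) (at z) \<and> (\<forall>h. \<bar>D h\<bar> \<le> slit_density k z * cmod h)"
proof (cases "cmod z = rad k")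
  case True
  obtain j where j: "j \<le> Suc k" "cmod (z - centre k j) \<le> 2 * \<beta> k"
    using gap_near_centre[OF z True] by (auto simp: centre_def)
  have "(potential k has_derivative (\<lambda>h. 0)) (at z)"
  proof (rule has_derivative_transform_within_open[of "\<lambda>_. 1 / 2" _ _ _ "ball (centre k j) (\<eta> k)"])
    show "z \<in> ball (centre k j) (\<eta> k)" using j gap_less[of k] by (simp add: dist_norm norm_minus_commute)
    fix w assume "w \<in> ball (centre k j) (\<eta> k)"
    then have "plateau k w = 0" using plateau_eq_0[OF j(1)] by (simp add: dist_norm norm_minus_commute)
    then show "1 / 2 = potential k w" by (simp add: potential_def)
  qed auto
  then show ?thesis using slit_density_nonneg by (intro exI[of _ "\<lambda>_. 0"]) simp
next
  case False
  obtain D where D: "(plateau k has_derivative D) (at z)" "\<And>h. \<bar>D h\<bar> \<le> 2 * slit_density k z * cmod h"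
    using plateau_deriv by blast
  have side: ?thesis if S: "open S" "z \<in> S" "\<And>w. w \<in> S \<Longrightarrow> (1 + \<sigma> * plateau k w) / 2 = potential k w"
    and \<sigma>: "\<bar>\<sigma>\<bar> = 1" for S \<sigma>
  proof -
    have "((\<lambda>w. (1 + \<sigma> * plateau k w) / 2) has_derivative (\<lambda>h. (0 + \<sigma> * D h) / 2)) (at z)"
      using D(1) by (intro bounded_linear.has_derivative[OF bounded_linear_divide] has_derivative_add
          has_derivative_const has_derivative_mult_right)
    then have "(potential k has_derivative (\<lambda>h. (0 + \<sigma> * D h) / 2)) (at z)"
      by (rule has_derivative_transform_within_open[OF _ S])
    moreover have "\<bar>(0 + \<sigma> * D h) / 2\<bar> \<le> slit_density k z * cmod h" for h
      using D(2)[of h] \<sigma> by (simp add: abs_mult)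
    ultimately show ?thesis by blast
  qed
  show ?thesis
    using side[of "ball 0 (rad k)" 1] side[of "- cball 0 (rad k)" "-1"] False
    by (cases "cmod z < rad k") (auto simp: potential_def open_Compl)
qed

lemma slit_density_measurable: "slit_density k \<in> borel_measurable borel"
proof -
  have "(\<lambda>z. \<rho> k (z - centre k j)) \<in> borel_measurable borel" for j
    by (rule measurable_compose[OF _ cutoff_measurable]) measurable
  then show ?thesis unfolding slit_density_def[abs_def] by measurable
qed

lemma nn_integral_translate:
  fixes f :: "complex \<Rightarrow> ennreal"
  assumes "f \<in> borel_measurable borel"
  shows "(\<integral>\<^sup>+ z. f (z - c) \<partial>lborel) = (\<integral>\<^sup>+ z. f z \<partial>lborel)"
proof -
  have "(\<integral>\<^sup>+ z. f z \<partial>lborel) = (\<integral>\<^sup>+ z. f z \<partial>(distr lborel borel ((+) (- c))))"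
    by (simp only: lborel_distr_plus)
  also have "\<dots> = (\<integral>\<^sup>+ z. f (- c + z) \<partial>lborel)"
    using assms by (intro nn_integral_distr) auto
  finally show ?thesis by simp
qed

text \<open>The Cauchy-Schwarz inequality for k + 2 summands gives 4 (k + 2) times the sum of k + 2
  energies, each at most 1 / (k + 2)^3.\<close>

lemma slit_density_energy: "(\<integral>\<^sup>+ z. ennreal ((slit_density k z)\<^sup>2) \<partial>lborel) \<le> ennreal (4 / real (k + 2))"
proof -
  let ?S = "\<lambda>z. \<Sum>j\<le>Suc k. (\<rho> k (z - centre k j))\<^sup>2"
  let ?e = "1 / real (k + 2) ^ 3"
  have sq: "(slit_density k z)\<^sup>2 \<le> 4 * real (k + 2) * ?S z" for z
  proof -
    have "(\<Sum>j\<le>Suc k. \<rho> k (z - centre k j) * 1)\<^sup>2 \<le> ?S z * (\<Sum>j\<le>Suc k. 1\<^sup>2)"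
      by (rule Cauchy_Schwarz_ineq_sum)
    also have "(\<Sum>j\<le>Suc k. (1::real)\<^sup>2) = real (k + 2)" by simp
    finally have "(\<Sum>j\<le>Suc k. \<rho> k (z - centre k j))\<^sup>2 \<le> ?S z * real (k + 2)"
      by (simp only: mult_1_right)
    moreover have "4 * x \<le> 4 * n * y" if "x \<le> y * n" for x y n :: real
      using that by (simp add: mult.commute)
    ultimately have "4 * (\<Sum>j\<le>Suc k. \<rho> k (z - centre k j))\<^sup>2 \<le> 4 * real (k + 2) * ?S z"
      by blast
    then show ?thesis by (simp only: slit_density_def power_mult_distrib) simp
  qed
  have m: "(\<lambda>z. \<rho> k (z - centre k j)) \<in> borel_measurable borel" for j
    by (rule measurable_compose[OF _ cutoff_measurable]) measurable
  have e: "(\<integral>\<^sup>+ z. ennreal ((\<rho> k (z - centre k j))\<^sup>2) \<partial>lborel) \<le> ennreal ?e" for j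
  proof -
    have "(\<lambda>z. ennreal ((\<rho> k z)\<^sup>2)) \<in> borel_measurable borel" using cutoff_measurable by measurable
    from nn_integral_translate[OF this, of "centre k j"] show ?thesis using cutoff_energy[of k] by simp
  qed
  have "(\<integral>\<^sup>+ z. ennreal ((slit_density k z)\<^sup>2) \<partial>lborel)
      \<le> (\<integral>\<^sup>+ z. ennreal (4 * real (k + 2)) * (\<Sum>j\<le>Suc k. ennreal ((\<rho> k (z - centre k j))\<^sup>2)) \<partial>lborel)"
  proof (rule nn_integral_mono)
    fix z
    have "ennreal ((slit_density k z)\<^sup>2) \<le> ennreal (4 * real (k + 2) * ?S z)"
      by (rule ennreal_leI[OF sq])
    also have "\<dots> = ennreal (4 * real (k + 2)) * ennreal (?S z)"
      by (intro ennreal_mult sum_nonneg) auto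
    also have "ennreal (?S z) = (\<Sum>j\<le>Suc k. ennreal ((\<rho> k (z - centre k j))\<^sup>2))"
      by (rule sum_ennreal[symmetric]) auto
    finally show "ennreal ((slit_density k z)\<^sup>2) \<le> ennreal (4 * real (k + 2)) * (\<Sum>j\<le>Suc k. ennreal ((\<rho> k (z - centre k j))\<^sup>2))" .
  qed
  also have "\<dots> = ennreal (4 * real (k + 2)) * (\<Sum>j\<le>Suc k. (\<integral>\<^sup>+ z. ennreal ((\<rho> k (z - centre k j))\<^sup>2) \<partial>lborel))"
  proof -
    have "(\<lambda>z. ennreal ((\<rho> k (z - centre k j))\<^sup>2)) \<in> borel_measurable lborel" for j using m by measurable
    note m2 = this
    then have "(\<lambda>z. \<Sum>j\<le>Suc k. ennreal ((\<rho> k (z - centre k j))\<^sup>2)) \<in> borel_measurable lborel"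
      by (intro borel_measurable_sum)
    then show ?thesis by (simp only: nn_integral_cmult nn_integral_sum[OF m2])
  qed
  also have "\<dots> \<le> ennreal (4 * real (k + 2)) * (\<Sum>j\<le>Suc k. ennreal ?e)"
    by (intro mult_left_mono sum_mono e) auto
  also have "(\<Sum>j\<le>Suc k. ennreal ?e) = ennreal (\<Sum>j\<le>Suc k. 1 / real (k + 2) ^ 3)"
    by (rule sum_ennreal) auto
  also have "(\<Sum>j\<le>Suc k. 1 / real (k + 2) ^ 3) = real (k + 2) * ?e" by simp
  also have "ennreal (4 * real (k + 2)) * ennreal (real (k + 2) * ?e)
     = ennreal (4 * real (k + 2) * (real (k + 2) * ?e))"
    by (rule ennreal_mult[symmetric]) auto
  also have "4 * real (k + 2) * (real (k + 2) * ?e) = 4 / real (k + 2)"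
  proof -
    have "4 * x * (x * (1 / x ^ 3)) = 4 / x" if "x \<noteq> 0" for x :: real
      using that by (simp add: power3_eq_cube)
    from this[of "real (k + 2)"] show ?thesis by simp
  qed
  finally show ?thesis .
qed

end

text \<open>The order of choice matters: cutoffs vanishing beyond the distance
  \<open>width k\<close> come before the gaps, which are then made small compared with the radius
  \<open>\<eta> k\<close> on which a cutoff is 1.\<close>

lemma slit_potential_exists: "\<exists>\<beta> \<eta> \<phi> \<rho>. slit_potential \<beta> \<eta> \<phi> \<rho>"
proof -
  define P where "P k \<eta> \<phi> \<rho> \<longleftrightarrow> 0 < \<eta> \<and> (\<forall>z. \<exists>D. (\<phi> has_derivative D) (at z) \<and> (\<forall>h. \<bar>D h\<bar> \<le> \<rho> z * cmod h)) \<and>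
    (\<forall>z. 0 \<le> \<phi> z) \<and> (\<forall>z. cmod z < \<eta> \<longrightarrow> \<phi> z = 1) \<and> (\<forall>z. width k \<le> cmod z \<longrightarrow> \<phi> z = 0) \<and>
    \<rho> \<in> borel_measurable borel \<and> (\<forall>z. 0 \<le> \<rho> z) \<and>
    (\<integral>\<^sup>+ z. ennreal ((\<rho> z)\<^sup>2) \<partial>lborel) \<le> ennreal (1 / real (k + 2) ^ 3)"
    for k \<eta> and \<phi> \<rho> :: "complex \<Rightarrow> real"
  have "\<exists>\<eta> \<phi> \<rho>. P k \<eta> \<phi> \<rho>" for k
  proof -
    have pos: "0 < 1 / real (k + 2) ^ 3" by simp
    show ?thesis
      apply (rule cutoff_exists[OF width_pos[of k] pos])
      subgoal for \<eta> \<phi> \<rho>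
        by (rule exI[of _ \<eta>], rule exI[of _ \<phi>], rule exI[of _ \<rho>], unfold P_def, intro conjI allI impI) simp_all
      done
  qed
  then obtain \<eta> \<phi> \<rho> where "\<And>k. P k (\<eta> k) (\<phi> k) (\<rho> k)" by metis
  note * = this[unfolded P_def]
  define \<beta> where "\<beta> k = min (1 / real (Suc k)) (\<eta> k / 4)" for k
  have "slit_potential \<beta> \<eta> \<phi> \<rho>"
  proof
    fix k
    show "0 < \<beta> k" using *[of k] by (simp add: \<beta>_def)
    have "\<beta> k * real (Suc k) \<le> 1 / real (Suc k) * real (Suc k)"
      by (intro mult_right_mono) (auto simp: \<beta>_def)
    then show "\<beta> k * real (Suc k) \<le> 1" by simp
    show "2 * \<beta> k < \<eta> k" using *[of k] by (simp add: \<beta>_def min_def)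
  qed (use * in blast)+
  then show ?thesis by blast
qed

section \<open>Circle domains conformally equivalent to the slit domain\<close>

lemma open_Fin_image: "open S \<Longrightarrow> open (Fin ` S)"
proof -
  assume S: "open S"
  have "Fin ` S = - {Infty} \<inter> unfin -` S"
  proof (rule set_eqI)
    fix x show "x \<in> Fin ` S \<longleftrightarrow> x \<in> - {Infty} \<inter> unfin -` S" by (cases x) auto
  qed
  then show "open (Fin ` S)"
    using continuous_open_preimage[OF continuous_on_unfin open_not_Infty S] by simp
qed

lemma closed_Fin_cball: "closed (Fin ` cball 0 r)"
  using compact_continuous_image[OF continuous_on_Fin compact_cball] by (rule compact_imp_closed)

lemma frontier_Fin_ball: "frontier (Fin ` ball 0 r) \<subseteq> Fin ` sphere 0 r"
proof -
  have "closure (Fin ` ball 0 r) \<subseteq> Fin ` cball 0 r"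
    by (rule closure_minimal) (auto simp: closed_Fin_cball)
  then have "frontier (Fin ` ball 0 r) \<subseteq> Fin ` cball 0 r - Fin ` ball 0 r"
    using open_Fin_image[OF open_ball, of 0 r] by (auto simp: frontier_def interior_open)
  also have "\<dots> = Fin ` (cball 0 r - ball 0 r)" by (rule image_set_diff[symmetric]) (simp add: inj_def)
  also have "\<dots> = Fin ` sphere 0 r" by (simp add: cball_diff_eq_sphere)
  finally show ?thesis .
qed

lemma frontier_Fin_cball: "frontier (Fin ` cball 0 r) \<subseteq> Fin ` sphere 0 r"
proof -
  have "Fin ` ball 0 r \<subseteq> interior (Fin ` cball 0 r)"
    using open_Fin_image[OF open_ball, of 0 r] by (intro interior_maximal) auto
  then have "frontier (Fin ` cball 0 r) \<subseteq> Fin ` cball 0 r - Fin ` ball 0 r"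
    using closed_Fin_cball[of r] by (auto simp: frontier_def)
  also have "\<dots> = Fin ` (cball 0 r - ball 0 r)" by (rule image_set_diff[symmetric]) (simp add: inj_def)
  also have "\<dots> = Fin ` sphere 0 r" by (simp add: cball_diff_eq_sphere)
  finally show ?thesis .
qed

lemma hat_proj_eq_of_mem: "x' \<in> hat_proj U x \<Longrightarrow> hat_proj U x' = hat_proj U x"
proof (cases "x \<in> U")
  case True
  then show "x' \<in> hat_proj U x \<Longrightarrow> hat_proj U x' = hat_proj U x" by (auto simp: hat_proj_def)
next
  case False
  show "x' \<in> hat_proj U x \<Longrightarrow> hat_proj U x' = hat_proj U x"
    by (rule hat_proj_eq_comp[OF hat_proj_comps[OF False]])
qed

text \<open>The situation to be refuted, in which the unit disk corresponds to a disk of positive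
  radius. The rotation with parameters s and t moves the centre of that disk to infinity; being an
  isometry, it keeps closed disks closed disks.\<close>

locale slit_uniformization = slit_potential +
  fixes D :: "riemann_sphere set" and f g :: "riemann_sphere \<Rightarrow> riemann_sphere" and s t :: complex and r0 :: real
  assumes D: "circle_domain D" and fg: "homeomorphism slit_dom D f g" and f: "sphere_holomorphic_on f slit_dom"
    and st: "(cmod s)\<^sup>2 + (cmod t)\<^sup>2 = 1" and r0: "0 < r0"
    and disk_image: "hat_ext slit_dom D f unit_disk = cball (rot (cnj s) (- t) Infty) r0"
begin

definition pole :: riemann_sphere where "pole = rot (cnj s) (- t) Infty"
definition param_away :: "complex \<Rightarrow> riemann_sphere" where "param_away z = rot (cnj s) (- t) (Fin z)"
definition coord :: "riemann_sphere \<Rightarrow> complex" where "coord x = unfin (rot s t x)"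

lemma st': "(cmod (cnj s))\<^sup>2 + (cmod (- t))\<^sup>2 = 1" using st by simp

lemma rot_st [simp]: "rot s t (rot (cnj s) (- t) x) = x" "rot (cnj s) (- t) (rot s t x) = x"
  using rot_inverse[OF st'] rot_inverse[OF st] by simp_all

lemma rot_eq_Infty: "rot s t x = Infty \<longleftrightarrow> x = pole"
  unfolding pole_def by (metis rot_st)

lemma coord_param [simp]: "coord (param_away z) = z" by (simp add: coord_def param_away_def)

lemma param_coord: "x \<noteq> pole \<Longrightarrow> param_away (coord x) = x"
  by (simp add: coord_def param_away_def Fin_unfin rot_eq_Infty)

lemma continuous_on_param: "continuous_on UNIV param_away"
  unfolding param_away_def[abs_def]
  by (rule continuous_on_compose2[OF continuous_on_rot[OF st', of UNIV] continuous_on_Fin]) auto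

lemma dist_param: "dist (param_away z) x = dist (Fin z) (rot s t x)"
  using dist_rot[OF st, of "param_away z" x] by (simp add: param_away_def)

lemma domain_D: "sphere_domain D" "open D"
  using D by (simp_all add: circle_domain_def sphere_domain_def)

lemma open_slit_dom: "open slit_dom" using sphere_domain_slit_dom by (simp add: sphere_domain_def)

section \<open>The homeomorphism of the quotient spaces on components\<close>

definition fwd :: "riemann_sphere set \<Rightarrow> riemann_sphere set" where "fwd = hat_ext slit_dom D f"
definition bwd :: "riemann_sphere set \<Rightarrow> riemann_sphere set" where "bwd = hat_ext D slit_dom g"

lemma hat_homeomorphism: "homeomorphic_maps (hat_space slit_dom) (hat_space D) fwd bwd"
  unfolding fwd_def bwd_def using hat_map_eq(2)[OF sphere_domain_slit_dom domain_D(1) fg] .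

lemma comps_topspace: "p \<in> comps U \<Longrightarrow> p \<in> topspace (hat_space U)"
  by (simp add: topspace_hat_space range_hat_proj)

lemma fwd_comps: "p \<in> comps slit_dom \<Longrightarrow> fwd p \<in> comps D"
  using hat_ext_ends_at[OF sphere_domain_slit_dom domain_D(1) fg] by (simp add: fwd_def ends_at_def)

lemma bwd_comps: "q \<in> comps D \<Longrightarrow> bwd q \<in> comps slit_dom"
  using hat_ext_ends_at[OF domain_D(1) sphere_domain_slit_dom homeomorphism_symD[OF fg]] by (simp add: bwd_def ends_at_def)

lemma bwd_fwd: "p \<in> comps slit_dom \<Longrightarrow> bwd (fwd p) = p"
  using hat_homeomorphism comps_topspace by (simp add: homeomorphic_maps_def)

lemma fwd_bwd: "q \<in> comps D \<Longrightarrow> fwd (bwd q) = q"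
  using hat_homeomorphism comps_topspace by (simp add: homeomorphic_maps_def)

lemma unit_disk_comps: "unit_disk \<in> comps slit_dom" by (simp add: comps_slit_dom)

lemma slit_comps: "j \<le> k \<Longrightarrow> Fin ` slit k j \<in> comps slit_dom"
  by (auto simp: comps_slit_dom levels_def intro!: image_eqI[of _ _ "(k, j)"])

lemma fwd_disk: "fwd unit_disk = cball pole r0" by (simp add: fwd_def pole_def disk_image)

lemma pole_notin: "pole \<notin> D"
proof -
  have "pole \<in> fwd unit_disk" using r0 by (simp add: fwd_disk)
  then show ?thesis using comps_facts(4)[OF domain_D(2) fwd_comps[OF unit_disk_comps]] by blast
qed

section \<open>The conformal map in planar coordinates\<close>

definition planar_map :: "complex \<Rightarrow> complex" where "planar_map z = coord (f (Fin z))"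
definition planar_inv :: "complex \<Rightarrow> complex" where "planar_inv w = unfin (g (param_away w))"
definition planar_image :: "complex set" where "planar_image = planar_map ` (- slits)"

lemma Fin_in_slit_dom: "Fin z \<in> slit_dom \<longleftrightarrow> z \<notin> slits" by (auto simp: slit_dom_def)

lemma f_Fin: "z \<notin> slits \<Longrightarrow> f (Fin z) \<in> D"
  using fg Fin_in_slit_dom by (auto simp: homeomorphism_def)

lemma param_planar_map: "z \<notin> slits \<Longrightarrow> param_away (planar_map z) = f (Fin z)"
  using f_Fin pole_notin unfolding planar_map_def by (metis param_coord)

lemma planar_inv_map: "z \<notin> slits \<Longrightarrow> planar_inv (planar_map z) = z"
  using homeomorphism_apply1[OF fg] Fin_in_slit_dom by (simp add: planar_inv_def param_planar_map)

lemma open_Compl_slits: "open (- slits)"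
  using compact_slits by (simp add: compact_imp_closed open_Compl)

lemma planar_map_holomorphic: "planar_map holomorphic_on - slits"
proof (rule holomorphic_onI)
  fix z assume z: "z \<in> - slits"
  have "rot s t (f (Fin z)) \<noteq> Infty" using z f_Fin[of z] pole_notin by (auto simp: rot_eq_Infty)
  then have "(\<lambda>w. unfin (rot s t (f (Fin w)))) field_differentiable (at z)"
    using z Fin_in_slit_dom by (intro field_differentiable_unfin_rot[OF f open_slit_dom]) auto
  then show "planar_map field_differentiable (at z within - slits)"
    unfolding planar_map_def[abs_def] coord_def by (rule field_differentiable_at_within)
qed

lemma inj_planar_map: "inj_on planar_map (- slits)"
  by (rule inj_on_inverseI[of _ planar_inv]) (simp add: planar_inv_map)

lemma open_planar_image: "open planar_image"
  unfolding planar_image_def by (rule open_mapping_thm3[OF planar_map_holomorphic open_Compl_slits inj_planar_map])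

lemma planar_inv_holomorphic: "planar_inv holomorphic_on planar_image"
proof -
  obtain h where "h holomorphic_on planar_map ` (- slits)"
    and inv: "\<And>z. z \<in> - slits \<Longrightarrow> h (planar_map z) = z"
    by (rule holomorphic_has_inverse[OF planar_map_holomorphic open_Compl_slits inj_planar_map]) blast
  then have h: "h holomorphic_on planar_image" by (simp only: planar_image_def)
  show ?thesis
    by (rule holomorphic_transform[OF h]) (auto simp: planar_image_def inv planar_inv_map)
qed

lemma inj_planar_inv: "inj_on planar_inv planar_image"
  unfolding planar_image_def by (rule inj_onI) (auto simp: planar_inv_map)

lemma planar_image_mem: "w \<in> planar_image \<Longrightarrow> param_away w \<in> D \<and> planar_inv w \<notin> slits \<and> g (param_away w) = Fin (planar_inv w)"
proof -
  assume "w \<in> planar_image"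
  then obtain z where z: "z \<notin> slits" "w = planar_map z" by (auto simp: planar_image_def)
  then show ?thesis
    using f_Fin[OF z(1)] Fin_in_slit_dom[of z] homeomorphism_apply1[OF fg, of "Fin z"]
    by (simp add: param_planar_map planar_inv_map)
qed

text \<open>The source coordinate omits infinity, so \<open>f Infty\<close> is the one point of D
  without counterpart in the planar image.\<close>

lemma planar_imageI: 
  assumes "param_away w \<in> D" "param_away w \<noteq> f Infty"
  shows "w \<in> planar_image"
proof -
  obtain z where z: "g (param_away w) = Fin z"
  proof (cases "g (param_away w)")
    case Infty
    then show ?thesis using homeomorphism_apply2[OF fg assms(1)] assms(2) by simp
  qed (rule that)
  have "Fin z \<in> slit_dom" using fg assms z by (auto simp: homeomorphism_def)
  then have zs: "z \<notin> slits" by (simp add: Fin_in_slit_dom)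
  have "f (Fin z) = param_away w" using homeomorphism_apply2[OF fg assms(1)] z by simp
  then have "planar_map z = w" by (simp add: planar_map_def)
  then show ?thesis using zs unfolding planar_image_def by blast
qed

section \<open>Transported potentials and their derivatives\<close>

definition sphere_potential :: "nat \<Rightarrow> riemann_sphere \<Rightarrow> real" where
  "sphere_potential k x = (case x of Fin z \<Rightarrow> potential k z | Infty \<Rightarrow> 0)"

text \<open>The potential of level \<open>k\<close> transported to the circle domain. It is meaningless on the images of the
  slits of level \<open>k\<close>, on which the chosen representative matters.\<close>

definition pushed :: "nat \<Rightarrow> complex \<Rightarrow> real" where
  "pushed k z = sphere_potential k (SOME x. x \<in> bwd (hat_proj D (param_away z)))"

lemma pushed_image: 
  assumes "z \<in> planar_image" shows "pushed k z = potential k (planar_inv z)"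
proof -
  note * = planar_image_mem[OF assms]
  then have "bwd (hat_proj D (param_away z)) = {Fin (planar_inv z)}"
    by (simp add: hat_proj_def bwd_def)
  then show ?thesis by (simp add: pushed_def sphere_potential_def)
qed

text \<open>A saturated V contains the whole fibre, so the value does not depend on the
  representative picked by \<open>SOME\<close>.\<close>

lemma pushed_constant:
  assumes V: "open V" "frontier V \<inter> - slit_dom = {}" "\<And>x. x \<in> V \<Longrightarrow> sphere_potential k x = c"
    and z: "bwd (hat_proj D (param_away z)) \<in> hat_proj slit_dom ` V"
  shows "pushed k z = c"
proof -
  obtain x where x: "x \<in> V" "bwd (hat_proj D (param_away z)) = hat_proj slit_dom x" using z by blast
  define x' where "x' = (SOME x'. x' \<in> hat_proj slit_dom x)"
  have "x' \<in> hat_proj slit_dom x" unfolding x'_def by (rule someI[of _ x]) (rule hat_proj_mem)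
  then have "hat_proj slit_dom x' = hat_proj slit_dom x" by (rule hat_proj_eq_of_mem)
  then have "x' \<in> hat_proj slit_dom -` (hat_proj slit_dom ` V)" using x by auto
  then have "x' \<in> V" using openin_hat_saturated(2)[OF V(1,2)] by simp
  then show ?thesis using V(3) by (simp add: pushed_def x(2) x'_def)
qed

text \<open>Continuity of \<open>bwd\<close> between the quotient spaces enters here: the points
  sent into a saturated open set form an open set of the plane, however complicated the boundary of
  D may be.\<close>

lemma pushed_locally_constant:
  assumes V: "open V" "frontier V \<inter> - slit_dom = {}" "\<And>x. x \<in> V \<Longrightarrow> sphere_potential k x = c"
    and z: "bwd (hat_proj D (param_away z)) \<in> hat_proj slit_dom ` V"
  shows "(pushed k has_derivative (\<lambda>_. 0)) (at z)"
proof -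
  let ?W = "hat_proj slit_dom ` V"
  have "openin (hat_space slit_dom) ?W" using openin_hat_saturated(1)[OF V(1,2)] .
  moreover have "continuous_map (hat_space D) (hat_space slit_dom) bwd"
    using hat_homeomorphism by (simp add: homeomorphic_maps_def)
  ultimately have "openin (hat_space D) {P \<in> topspace (hat_space D). bwd P \<in> ?W}"
    by (simp add: openin_continuous_map_preimage)
  then have "open (hat_proj D -` {P \<in> topspace (hat_space D). bwd P \<in> ?W})" by (simp add: openin_hat_space)
  moreover have "hat_proj D -` {P \<in> topspace (hat_space D). bwd P \<in> ?W} = {y. bwd (hat_proj D y) \<in> ?W}"
    by (auto simp: topspace_hat_space)
  ultimately have "open {y. bwd (hat_proj D y) \<in> ?W}" by simp
  then have op: "open (param_away -` {y. bwd (hat_proj D y) \<in> ?W})"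
    using continuous_on_param by (rule open_vimage)
  show ?thesis
  proof (rule has_derivative_transform_within_open[of "\<lambda>_. c" _ _ _ "param_away -` {y. bwd (hat_proj D y) \<in> ?W}"])
    fix w assume "w \<in> param_away -` {y. bwd (hat_proj D y) \<in> ?W}"
    then show "c = pushed k w" using pushed_constant[OF V, of w] by simp
  qed (use op z in auto)
qed

text \<open>The bounding circles of the inner and outer neighbourhoods carry no slits, so both sets
  are saturated. Every component that is not a slit of level k lies in one of them, and the
  potential of level k is constant on each.\<close>

definition inner_nbhd :: "nat \<Rightarrow> riemann_sphere set" where
  "inner_nbhd k = Fin ` ball 0 (rad k - width k)"
definition outer_nbhd :: "nat \<Rightarrow> riemann_sphere set" where
  "outer_nbhd k = - Fin ` cball 0 (rad k + width k)"

lemma inner_radius: "1 < rad k - width k" "rad k - width k \<notin> range rad" "rad k + width k \<notin> range rad"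
proof -
  show "1 < rad k - width k" using rad_gt_1[of "Suc k"] width_pos[of k] by (simp add: rad_Suc)
  have "rad l \<noteq> rad k - width k \<and> rad l \<noteq> rad k + width k" for l
    using rad_sep_gt[of k l] rad_sep_lt[of l k] width_pos[of k] by (cases k l rule: linorder_cases) auto
  then show "rad k - width k \<notin> range rad" "rad k + width k \<notin> range rad" by (metis imageE)+
qed

lemma inner_nbhd:
  "open (inner_nbhd k)" "frontier (inner_nbhd k) \<inter> - slit_dom = {}" "x \<in> inner_nbhd k \<Longrightarrow> sphere_potential k x = 1"
proof -
  show "open (inner_nbhd k)" unfolding inner_nbhd_def by (rule open_Fin_image) simp
  have "sphere 0 (rad k - width k) \<inter> slits = {}" using inner_radius by (intro circle_avoids_slits)
  then show "frontier (inner_nbhd k) \<inter> - slit_dom = {}"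
    using frontier_Fin_ball[of "rad k - width k"] unfolding inner_nbhd_def slit_dom_def by auto
  show "x \<in> inner_nbhd k \<Longrightarrow> sphere_potential k x = 1"
    by (auto simp: inner_nbhd_def sphere_potential_def potential_inner)
qed

lemma outer_nbhd:
  "open (outer_nbhd k)" "frontier (outer_nbhd k) \<inter> - slit_dom = {}" "x \<in> outer_nbhd k \<Longrightarrow> sphere_potential k x = 0"
proof -
  show "open (outer_nbhd k)" unfolding outer_nbhd_def by (simp add: closed_Fin_cball open_Compl)
  have "1 < rad k + width k" using rad_gt_1[of k] width_pos[of k] by linarith
  then have "sphere 0 (rad k + width k) \<inter> slits = {}" using inner_radius by (intro circle_avoids_slits)
  then show "frontier (outer_nbhd k) \<inter> - slit_dom = {}"
    using frontier_Fin_cball[of "rad k + width k"] unfolding outer_nbhd_def slit_dom_def frontier_complement by auto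
  show "x \<in> outer_nbhd k \<Longrightarrow> sphere_potential k x = 0"
    by (cases x) (auto simp: outer_nbhd_def sphere_potential_def intro!: potential_outer)
qed

lemma comp_in_nbhd:
  assumes P: "P \<in> comps slit_dom" "\<And>j. j \<le> k \<Longrightarrow> P \<noteq> Fin ` slit k j"
  shows "P \<in> hat_proj slit_dom ` inner_nbhd k \<or> P \<in> hat_proj slit_dom ` outer_nbhd k"
proof -
  consider "P = unit_disk" | l i where "i \<le> l" "P = Fin ` slit l i"
    using P(1) by (auto simp: comps_slit_dom levels_def)
  then show ?thesis
  proof cases
    case 1
    have "Fin 0 \<in> P" using 1 by (auto simp: unit_disk_def)
    then have "P = hat_proj slit_dom (Fin 0)" using hat_proj_eq_comp[OF P(1)] by simp
    moreover have "Fin 0 \<in> inner_nbhd k" using inner_radius(1)[of k] by (auto simp: inner_nbhd_def)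
    ultimately show ?thesis by blast
  next
    case 2
    have lk: "l \<noteq> k" using P(2) 2 by blast
    obtain z where z: "z \<in> slit l i" using slit_compact_connected(3) by blast
    then have "cmod z = rad l" using slit_subset_sphere by fastforce
    have "Fin z \<in> P" using 2 z by blast
    then have Pz: "P = hat_proj slit_dom (Fin z)" using hat_proj_eq_comp[OF P(1)] by simp
    show ?thesis
    proof (cases "k < l")
      case True
      then have "Fin z \<in> inner_nbhd k"
        using rad_sep_gt[OF True] width_pos[of k] \<open>cmod z = rad l\<close> by (auto simp: inner_nbhd_def)
      then show ?thesis using Pz by blast
    next
      case False
      then have "Fin z \<in> outer_nbhd k"
        using rad_sep_lt[of l k] lk width_pos[of k] \<open>cmod z = rad l\<close> by (auto simp: outer_nbhd_def)
      then show ?thesis using Pz by blast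
    qed
  qed
qed

text \<open>On the planar image the chain rule applies. Any other point off the disks of level k is
  \<open>f Infty\<close> or belongs to a component that does not come from level k; around it
  \<open>pushed k\<close> is locally constant, whence the bound 0.\<close>

lemma pushed_deriv:
  assumes z: "\<And>j. j \<le> k \<Longrightarrow> param_away z \<notin> fwd (Fin ` slit k j)"
  shows "\<exists>A. (pushed k has_derivative A) (at z) \<and>
    (\<forall>u. \<bar>A u\<bar> \<le> (if z \<in> planar_image then cmod (deriv planar_inv z) * slit_density k (planar_inv z) else 0) * cmod u)"
proof (cases "z \<in> planar_image")
  case True
  have ns: "planar_inv z \<notin> slits" using planar_image_mem[OF True] by blast
  obtain A where A: "(potential k has_derivative A) (at (planar_inv z))"
    "\<And>h. \<bar>A h\<bar> \<le> slit_density k (planar_inv z) * cmod h" using potential_deriv[OF ns] by blast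
  have "(planar_inv has_field_derivative deriv planar_inv z) (at z)"
    using planar_inv_holomorphic open_planar_image True by (rule holomorphic_derivI)
  then have "(planar_inv has_derivative (*) (deriv planar_inv z)) (at z)" by (simp add: has_field_derivative_def)
  then have "((\<lambda>w. potential k (planar_inv w)) has_derivative (\<lambda>u. A (deriv planar_inv z * u))) (at z)"
    using A(1) by (rule has_derivative_compose)
  then have "(pushed k has_derivative (\<lambda>u. A (deriv planar_inv z * u))) (at z)"
    by (rule has_derivative_transform_within_open[OF _ open_planar_image True]) (simp add: pushed_image)
  moreover have "\<bar>A (deriv planar_inv z * u)\<bar> \<le> cmod (deriv planar_inv z) * slit_density k (planar_inv z) * cmod u" for u
    using A(2)[of "deriv planar_inv z * u"] by (simp add: norm_mult mult.commute mult.left_commute)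
  ultimately show ?thesis using True by auto
next
  case False
  define P where "P = bwd (hat_proj D (param_away z))"
  have "P \<in> hat_proj slit_dom ` inner_nbhd k \<or> P \<in> hat_proj slit_dom ` outer_nbhd k"
  proof (cases "param_away z \<in> D")
    case True
    then have "param_away z = f Infty" using False planar_imageI by blast
    moreover have Inf: "Infty \<in> slit_dom" by (auto simp: slit_dom_def)
    ultimately have "g (param_away z) = Infty" using homeomorphism_apply1[OF fg] by simp
    then have "P = hat_proj slit_dom Infty" using True Inf by (simp add: P_def hat_proj_def bwd_def)
    moreover have "Infty \<in> outer_nbhd k" by (auto simp: outer_nbhd_def)
    ultimately show ?thesis by blast
  next
    case nD: False
    then have q: "hat_proj D (param_away z) \<in> comps D" by (rule hat_proj_comps)
    have "P \<noteq> Fin ` slit k j" if "j \<le> k" for j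
    proof
      assume "P = Fin ` slit k j"
      then have "fwd (Fin ` slit k j) = hat_proj D (param_away z)" using fwd_bwd[OF q] by (simp add: P_def)
      then show False using z[OF that] hat_proj_mem[of "param_away z" D] by simp
    qed
    then show ?thesis using comp_in_nbhd bwd_comps[OF q] by (simp add: P_def)
  qed
  then have "(pushed k has_derivative (\<lambda>_. 0)) (at z)"
    using pushed_locally_constant[OF inner_nbhd] pushed_locally_constant[OF outer_nbhd] unfolding P_def by blast
  then show ?thesis using False by auto
qed

text \<open>A point component counts as a disk of radius 0, so that all components off
  \<open>pole\<close> are treated alike.\<close>

lemma planar_disk:
  assumes q: "q \<in> comps D" "pole \<notin> q"
  shows "\<exists>c r. 0 \<le> r \<and> param_away -` q = cball c r"
proof (cases "diameter q = 0")
  case True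
  obtain x where x: "x \<in> q" using comps_facts(3)[OF domain_D(2) q(1)] by blast
  have "y = x" if "y \<in> q" for y
    using diameter_bounded_bound[OF bounded_sphere that x] True by simp
  then have "q = {x}" using x by blast
  then have "param_away -` q = {coord x}"
    using param_coord[of x] x q(2) by (auto simp: vimage_def)
  then show ?thesis by (intro exI[of _ "coord x"] exI[of _ 0]) simp
next
  case False
  then have "0 < diameter q" using diameter_ge_0[OF bounded_sphere, of q] by simp
  then have "closed_disk q" using q D by (simp add: circle_domain_def comps_N_def)
  then obtain b r where b: "0 < r" "r < pi" "q = cball b r" by (auto simp: closed_disk_def)
  have "dist Infty (rot s t b) = dist pole b"
    using dist_rot[OF st, of pole b] by (simp add: pole_def)
  then have "r < dist Infty (rot s t b)" using q(2) b by (simp add: dist_commute)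
  then obtain c \<rho> where c: "0 \<le> \<rho>" "{z. dist (Fin z) (rot s t b) \<le> r} = cball c \<rho>"
    by (rule planar_trace_of_spherical_disk[OF less_imp_le[OF b(1)] less_imp_le[OF b(2)]])
  have "param_away -` q = {z. dist (Fin z) (rot s t b) \<le> r}"
    by (simp add: b(3) vimage_def dist_param[symmetric] dist_commute)
  then show ?thesis using c by blast
qed

lemma contradiction: False
proof -
  \<comment> \<open>The unit disk corresponds to a ball about \<open>pole\<close>, so everything
    beyond radius R belongs to its image. This confines the domain and all other disks to a bounded
    region.\<close>
  obtain R where R: "0 < R" "\<And>z. R \<le> cmod z \<Longrightarrow> dist (Fin z) Infty \<le> r0"
    using large_points_near_Infty[OF r0] by blast
  have "dist (param_away z) pole = dist (Fin z) Infty" for z by (simp add: dist_param pole_def)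
  then have far: "param_away z \<in> fwd unit_disk" if "R \<le> cmod z" for z
    using R(2)[OF that] by (simp add: fwd_disk dist_commute)
  have B: "fwd unit_disk \<in> comps D" by (rule fwd_comps[OF unit_disk_comps])
  have near: "cmod z < R" if "param_away z \<notin> fwd unit_disk" for z
    using far[of z] that by (cases "R \<le> cmod z") auto
  have imR: "planar_image \<subseteq> ball 0 R"
  proof
    fix z assume "z \<in> planar_image"
    then have "param_away z \<in> D" using planar_image_mem by blast
    then have "param_away z \<notin> fwd unit_disk" using comps_facts(4)[OF domain_D(2) B] by blast
    then show "z \<in> ball 0 R" using near by simp
  qed
  let ?q = "\<lambda>k j. fwd (Fin ` slit k j)"
  have q: "?q k j \<in> comps D" if "j \<le> k" for k j using fwd_comps[OF slit_comps[OF that]] .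
  have slit_ne: "Fin ` slit k j \<noteq> unit_disk" for k j
    using slit_outside_disk[of k j] slit_compact_connected(3)[of k j] by (auto simp: unit_disk_def inj_image_eq_iff inj_def)
  have slit_inj: "Fin ` slit k j \<noteq> Fin ` slit l i" if "j \<le> k" "i \<le> l" "(k, j) \<noteq> (l, i)" for k j l i
  proof
    assume "Fin ` slit k j = Fin ` slit l i"
    then have "slit k j = slit l i" by (simp add: inj_image_eq_iff inj_def)
    then show False using slit_disjoint[OF that] slit_compact_connected(3)[of k j] by simp
  qed
  have fwd_inj: "fwd P \<noteq> fwd Q" if "P \<in> comps slit_dom" "Q \<in> comps slit_dom" "P \<noteq> Q" for P Q
    using bwd_fwd that by metis
  have qB: "?q k j \<inter> fwd unit_disk = {}" if "j \<le> k" for k j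
    using comps_disjoint[OF q[OF that] B fwd_inj[OF slit_comps[OF that] unit_disk_comps slit_ne]] .
  have qq: "?q k j \<inter> ?q l i = {}" if "j \<le> k" "i \<le> l" "(k, j) \<noteq> (l, i)" for k j l i
    using comps_disjoint[OF q[OF that(1)] q[OF that(2)] fwd_inj[OF slit_comps[OF that(1)] slit_comps[OF that(2)] slit_inj[OF that]]] .
  have "\<exists>y. snd x \<le> fst x \<longrightarrow> 0 \<le> snd y \<and> param_away -` ?q (fst x) (snd x) = cball (fst y) (snd y)" for x
  proof (cases "snd x \<le> fst x")
    case True
    have "pole \<in> fwd unit_disk" using r0 by (simp add: fwd_disk)
    then have "pole \<notin> ?q (fst x) (snd x)" using qB[OF True] by blast
    then obtain c r where "0 \<le> r" "param_away -` ?q (fst x) (snd x) = cball c r"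
      using planar_disk[OF q[OF True]] by blast
    then show ?thesis by (intro exI[of _ "(c, r)"]) simp
  qed simp
  then have "\<exists>y. \<forall>x. snd x \<le> fst x \<longrightarrow>
      0 \<le> snd (y x) \<and> param_away -` ?q (fst x) (snd x) = cball (fst (y x)) (snd (y x))"
    by (intro choice allI)
  then obtain y where y: "\<And>x. snd x \<le> fst x \<Longrightarrow>
      0 \<le> snd (y x) \<and> param_away -` ?q (fst x) (snd x) = cball (fst (y x)) (snd (y x))" by blast
  define c where "c k j = fst (y (k, j))" for k j
  define r where "r k j = snd (y (k, j))" for k j
  have cr: "0 \<le> r k j \<and> param_away -` ?q k j = cball (c k j) (r k j)" if "j \<le> k" for k j
    using y[of "(k, j)"] that by (simp add: c_def r_def)
  \<comment> \<open>Every potential vanishes beyond radius 3, so the image of that exterior contains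
    one disk, independent of k, on which all transported potentials are 0. The point 4 is an
    arbitrary point of the exterior.\<close>
  have "open (- cball (0::complex) 3)" by (simp add: open_Compl)
  moreover have sub3: "- cball 0 3 \<subseteq> - slits"
  proof -
    have "slits \<subseteq> cball 0 2"
      unfolding slits_def using slit_subset_sphere rad_le_2 by fastforce
    then show ?thesis by (auto intro: order_trans)
  qed
  ultimately have "open (planar_map ` (- cball 0 3))"
    using holomorphic_on_subset[OF planar_map_holomorphic] inj_on_subset[OF inj_planar_map]
    by (intro open_mapping_thm3) auto
  moreover have "planar_map 4 \<in> planar_map ` (- cball 0 3)" by (intro imageI) simp
  ultimately obtain s0 where s0: "0 < s0" "ball (planar_map 4) s0 \<subseteq> planar_map ` (- cball 0 3)"
    using open_contains_ball by blast
  have w0: "pushed k z = 0" if zb: "z \<in> ball (planar_map 4) s0" for k z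
  proof -
    obtain u where u: "u \<in> - cball 0 3" "z = planar_map u" using subsetD[OF s0(2) zb] by (rule imageE)
    then have us: "u \<notin> slits" using sub3 by blast
    then have "z \<in> planar_image" using u by (auto simp: planar_image_def)
    then have "pushed k z = potential k u" using u us by (simp add: pushed_image planar_inv_map)
    moreover have "rad k + width k \<le> 3"
    proof -
      have "width k \<le> rad k - width k - 1 + width k" using inner_radius(1)[of k] by simp
      then show ?thesis using rad_le_2[of k] inner_radius(1)[of k] by linarith
    qed
    ultimately show ?thesis using u(1) by (simp add: potential_outer)
  qed
  have w1: "pushed k z = 1" if "R \<le> cmod z" for k z
  proof -
    have "hat_proj D (param_away z) = fwd unit_disk" using hat_proj_eq_comp[OF B far[OF that]] .
    then have "bwd (hat_proj D (param_away z)) = unit_disk" using bwd_fwd[OF unit_disk_comps] by simp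
    moreover have "unit_disk = hat_proj slit_dom (Fin 0)"
      using hat_proj_eq_comp[OF unit_disk_comps, of "Fin 0"] by (auto simp: unit_disk_def)
    moreover have "Fin 0 \<in> inner_nbhd k" using inner_radius(1)[of k] by (auto simp: inner_nbhd_def)
    ultimately show ?thesis using pushed_constant[OF inner_nbhd] by (metis imageI)
  qed
  \<comment> \<open>With this l the area term equals s0. Once l times the energy is at most s0 as
    well, at least half of the width 2 s0 of the family of lines must be covered by the
    disks.\<close>
  define l where "l = pi * R\<^sup>2 / s0"
  have l: "0 < l" using R s0 by (simp add: l_def)
  have level: "2 * s0 \<le> (l * (4 / real (k + 2)) + pi * R\<^sup>2 / l) / 2 + 2 * (\<Sum>j\<le>k. r k j)" for k
  proof (rule length_area_inequality[where S = planar_image and h = planar_inv and \<rho> = "slit_density k" and c = "c k" and w = "pushed k"])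
    fix z assume z: "z \<notin> (\<Union>j\<in>{..k}. cball (c k j) (r k j))"
    show "\<exists>A. (pushed k has_derivative A) (at z) \<and>
      (\<forall>u. \<bar>A u\<bar> \<le> (if z \<in> planar_image then cmod (deriv planar_inv z) * slit_density k (planar_inv z) else 0) * cmod u)"
    proof (rule pushed_deriv)
      fix j assume j: "j \<le> k"
      show "param_away z \<notin> ?q k j" using cr[OF j] z j by blast
    qed
  qed (use open_planar_image imR planar_inv_holomorphic inj_planar_inv slit_density_measurable slit_density_nonneg
      slit_density_energy cr w0 w1 s0 R l in auto)
  have plR: "pi * R\<^sup>2 / l = s0" using R s0 by (simp add: l_def)
  \<comment> \<open>The threshold on k makes l times the energy bound 4 / (k + 2) at most s0. The
    Cauchy-Schwarz inequality over k + 1 radii turns the lower bound s0 / 2 for their sum into one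
    for their squares.\<close>
  have sq: "s0\<^sup>2 / 4 * (1 / real (Suc k)) \<le> (\<Sum>j\<le>k. (r k j)\<^sup>2)" if k: "4 * l / s0 \<le> real (k + 2)" for k
  proof -
    have "4 * l \<le> real (k + 2) * s0" using k s0 by (simp only: pos_divide_le_eq)
    then have "l * (4 / real (k + 2)) \<le> s0" by (simp add: pos_divide_le_eq mult.commute)
    moreover have "2 * s0 \<le> (l * (4 / real (k + 2)) + s0) / 2 + 2 * (\<Sum>j\<le>k. r k j)"
      using level[of k] unfolding plR .
    ultimately have "2 * s0 \<le> (s0 + s0) / 2 + 2 * (\<Sum>j\<le>k. r k j)"
      by (meson add_right_mono divide_right_mono order_trans zero_le_numeral)
    then have "s0 / 2 \<le> (\<Sum>j\<le>k. r k j)" by simp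
    then have "(s0 / 2)\<^sup>2 \<le> (\<Sum>j\<le>k. r k j)\<^sup>2" using s0 by (intro power_mono) auto
    also have "\<dots> = (\<Sum>j\<le>k. r k j * 1)\<^sup>2" by simp
    also have "\<dots> \<le> (\<Sum>j\<le>k. (r k j)\<^sup>2) * (\<Sum>j\<le>k. 1\<^sup>2)" by (rule Cauchy_Schwarz_ineq_sum)
    finally have "s0\<^sup>2 / 4 \<le> (\<Sum>j\<le>k. (r k j)\<^sup>2) * real (Suc k)" by (simp add: power_divide)
    then have "s0\<^sup>2 / 4 / real (Suc k) \<le> (\<Sum>j\<le>k. (r k j)\<^sup>2)"
      by (subst pos_divide_le_eq) (simp_all only: of_nat_0_less_iff zero_less_Suc)
    then show ?thesis by simp
  qed
  \<comment> \<open>The disks are disjoint across all levels, so the area of the disk of radius R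
    bounds the partial sums uniformly in n.\<close>
  have total: "(\<Sum>k<n. \<Sum>j\<le>k. (r k j)\<^sup>2) \<le> R\<^sup>2" for n
  proof -
    let ?J = "SIGMA k:{..<n}. {..k}"
    have "(\<Sum>k<n. \<Sum>j\<le>k. (r k j)\<^sup>2) = (\<Sum>p\<in>?J. (r (fst p) (snd p))\<^sup>2)"
      by (subst sum.Sigma) (auto simp: case_prod_beta)
    also have "\<dots> \<le> R\<^sup>2"
    proof (rule sum_squares_disjoint_disks[where c = "\<lambda>p. c (fst p) (snd p)"])
      show "finite ?J" by simp
      fix p assume p: "p \<in> ?J"
      then have p1: "snd p \<le> fst p" by auto
      show "0 \<le> r (fst p) (snd p)" using cr[OF p1] by simp
      show "cball (c (fst p) (snd p)) (r (fst p) (snd p)) \<subseteq> ball 0 R"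
      proof
        fix z assume "z \<in> cball (c (fst p) (snd p)) (r (fst p) (snd p))"
        then have "param_away z \<in> ?q (fst p) (snd p)" using cr[OF p1] by blast
        then have "param_away z \<notin> fwd unit_disk" using qB[OF p1] by blast
        then show "z \<in> ball 0 R" using near by simp
      qed
      fix p' assume p': "p' \<in> ?J" "p \<noteq> p'"
      then have p2: "snd p' \<le> fst p'" by auto
      have "?q (fst p) (snd p) \<inter> ?q (fst p') (snd p') = {}"
        using qq[OF p1 p2] p'(2) by (simp add: prod_eq_iff)
      then show "cball (c (fst p) (snd p)) (r (fst p) (snd p)) \<inter> cball (c (fst p') (snd p')) (r (fst p') (snd p')) = {}"
        using cr[OF p1] cr[OF p2] by blast
    qed (rule R(1))
    finally show ?thesis .
  qed
  \<comment> \<open>From \<open>k0\<close> on, this convergent series dominates a positive multiple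
    of the harmonic series.\<close>
  have "summable (\<lambda>k. \<Sum>j\<le>k. (r k j)\<^sup>2)"
    by (rule summableI_nonneg_bounded[OF _ total]) (simp add: sum_nonneg)
  moreover obtain k0 :: nat where k0: "4 * l / s0 \<le> real k0" using real_arch_simple by blast
  have "norm (s0\<^sup>2 / 4 * (1 / real (Suc k))) \<le> (\<Sum>j\<le>k. (r k j)\<^sup>2)" if "k \<ge> k0" for k
    using sq[of k] k0 that by simp
  ultimately have "summable (\<lambda>k. s0\<^sup>2 / 4 * (1 / real (Suc k)))"
    by (rule summable_comparison_test')
  then have "s0\<^sup>2 / 4 = 0 \<or> summable (\<lambda>k. 1 / real (Suc k))" by (simp only: summable_cmult_iff)
  then have "summable (\<lambda>k. 1 / real (Suc k))" using s0 by auto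
  then have "summable (\<lambda>k. real (Suc k) powr (-1))" by (simp add: powr_minus_divide)
  then have "summable (\<lambda>k. real k powr (-1))" by (subst (asm) summable_Suc_iff)
  then show False unfolding summable_real_powr_iff by simp
qed

end

lemma (in slit_potential) unit_disk_collapses:
  assumes D: "circle_domain D" and cf: "conformal_homeo slit_dom D f"
  shows "hat_map slit_dom D f unit_disk \<in> comps_P D"
proof -
  obtain g where fg: "homeomorphism slit_dom D f g" and f: "sphere_holomorphic_on f slit_dom"
    using cf by (auto simp: conformal_homeo_def)
  have sD: "sphere_domain D" using D by (simp add: circle_domain_def)
  have ud: "unit_disk \<in> comps slit_dom" by (simp add: comps_slit_dom)
  have B: "hat_ext slit_dom D f unit_disk \<in> comps D"
    using hat_ext_ends_at[OF sphere_domain_slit_dom sD fg ud] by (simp add: ends_at_def)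
  have "diameter (hat_ext slit_dom D f unit_disk) = 0"
  proof (rule ccontr)
    assume "diameter (hat_ext slit_dom D f unit_disk) \<noteq> 0"
    then have "0 < diameter (hat_ext slit_dom D f unit_disk)"
      using diameter_ge_0[OF bounded_sphere, of "hat_ext slit_dom D f unit_disk"] by simp
    then have "closed_disk (hat_ext slit_dom D f unit_disk)"
      using B D by (simp add: circle_domain_def comps_N_def)
    then obtain a r where a: "0 < r" "hat_ext slit_dom D f unit_disk = cball a r" by (auto simp: closed_disk_def)
    obtain p q where pq: "(cmod p)\<^sup>2 + (cmod q)\<^sup>2 = 1" "a = homog p q" by (rule homog_exists)
    \<comment> \<open>The parameters handed to the locale are those of the inverse of
      \<open>rot p q\<close>, which moves a to infinity.\<close>
    have "a = rot (cnj (cnj p)) (- (- q)) Infty" by (simp add: rot_def pq)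
    then have "slit_uniformization \<beta> \<eta> \<phi> \<rho> D f g (cnj p) (- q) r"
      using D fg f pq a by unfold_locales auto
    then show False by (rule slit_uniformization.contradiction)
  qed
  then show ?thesis
    using B ud hat_map_eq(1)[OF sphere_domain_slit_dom sD fg]
    by (simp add: comps_P_def topspace_hat_space range_hat_proj)
qed

theorem theorem1p3:
  fixes \<alpha> :: real
  assumes "\<alpha> > 2"
  shows "\<exists>U. sphere_domain U \<and> countably_connected U \<and>
           (\<lambda>p. diameter p powr \<alpha>) summable_on comps U \<and>
           unit_disk \<in> comps_N U \<and>
           (\<forall>D f. circle_domain D \<and> conformal_homeo U D f \<longrightarrow>
                  hat_map U D f unit_disk \<in> comps_P D)"
proof -
  obtain \<beta> \<eta> \<phi> \<rho> where "slit_potential \<beta> \<eta> \<phi> \<rho>" using slit_potential_exists by blast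
  then interpret slit_potential \<beta> \<eta> \<phi> \<rho> .
  show ?thesis
    using sphere_domain_slit_dom countably_connected_slit_dom summable_diameters[OF assms] unit_disk_comps_N unit_disk_collapses
    by blast
qed

end
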